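(* The group $\mathrm{Diff}^\infty_{\mathrm{ap}}(\mathbb{R}^n)$ has a well-defined ($C^1_F$-smooth) Lie group exponential map $\mathrm{Exp}_{\mathrm{LG}}:C^\infty_{\mathrm{ap}}(\mathbb{R}^n,\mathbb{R}^n)\to\mathrm{Diff}^\infty_{\mathrm{ap}}(\mathbb{R}^n)$ such that $d_0\mathrm{Exp}_{\mathrm{LG}}=\mathrm{id}_{C^\infty_{\mathrm{ap}}}$ and, for every non-zero constant vector $c\in\mathbb{R}^n$ (viewed as a constant vector field), there exists a non-zero $\delta u\in C^\infty_{\mathrm{ap}}(\mathbb{R}^n,\mathbb{R}^n)$ with $(d_c\mathrm{Exp}_{\mathrm{LG}})(\delta u)=0$.
   Context: Hölder/almost periodic spaces: for integer $k\ge0$, $C^k_b(\mathbb{R}^n,\mathbb{R})$ is the space of $C^k$ functions with bounded continuous derivatives of order $\le k$, norm $|f|_k=\max_{|\beta|\le k}\sup|\partial^\beta f|$; $C^k_{\mathrm{ap}}=\{f\in C^k_b:\{f(\cdot+c)\}_{c\in\mathbb{R}^n}\text{ precompact in }C^k_b\}$; $C^\infty_{\mathrm{ap}}=\bigcap_{k\ge1}C^k_{\mathrm{ap}}$ with the Fréchet topology of the norms $|\cdot|_k$; vector-valued versions componentwise. $\mathrm{Diff}^\infty_{\mathrm{ap}}(\mathbb{R}^n)$ is the group (under composition) of maps $\varphi=\mathrm{id}+f$ with $f\in C^\infty_{\mathrm{ap}}(\mathbb{R}^n,\mathbb{R}^n)$ and $\inf_x\det(I+[d_xf])>0$, with the Fréchet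 topology of $f$. For $u\in C^\infty_{\mathrm{ap}}(\mathbb{R}^n,\mathbb{R}^n)$, $\mathrm{Exp}_{\mathrm{LG}}(u)=\varphi(1)$ where $\varphi\in C^1_F([0,\infty),\mathrm{Diff}^\infty_{\mathrm{ap}}(\mathbb{R}^n))$ is the unique solution of $\dot\varphi=u\circ\varphi$, $\varphi(0)=\mathrm{id}$. $C^1_F$ means Fréchet continuously differentiable: directional derivatives $d_xF(h)=\lim_{\varepsilon\to0}(F(x+\varepsilon h)-F(x))/\varepsilon$ exist and $(x,h)\mapsto d_xF(h)$ is continuous. *)

theory Defs
  imports "HOL-Analysis.Analysis"
begin

definition pd :: "'n::finite \<Rightarrow> (real^'n \<Rightarrow> real) \<Rightarrow> real^'n \<Rightarrow> real" where
  "pd i g x = deriv (\<lambda>t. g (x + t *\<^sub>R axis i 1)) 0"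

text \<open>Iterated partial derivative; the list encodes the multi-index (order = length).\<close>
fun pdl :: "'n::finite list \<Rightarrow> (real^'n \<Rightarrow> real) \<Rightarrow> real^'n \<Rightarrow> real" where
  "pdl [] g = g"
| "pdl (i # js) g = pd i (pdl js g)"

definition Ckb :: "nat \<Rightarrow> (real^'n::finite \<Rightarrow> real) \<Rightarrow> bool" where
  "Ckb k g \<longleftrightarrow>
     (\<forall>js::'n list. length js \<le> k \<longrightarrow>
        continuous_on UNIV (pdl js g) \<and> bounded (range (pdl js g))) \<and>
     (\<forall>(js::'n list) i x. length js < k \<longrightarrow>
        ((\<lambda>t. pdl js g (x + t *\<^sub>R axis i 1)) has_real_derivative pdl (i # js) g x) (at 0))"

definition normk :: "nat \<Rightarrow> (real^'n::finite \<Rightarrow> real) \<Rightarrow> real" where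
  "normk k g = (SUP p \<in> {js::'n list. length js \<le> k} \<times> UNIV. \<bar>pdl (fst p) g (snd p)\<bar>)"

text \<open>C^k_ap: the family of translates is precompact in C^k_b (sequential relative compactness
  in the normed space C^k_b).\<close>
definition Ckap :: "nat \<Rightarrow> (real^'n::finite \<Rightarrow> real) \<Rightarrow> bool" where
  "Ckap k g \<longleftrightarrow> Ckb k g \<and>
     (\<forall>c :: nat \<Rightarrow> real^'n. \<exists>r h. strict_mono r \<and> Ckb k h \<and>
        (\<lambda>m. normk k (\<lambda>x. g (x + c (r m)) - h x)) \<longlonglongrightarrow> 0)"

definition comp_fun :: "(real^'n::finite \<Rightarrow> real^'n) \<Rightarrow> 'n \<Rightarrow> real^'n \<Rightarrow> real" where
  "comp_fun f j = (\<lambda>x. f x $ j)"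

definition Cinf_ap :: "(real^'n::finite \<Rightarrow> real^'n) set" where
  "Cinf_ap = {f. \<forall>k\<ge>1. \<forall>j. Ckap k (comp_fun f j)}"

definition vnormk :: "nat \<Rightarrow> (real^'n::finite \<Rightarrow> real^'n) \<Rightarrow> real" where
  "vnormk k f = Max (range (\<lambda>j. normk k (comp_fun f j)))"

definition ap_tendsto ::
  "('a \<Rightarrow> (real^'n::finite \<Rightarrow> real^'n)) \<Rightarrow> (real^'n \<Rightarrow> real^'n) \<Rightarrow> 'a filter \<Rightarrow> bool" where
  "ap_tendsto F l net \<longleftrightarrow> l \<in> Cinf_ap \<and> eventually (\<lambda>e. F e \<in> Cinf_ap) net \<and>
     (\<forall>k. ((\<lambda>e. vnormk k (\<lambda>x. F e x - l x)) \<longlongrightarrow> 0) net)"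

definition has_dd ::
  "((real^'n::finite \<Rightarrow> real^'n) \<Rightarrow> (real^'n \<Rightarrow> real^'n)) \<Rightarrow> (real^'n \<Rightarrow> real^'n)
     \<Rightarrow> (real^'n \<Rightarrow> real^'n) \<Rightarrow> (real^'n \<Rightarrow> real^'n) \<Rightarrow> bool" where
  "has_dd F x h L \<longleftrightarrow>
     ap_tendsto (\<lambda>e. (\<lambda>y. (1 / e) *\<^sub>R (F (\<lambda>z. x z + e *\<^sub>R h z) y - F x y))) L (at 0)"

text \<open>C^1_F maps C^\<infinity>_ap \<rightarrow> C^\<infinity>_ap: all directional derivatives exist and (x,h) \<mapsto> d_xF(h)
  is continuous (the Fr\'echet space is metrizable, so sequential continuity is used).\<close>
definition C1F_ap ::
  "((real^'n::finite \<Rightarrow> real^'n) \<Rightarrow> (real^'n \<Rightarrow> real^'n)) \<Rightarrow> bool" where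
  "C1F_ap F \<longleftrightarrow> (\<forall>x\<in>Cinf_ap. F x \<in> Cinf_ap) \<and>
     (\<exists>D. (\<forall>x\<in>Cinf_ap. \<forall>h\<in>Cinf_ap. has_dd F x h (D x h)) \<and>
          (\<forall>xs hs x h. (\<forall>m. xs m \<in> Cinf_ap \<and> hs m \<in> Cinf_ap) \<longrightarrow> x \<in> Cinf_ap \<longrightarrow> h \<in> Cinf_ap \<longrightarrow>
              ap_tendsto xs x sequentially \<longrightarrow> ap_tendsto hs h sequentially \<longrightarrow>
              ap_tendsto (\<lambda>m. D (xs m) (hs m)) (D x h) sequentially))"

definition jac :: "(real^'n::finite \<Rightarrow> real^'n) \<Rightarrow> real^'n \<Rightarrow> real^'n^'n" where
  "jac f x = (\<chi> i j. pd j (comp_fun f i) x)"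

definition Diff_ap :: "(real^'n::finite \<Rightarrow> real^'n) set" where
  "Diff_ap = {\<phi>. (\<lambda>x. \<phi> x - x) \<in> Cinf_ap \<and>
                  (INF x. det (mat 1 + jac (\<lambda>y. \<phi> y - y) x)) > 0}"

text \<open>phi : [0,\<infinity>) \<rightarrow> Diff^\<infinity>_ap is a C^1_F solution of dphi/dt = u \<circ> phi, phi(0) = id
  (differentiability measured in the chart phi \<mapsto> phi - id; one-sided at t = 0).\<close>
definition is_flow :: "(real^'n::finite \<Rightarrow> real^'n) \<Rightarrow> (real \<Rightarrow> real^'n \<Rightarrow> real^'n) \<Rightarrow> bool" where
  "is_flow u \<phi> \<longleftrightarrow>
     (\<forall>t\<ge>0. \<phi> t \<in> Diff_ap) \<and> \<phi> 0 = id \<and>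
     (\<forall>t\<ge>0. ap_tendsto (\<lambda>s. (\<lambda>x. (1 / (s - t)) *\<^sub>R (\<phi> s x - \<phi> t x)))
                         (\<lambda>x. u (\<phi> t x)) (at t within {0..})) \<and>
     (\<forall>t\<ge>0. ap_tendsto (\<lambda>s. (\<lambda>x. u (\<phi> s x))) (\<lambda>x. u (\<phi> t x)) (at t within {0..}))"

definition Exp_LG :: "(real^'n::finite \<Rightarrow> real^'n) \<Rightarrow> (real^'n \<Rightarrow> real^'n)" where
  "Exp_LG u = (SOME \<phi>. is_flow u \<phi>) 1"

end

theory Submission
  imports Defs
begin

text \<open>Precompactness in all \<open>C^k\<close> norms reduces to \<open>C^0\<close>: by the interpolation inequality a family
  bounded in every \<open>C^k\<close> that converges uniformly converges together with all derivatives.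
  Smoothness of flows, uniformly over bounded families of vector fields, comes from
  the Euler scheme: its iterates are bounded in every \<open>C^k\<close> by a discrete Gronwall argument and
  converge pointwise to the flow. Everything else is read off the operator
  \<open>A(u,v,h)(x) = \<integral>\<^sub>0\<^sup>1 D\<phi>\<^sup>u\<^sub>1\<^sub>-\<^sub>s(\<phi>\<^sup>v\<^sub>s x) (h(\<phi>\<^sup>v\<^sub>s x)) ds\<close>. It commutes with translations and is continuous, hence
  preserves almost periodicity, and the Alekseev-Groebner formula \<open>\<phi>\<^sup>v\<^sub>1 - \<phi>\<^sup>u\<^sub>1 = A(u,v,v-u)\<close> turns
  difference quotients of the flow, both in time and in the vector field, into values of \<open>A\<close>;
  in particular \<open>d\<^sub>uExp(h) = A(u,u,h)\<close>. For a constant field \<open>c\<close> this is the average of \<open>h\<close> over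
  the segment from \<open>x\<close> to \<open>x + c\<close>, which vanishes for \<open>h(x) = cos(2\<pi>\<langle>c,x\<rangle>/\<langle>c,c\<rangle>) c\<close>.\<close>

section \<open>Uniformly bounded families of smooth functions\<close>

text \<open>The obstacle is that Frechet spaces have neither a general existence theorem for
  differential equations nor a mean value calculus as convenient as that of Banach spaces. Smooth
  dependence is therefore not read off a variational equation: Euler iterates are built from
  finitely many sums and compositions, hence smooth at once, and bounds of every order pass to
  pointwise limits. The bounds are stated for families over an arbitrary index set, so that
  uniformity in time, in a sequence of fields, in translations or in the step number is only a
  choice of that set. In \<open>bdd_Ck\<close> the derivative is evaluated in a fixed direction
  before the next one is taken; each order then again consists of functions into the same space, and
  no operator-valued derivatives arise. Time becomes a scalar factor, since the flow of u at time t
  is the flow of t u at time 1. The Alekseev-Groebner formula has no remainder: a difference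
  quotient is exactly a value of A, so differentiability is continuity of A. Moreover A(tu,tu,u) is
  u composed with its flow at time t, so composition with a flow needs no theory of its own.\<close>

primrec bdd_Ck :: "nat \<Rightarrow> 'i set \<Rightarrow> ('i \<Rightarrow> 'a::euclidean_space \<Rightarrow> 'b::euclidean_space) \<Rightarrow> bool" where
  "bdd_Ck 0 I f \<longleftrightarrow> (\<exists>M. \<forall>i\<in>I. \<forall>x. norm (f i x) \<le> M)"
| "bdd_Ck (Suc k) I f \<longleftrightarrow> (\<exists>M. \<forall>i\<in>I. \<forall>x. norm (f i x) \<le> M) \<and>
     (\<exists>f'. (\<forall>i\<in>I. \<forall>x. (f i has_derivative f' i x) (at x)) \<and>
           (\<forall>v. bdd_Ck k I (\<lambda>i x. f' i x v)))"

definition bdd_Cinf :: "'i set \<Rightarrow> ('i \<Rightarrow> 'a::euclidean_space \<Rightarrow> 'b::euclidean_space) \<Rightarrow> bool" where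
  "bdd_Cinf I f \<longleftrightarrow> (\<forall>k. bdd_Ck k I f)"

abbreviation fd :: "('a::euclidean_space \<Rightarrow> 'b::euclidean_space) \<Rightarrow> 'a \<Rightarrow> 'a \<Rightarrow> 'b" where
  "fd f x \<equiv> frechet_derivative f (at x)"

lemma linear_Basis_expand:
  fixes L :: "'a::euclidean_space \<Rightarrow> 'b::real_vector"
  assumes "linear L"
  shows "L v = (\<Sum>b\<in>Basis. (v \<bullet> b) *\<^sub>R L b)"
proof -
  have "L v = L (\<Sum>b\<in>Basis. (v \<bullet> b) *\<^sub>R b)"
    by (simp add: euclidean_representation)
  then show ?thesis
    using assms by (simp add: linear_sum linear_scale)
qed

text \<open>\<open>bdd_Ck\<close> controls derivatives only in fixed directions. A direction that
  varies with the point is expanded in the basis, which leaves fixed-direction derivatives with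
  scalar coefficients.\<close>

lemma has_derivative_Basis_expand:
  assumes "(f has_derivative f') (at (x::'a::euclidean_space))"
  shows "f' v = (\<Sum>b\<in>Basis. (v \<bullet> b) *\<^sub>R f' b)"
  using assms by (intro linear_Basis_expand has_derivative_linear)

lemma bdd_Ck_bounded:
  assumes "bdd_Ck k I f"
  obtains M where "M \<ge> 0" "\<And>i x. i \<in> I \<Longrightarrow> norm (f i x) \<le> M"
proof -
  obtain M where M: "\<forall>i\<in>I. \<forall>x. norm (f i x) \<le> M"
    using assms by (cases k) auto
  have "norm (f i x) \<le> max M 0" if "i \<in> I" for i x
    using M that by (meson max.coboundedI1)
  then show thesis using that[of "max M 0"] by auto
qed

lemma bdd_Ck_cong:
  assumes "bdd_Ck k I f" "\<And>i x. i \<in> I \<Longrightarrow> f i x = g i x"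
  shows "bdd_Ck k I g"
proof -
  have fg: "\<And>i. i \<in> I \<Longrightarrow> g i = f i" using assms(2) by (simp add: fun_eq_iff)
  show ?thesis using assms(1) by (cases k) (auto simp: fg)
qed

lemma bdd_Ck_SucD: "bdd_Ck (Suc k) I f \<Longrightarrow> bdd_Ck k I f"
proof (induction k arbitrary: f)
  case (Suc k)
  then obtain f' where f': "\<forall>i\<in>I. \<forall>x. (f i has_derivative f' i x) (at x)"
    "\<forall>v. bdd_Ck (Suc k) I (\<lambda>i x. f' i x v)"
    using bdd_Ck.simps(2)[of "Suc k" I f] by blast
  then have "\<forall>v. bdd_Ck k I (\<lambda>i x. f' i x v)" using Suc.IH by blast
  then show ?case using bdd_Ck.simps(2)[of k I f] bdd_Ck.simps(2)[of "Suc k" I f] Suc.prems f' by blast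
qed simp

lemma bdd_Ck_reindex:
  assumes "bdd_Ck k I f" "\<And>j. j \<in> J \<Longrightarrow> s j \<in> I"
  shows "bdd_Ck k J (\<lambda>j. f (s j))"
  using assms
proof (induction k arbitrary: f)
  case 0 then show ?case by auto
next
  case (Suc k)
  then obtain f' M where f': "\<forall>i\<in>I. \<forall>x. (f i has_derivative f' i x) (at x)"
    "\<forall>v. bdd_Ck k I (\<lambda>i x. f' i x v)" and M: "\<forall>i\<in>I. \<forall>x. norm (f i x) \<le> M"
    using bdd_Ck.simps(2)[of k I f] by blast
  have "\<forall>v. bdd_Ck k J (\<lambda>j x. f' (s j) x v)"
    using Suc.IH[of "\<lambda>i x. f' i x _"] f' Suc.prems(2) by blast
  then show ?case unfolding bdd_Ck.simps
    using f'(1) M Suc.prems(2) by (intro conjI exI[of _ M] exI[of _ "\<lambda>j. f' (s j)"]) auto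
qed

text \<open>The derivative hidden in the existential of \<open>bdd_Ck\<close> is unique, so any
  other presentation of it, in particular \<open>fd\<close>, inherits its bounds.\<close>

lemma bdd_Ck_deriv:
  assumes "bdd_Ck (Suc k) I f" "\<And>i x. i \<in> I \<Longrightarrow> (f i has_derivative f' i x) (at x)"
  shows "bdd_Ck k I (\<lambda>i x. f' i x v)"
proof -
  obtain f1 where f1: "\<forall>i\<in>I. \<forall>x. (f i has_derivative f1 i x) (at x)"
    "\<forall>v. bdd_Ck k I (\<lambda>i x. f1 i x v)"
    using assms(1) bdd_Ck.simps(2)[of k I f] by blast
  have "f1 i x = f' i x" if "i \<in> I" for i x
    using f1(1) assms(2) that by (blast intro: has_derivative_unique)
  then show ?thesis using f1(2) by (auto intro: bdd_Ck_cong)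
qed

lemma bdd_Ck_SucI:
  assumes "\<And>i x. i \<in> I \<Longrightarrow> norm (f i x) \<le> M"
    and "\<And>i x. i \<in> I \<Longrightarrow> (f i has_derivative f' i x) (at x)"
    and "\<And>v. bdd_Ck k I (\<lambda>i x. f' i x v)"
  shows "bdd_Ck (Suc k) I f"
  unfolding bdd_Ck.simps
  by (intro conjI exI[of _ M] exI[of _ f'] ballI allI assms)

lemma bdd_Ck_SucE:
  assumes "bdd_Ck (Suc k) I f"
  obtains f' where "\<And>i x. i \<in> I \<Longrightarrow> (f i has_derivative f' i x) (at x)"
    "\<And>v. bdd_Ck k I (\<lambda>i x. f' i x v)"
proof -
  from assms obtain f' where "\<forall>i\<in>I. \<forall>x. (f i has_derivative f' i x) (at x)"
    "\<forall>v. bdd_Ck k I (\<lambda>i x. f' i x v)"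
    unfolding bdd_Ck.simps by (elim conjE exE)
  then show thesis by (intro that[of f']) simp_all
qed

lemma bdd_Ck_const:
  fixes c :: "'i \<Rightarrow> 'b::euclidean_space"
  assumes "\<And>i. i \<in> I \<Longrightarrow> norm (c i) \<le> M"
  shows "bdd_Ck k I (\<lambda>i (x::'a::euclidean_space). c i)"
  using assms
proof (induction k arbitrary: c M)
  case (Suc k)
  show ?case
  proof (rule bdd_Ck_SucI)
    show "norm (c i) \<le> M" if "i \<in> I" for i using Suc.prems that by blast
    show "((\<lambda>x::'a. c i) has_derivative (\<lambda>v. 0)) (at x)" for i x by (rule has_derivative_const)
    show "bdd_Ck k I (\<lambda>i (x::'a). 0::'b)" by (rule Suc.IH[of "\<lambda>_. 0" 0]) simp
  qed
qed auto

lemma bdd_Ck_bounded_linear: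
  assumes T: "bounded_linear T" and "bdd_Ck k I f"
  shows "bdd_Ck k I (\<lambda>i x. T (f i x))"
proof -
  obtain K where K: "\<And>x. norm (T x) \<le> norm x * K" "K \<ge> 0"
    using bounded_linear.nonneg_bounded[OF T] by blast
  have bd: "\<exists>M. \<forall>i\<in>I. \<forall>x. norm (T (f i x)) \<le> M" if f: "bdd_Ck k I f" for k f
  proof -
    obtain M where "M \<ge> 0" "\<And>i x. i \<in> I \<Longrightarrow> norm (f i x) \<le> M"
      by (rule bdd_Ck_bounded[OF f]) (rule that)
    then have "norm (T (f i x)) \<le> M * K" if "i \<in> I" for i x
      using that by (intro order_trans[OF K(1)] mult_right_mono K(2)) auto
    then show ?thesis by blast
  qed
  show ?thesis using assms(2)
  proof (induction k arbitrary: f)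
    case 0 then show ?case using bd[OF 0] by simp
  next
    case (Suc k)
    obtain M where M: "\<forall>i\<in>I. \<forall>x. norm (T (f i x)) \<le> M" using bd[OF Suc.prems] by blast
    from Suc.prems obtain f' where f': "\<And>i x. i \<in> I \<Longrightarrow> (f i has_derivative f' i x) (at x)"
      "\<And>v. bdd_Ck k I (\<lambda>i x. f' i x v)" by (rule bdd_Ck_SucE) (rule that)
    show ?case
    proof (rule bdd_Ck_SucI)
      show "((\<lambda>x. T (f i x)) has_derivative (\<lambda>v. T (f' i x v))) (at x)" if "i \<in> I" for i x
        using bounded_linear.has_derivative[OF T f'(1)[OF that]] by simp
      show "norm (T (f i x)) \<le> M" if "i \<in> I" for i x using M that by blast
      show "bdd_Ck k I (\<lambda>i x. T (f' i x v))" for v by (rule Suc.IH[OF f'(2)])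
    qed
  qed
qed

lemma bdd_Ck_add:
  assumes "bdd_Ck k I f1" "bdd_Ck k I f2"
  shows "bdd_Ck k I (\<lambda>i x. f1 i x + f2 i x)"
  using assms
proof (induction k arbitrary: f1 f2)
  case 0
  then obtain M1 M2 where "\<forall>i\<in>I. \<forall>x. norm (f1 i x) \<le> M1" "\<forall>i\<in>I. \<forall>x. norm (f2 i x) \<le> M2"
    by auto
  then have "\<forall>i\<in>I. \<forall>x. norm (f1 i x + f2 i x) \<le> M1 + M2"
    by (intro ballI allI norm_triangle_mono) simp_all
  then show ?case unfolding bdd_Ck.simps by (rule exI)
next
  case (Suc k)
  obtain M1 where M1: "\<And>i x. i \<in> I \<Longrightarrow> norm (f1 i x) \<le> M1"
    by (rule bdd_Ck_bounded[OF Suc.prems(1)]) (rule that)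
  obtain M2 where M2: "\<And>i x. i \<in> I \<Longrightarrow> norm (f2 i x) \<le> M2"
    by (rule bdd_Ck_bounded[OF Suc.prems(2)]) (rule that)
  from Suc.prems(1) obtain f1' where f1': "\<And>i x. i \<in> I \<Longrightarrow> (f1 i has_derivative f1' i x) (at x)"
    "\<And>v. bdd_Ck k I (\<lambda>i x. f1' i x v)" by (rule bdd_Ck_SucE) (rule that)
  from Suc.prems(2) obtain f2' where f2': "\<And>i x. i \<in> I \<Longrightarrow> (f2 i has_derivative f2' i x) (at x)"
    "\<And>v. bdd_Ck k I (\<lambda>i x. f2' i x v)" by (rule bdd_Ck_SucE) (rule that)
  show ?case
  proof (rule bdd_Ck_SucI)
    show "norm (f1 i x + f2 i x) \<le> M1 + M2" if "i \<in> I" for i x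
      using M1[OF that] M2[OF that] by (rule norm_triangle_mono)
    show "((\<lambda>x. f1 i x + f2 i x) has_derivative (\<lambda>v. f1' i x v + f2' i x v)) (at x)" if "i \<in> I" for i x
      using f1'(1)[OF that] f2'(1)[OF that] by (rule has_derivative_add)
    show "bdd_Ck k I (\<lambda>i x. f1' i x v + f2' i x v)" for v
      by (rule Suc.IH[OF f1'(2) f2'(2)])
  qed
qed

lemma bdd_Ck_bilinear:
  assumes P: "bounded_bilinear P" and "bdd_Ck k I f" "bdd_Ck k I g"
  shows "bdd_Ck k I (\<lambda>i x. P (f i x) (g i x))"
proof -
  interpret bounded_bilinear P by (rule P)
  obtain K where K: "\<And>x y. norm (P x y) \<le> norm x * norm y * K" "K \<ge> 0"
    using nonneg_bounded by blast
  have bd: "\<exists>M. \<forall>i\<in>I. \<forall>x. norm (P (f i x) (g i x)) \<le> M" if f: "bdd_Ck k I f" and g: "bdd_Ck k I g" for k f g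
  proof -
    obtain M1 where M1: "M1 \<ge> 0" "\<And>i x. i \<in> I \<Longrightarrow> norm (f i x) \<le> M1"
      by (rule bdd_Ck_bounded[OF f]) (rule that)
    obtain M2 where M2: "M2 \<ge> 0" "\<And>i x. i \<in> I \<Longrightarrow> norm (g i x) \<le> M2"
      by (rule bdd_Ck_bounded[OF g]) (rule that)
    have "norm (P (f i x) (g i x)) \<le> M1 * M2 * K" if "i \<in> I" for i x
      by (rule order_trans[OF K(1)]) (intro mult_mono M1 M2 that K mult_nonneg_nonneg norm_ge_zero order_refl)
    then show ?thesis by blast
  qed
  show "bdd_Ck k I (\<lambda>i x. P (f i x) (g i x))"
    using assms(2,3)
  proof (induction k arbitrary: f g)
    case 0 then show ?case using bd[OF 0] by simp
  next
    case (Suc k)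
    obtain M where M: "\<forall>i\<in>I. \<forall>x. norm (P (f i x) (g i x)) \<le> M" using bd[OF Suc.prems] by blast
    from Suc.prems(1) obtain f' where f': "\<And>i x. i \<in> I \<Longrightarrow> (f i has_derivative f' i x) (at x)"
      "\<And>v. bdd_Ck k I (\<lambda>i x. f' i x v)" by (rule bdd_Ck_SucE) (rule that) 
    from Suc.prems(2) obtain g' where g': "\<And>i x. i \<in> I \<Longrightarrow> (g i has_derivative g' i x) (at x)"
      "\<And>v. bdd_Ck k I (\<lambda>i x. g' i x v)" by (rule bdd_Ck_SucE) (rule that) 
    show ?case
    proof (rule bdd_Ck_SucI)
      show "norm (P (f i x) (g i x)) \<le> M" if "i \<in> I" for i x using M that by auto
      show "((\<lambda>x. P (f i x) (g i x)) has_derivative (\<lambda>v. P (f i x) (g' i x v) + P (f' i x v) (g i x))) (at x)"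
        if "i \<in> I" for i x
        using FDERIV[OF f'(1)[OF that] g'(1)[OF that]] by simp
      show "bdd_Ck k I (\<lambda>i x. P (f i x) (g' i x v) + P (f' i x v) (g i x))" for v
        by (intro bdd_Ck_add Suc.IH f'(2) g'(2) bdd_Ck_SucD[OF Suc.prems(1)] bdd_Ck_SucD[OF Suc.prems(2)])
    qed
  qed
qed

lemma bdd_Ck_sum:
  assumes "finite A" "\<And>a. a \<in> A \<Longrightarrow> bdd_Ck k I (f a)"
  shows "bdd_Ck k I (\<lambda>i x. \<Sum>a\<in>A. f a i x)"
  using assms
proof (induction A rule: finite_induct)
  case empty
  show ?case using bdd_Ck_const[of I "\<lambda>_. 0" 0 k] by simp
next
  case (insert a A)
  then have "bdd_Ck k I (\<lambda>i x. f a i x + (\<Sum>a\<in>A. f a i x))"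
    by (intro bdd_Ck_add) simp_all
  then show ?case using insert by simp
qed

lemma bdd_Ck_inner_const: "bdd_Ck k I f \<Longrightarrow> bdd_Ck k I (\<lambda>i x. f i x \<bullet> b)"
  by (rule bdd_Ck_bounded_linear[OF bounded_linear_inner_left])

lemma bdd_Ck_Basis_expand:
  assumes "bdd_Ck k I w" "\<And>b. b \<in> Basis \<Longrightarrow> bdd_Ck k I (a b)"
  shows "bdd_Ck k I (\<lambda>i x. \<Sum>b\<in>Basis. (w i x \<bullet> b) *\<^sub>R a b i x)"
  by (intro bdd_Ck_sum bdd_Ck_bilinear[OF bounded_bilinear_scaleR] bdd_Ck_inner_const assms finite_Basis)

text \<open>The inner map is the identity plus g because a flow is unbounded as a map; only its
  displacement lies in \<open>bdd_Ck\<close>.\<close>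

lemma bdd_Ck_comp:
  fixes u :: "'i \<Rightarrow> 'a::euclidean_space \<Rightarrow> 'b::euclidean_space"
  assumes "bdd_Ck k I u" "bdd_Ck k I g"
  shows "bdd_Ck k I (\<lambda>i x. u i (x + g i x))"
  using assms
proof (induction k arbitrary: u)
  case 0 then show ?case by auto
next
  case (Suc k)
  obtain M where M: "\<And>i x. i \<in> I \<Longrightarrow> norm (u i x) \<le> M"
    by (rule bdd_Ck_bounded[OF Suc.prems(1)]) (rule that)
  obtain u' where u': "\<And>i x. i \<in> I \<Longrightarrow> (u i has_derivative u' i x) (at x)"
    "\<And>v. bdd_Ck k I (\<lambda>i x. u' i x v)" by (rule bdd_Ck_SucE[OF Suc.prems(1)]) (rule that)
  obtain g' where g': "\<And>i x. i \<in> I \<Longrightarrow> (g i has_derivative g' i x) (at x)"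
    "\<And>v. bdd_Ck k I (\<lambda>i x. g' i x v)" by (rule bdd_Ck_SucE[OF Suc.prems(2)]) (rule that)
  show ?case
  proof (rule bdd_Ck_SucI)
    show "norm (u i (x + g i x)) \<le> M" if "i \<in> I" for i x using M[OF that] .
    \<comment> \<open>The chain rule differentiates u in the moving direction v + g' v. Its
      expansion in the basis lets the induction hypothesis apply to u' in fixed directions.\<close>
    show "((\<lambda>x. u i (x + g i x)) has_derivative
       (\<lambda>v. \<Sum>b\<in>Basis. ((v + g' i x v) \<bullet> b) *\<^sub>R u' i (x + g i x) b)) (at x)" if i: "i \<in> I" for i x
    proof -
      have "((\<lambda>x. x + g i x) has_derivative (\<lambda>v. v + g' i x v)) (at x)"
        by (intro has_derivative_add has_derivative_ident g'(1) i)
      from has_derivative_compose[OF this u'(1)[OF i]]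
      show ?thesis
        by (rule has_derivative_eq_rhs)
          (intro ext has_derivative_Basis_expand[OF u'(1)[OF i]])
    qed
    have g0: "bdd_Ck k I g" by (rule bdd_Ck_SucD[OF Suc.prems(2)])
    show "bdd_Ck k I (\<lambda>i x. \<Sum>b\<in>Basis. ((v + g' i x v) \<bullet> b) *\<^sub>R u' i (x + g i x) b)" for v
      by (intro bdd_Ck_Basis_expand bdd_Ck_add g'(2) Suc.IH u'(2) g0 bdd_Ck_const[where c="\<lambda>_. v" and M="norm v"] order_refl)
  qed
qed

text \<open>Not an instance of \<open>bdd_Ck_comp\<close>: the shifts \<open>c i\<close> may be
  unbounded, and almost periodicity concerns arbitrary shifts.\<close>

lemma bdd_Ck_translate:
  assumes "bdd_Ck k I u"
  shows "bdd_Ck k I (\<lambda>i x. u i (x + c i))"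
  using assms
proof (induction k arbitrary: u)
  case 0 then show ?case by auto
next
  case (Suc k)
  obtain M where M: "\<And>i x. i \<in> I \<Longrightarrow> norm (u i x) \<le> M"
    by (rule bdd_Ck_bounded[OF Suc.prems(1)]) (rule that)
  obtain u' where u': "\<And>i x. i \<in> I \<Longrightarrow> (u i has_derivative u' i x) (at x)"
    "\<And>v. bdd_Ck k I (\<lambda>i x. u' i x v)" by (rule bdd_Ck_SucE[OF Suc.prems(1)]) (rule that)
  show ?case
  proof (rule bdd_Ck_SucI)
    show "norm (u i (x + c i)) \<le> M" if "i \<in> I" for i x using M[OF that] .
    show "((\<lambda>x. u i (x + c i)) has_derivative (\<lambda>v. u' i (x + c i) v)) (at x)" if i: "i \<in> I" for i x
    proof -
      have "((\<lambda>x. x + c i) has_derivative (\<lambda>v. v)) (at x)"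
        by (auto intro!: derivative_eq_intros)
      from has_derivative_compose[OF this u'(1)[OF i]] show ?thesis .
    qed
    show "bdd_Ck k I (\<lambda>i x. u' i (x + c i) v)" for v by (rule Suc.IH[OF u'(2)])
  qed
qed

lemma bdd_Ck_scale_const:
  fixes f :: "'i \<Rightarrow> 'a::euclidean_space \<Rightarrow> 'b::euclidean_space"
  assumes "\<And>i. i \<in> I \<Longrightarrow> \<bar>c i\<bar> \<le> M" "bdd_Ck k I f"
  shows "bdd_Ck k I (\<lambda>i x. c i *\<^sub>R f i x)"
  by (rule bdd_Ck_bilinear[OF bounded_bilinear_scaleR bdd_Ck_const[of _ c M] assms(2)]) (use assms(1) in simp)

lemma bdd_Ck_diff: "bdd_Ck k I f \<Longrightarrow> bdd_Ck k I g \<Longrightarrow> bdd_Ck k I (\<lambda>i x. f i x - g i x)"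
  using bdd_Ck_add[OF _ bdd_Ck_scale_const[of I "\<lambda>_. -1" 1], of k f g] by simp

lemma bdd_Cinf_bounded:
  assumes "bdd_Cinf I f"
  obtains M where "M \<ge> 0" "\<And>i x. i \<in> I \<Longrightarrow> norm (f i x) \<le> M"
  by (rule bdd_Ck_bounded[OF assms[unfolded bdd_Cinf_def, rule_format, of 0]]) (rule that)

lemma bdd_Cinf_fd:
  assumes "bdd_Cinf I f"
  shows bdd_Cinf_has_fd: "i \<in> I \<Longrightarrow> (f i has_derivative fd (f i) x) (at x)"
    and bdd_Cinf_fd_fam: "bdd_Cinf I (\<lambda>i x. fd (f i) x v)"
proof -
  have k: "bdd_Ck (Suc k) I f" for k using assms by (simp add: bdd_Cinf_def)
  obtain f' where f': "\<And>i x. i \<in> I \<Longrightarrow> (f i has_derivative f' i x) (at x)"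
    by (rule bdd_Ck_SucE[OF k[of 0]]) (rule that)
  have d: "(f i has_derivative fd (f i) x) (at x)" if "i \<in> I" for i x
    using differentiableI[OF f'[OF that]] by (simp add: frechet_derivative_works)
  then show "i \<in> I \<Longrightarrow> (f i has_derivative fd (f i) x) (at x)" .
  show "bdd_Cinf I (\<lambda>i x. fd (f i) x v)"
    unfolding bdd_Cinf_def by (intro allI bdd_Ck_deriv[OF k] d)
qed

text \<open>A class of bounded families that is closed under directional differentiation consists of
  smooth families. This suits pointwise limits and parameter integrals, whose derivatives are again
  limits and integrals.\<close>

lemma bdd_Cinf_coinduct:
  assumes "P f"
    and "\<And>f. P f \<Longrightarrow> (\<exists>M. \<forall>i\<in>I. \<forall>x. norm (f i x) \<le> M) \<and>
      (\<exists>f'. (\<forall>i\<in>I. \<forall>x. (f i has_derivative f' i x) (at x)) \<and> (\<forall>v. P (\<lambda>i x. f' i x v)))"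
  shows "bdd_Cinf I f"
  unfolding bdd_Cinf_def
proof
  fix k show "bdd_Ck k I f"
    using assms(1)
  proof (induction k arbitrary: f)
    case 0 then show ?case using assms(2) by simp
  next
    case (Suc k)
    obtain M where M: "\<forall>i\<in>I. \<forall>x. norm (f i x) \<le> M" using assms(2)[OF Suc.prems] by (elim conjE exE)
    obtain f' where "\<forall>i\<in>I. \<forall>x. (f i has_derivative f' i x) (at x)" "\<forall>v. P (\<lambda>i x. f' i x v)"
      using assms(2)[OF Suc.prems] by (elim conjE exE)
    then show ?case
      using M by (intro bdd_Ck_SucI[of I f M f'] Suc.IH) simp_all
  qed
qed

section \<open>Mean value and Taylor estimates, interpolation\<close>

lemma norm_Basis_combination_le:
  fixes v :: "'a::euclidean_space" and a :: "'a \<Rightarrow> 'b::real_normed_vector"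
  assumes "\<And>b. b \<in> Basis \<Longrightarrow> norm (a b) \<le> C"
  shows "norm (\<Sum>b\<in>Basis. (v \<bullet> b) *\<^sub>R a b) \<le> real DIM('a) * C * norm v"
proof -
  have "norm (\<Sum>b\<in>Basis. (v \<bullet> b) *\<^sub>R a b) \<le> (\<Sum>b\<in>(Basis::'a set). norm v * C)"
    by (rule sum_norm_le) (auto intro!: mult_mono assms Basis_le_norm)
  then show ?thesis by (simp add: mult_ac)
qed

lemma bdd_Ck_Lipschitz:
  fixes f :: "'i \<Rightarrow> 'a::euclidean_space \<Rightarrow> 'b::euclidean_space"
  assumes "bdd_Ck (Suc k) I f"
  obtains L where "L \<ge> 0" "\<And>i x y. i \<in> I \<Longrightarrow> norm (f i x - f i y) \<le> L * norm (x - y)"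
proof -
  obtain f' where f': "\<And>i x. i \<in> I \<Longrightarrow> (f i has_derivative f' i x) (at x)"
    "\<And>v. bdd_Ck k I (\<lambda>i x. f' i x v)" by (rule bdd_Ck_SucE[OF assms]) (rule that)
  have "\<exists>M. M \<ge> 0 \<and> (\<forall>i\<in>I. \<forall>x. norm (f' i x b) \<le> M)" for b
    by (rule bdd_Ck_bounded[OF f'(2)[of b]]) (intro exI conjI ballI allI, assumption, simp)
  then obtain M where M: "\<And>b. M b \<ge> 0" "\<And>b i x. i \<in> I \<Longrightarrow> norm (f' i x b) \<le> M b"
    by metis
  define C where "C = (\<Sum>b\<in>(Basis::'a set). M b)"
  have C0: "C \<ge> 0" unfolding C_def by (intro sum_nonneg M)
  have MC: "M b \<le> C" if "b \<in> Basis" for b unfolding C_def by (intro member_le_sum that M finite_Basis)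
  have on: "onorm (f' i x) \<le> real DIM('a) * C" if i: "i \<in> I" for i x
  proof (rule onorm_le)
    fix v show "norm (f' i x v) \<le> real DIM('a) * C * norm v"
      by (subst has_derivative_Basis_expand[OF f'(1)[OF i]])
         (intro norm_Basis_combination_le order_trans[OF M(2)[OF i] MC])
  qed
  have "norm (f i x - f i y) \<le> real DIM('a) * C * norm (x - y)" if i: "i \<in> I" for i x y
    by (rule differentiable_bound[of UNIV "f i" "f' i"]) (use f'(1)[OF i] on[OF i] in auto)
  then show thesis using C0 by (intro that[of "real DIM('a) * C"]) simp_all
qed

lemma bdd_Cinf_Lipschitz:
  fixes f :: "'i \<Rightarrow> 'a::euclidean_space \<Rightarrow> 'b::euclidean_space"
  assumes "bdd_Cinf I f"
  obtains L where "L \<ge> 0" "\<And>i x y. i \<in> I \<Longrightarrow> norm (f i x - f i y) \<le> L * norm (x - y)"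
  by (rule bdd_Ck_Lipschitz[OF assms[unfolded bdd_Cinf_def, rule_format, of "Suc 0"]]) (rule that)

text \<open>The derivative is Lipschitz uniformly in the index, so on the ball of radius
  \<open>norm y\<close> about x it varies by a multiple of \<open>norm y\<close>; the mean value
  theorem turns this into a quadratic remainder. As the constant does not depend on the index, the
  estimate survives limits and integrals over the index.\<close>

lemma bdd_Cinf_quadratic:
  fixes f :: "'i \<Rightarrow> 'a::euclidean_space \<Rightarrow> 'b::euclidean_space"
  assumes f: "bdd_Cinf I f"
  obtains C where "C \<ge> 0" "\<And>i x y. i \<in> I \<Longrightarrow> norm (f i (x + y) - f i x - fd (f i) x y) \<le> C * norm y ^ 2"
proof -
  have "\<exists>M. M \<ge> 0 \<and> (\<forall>i\<in>I. \<forall>x y. norm (fd (f i) x b - fd (f i) y b) \<le> M * norm (x - y))" for b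
    by (rule bdd_Cinf_Lipschitz[OF bdd_Cinf_fd_fam[OF f, of b]])
       (intro exI conjI ballI allI, assumption, simp)
  then obtain M where M: "\<And>b. M b \<ge> 0"
     "\<And>b i x y. i \<in> I \<Longrightarrow> norm (fd (f i) x b - fd (f i) y b) \<le> M b * norm (x - y)"
    by metis
  define C where "C = (\<Sum>b\<in>(Basis::'a set). M b)"
  have C0: "C \<ge> 0" unfolding C_def by (intro sum_nonneg M)
  have MC: "M b \<le> C" if "b \<in> Basis" for b unfolding C_def by (intro member_le_sum that M finite_Basis)
  let ?D = "real DIM('a) * C"
  have on: "onorm (fd (f i) x - fd (f i) y) \<le> ?D * r"
    if i: "i \<in> I" and r: "norm (x - y) \<le> r" for i x y r
  proof (rule onorm_le)
    fix v
    have "(fd (f i) x - fd (f i) y) v = (\<Sum>b\<in>Basis. (v \<bullet> b) *\<^sub>R (fd (f i) x b - fd (f i) y b))"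
      unfolding fun_diff_def
      by (subst (1 2) has_derivative_Basis_expand[OF bdd_Cinf_has_fd[OF f i]])
         (simp add: sum_subtractf scaleR_diff_right)
    also have "norm \<dots> \<le> real DIM('a) * (C * r) * norm v"
    proof (rule norm_Basis_combination_le)
      fix b :: 'a assume b: "b \<in> Basis"
      show "norm (fd (f i) x b - fd (f i) y b) \<le> C * r"
        by (rule order_trans[OF M(2)[OF i]]) (intro mult_mono MC[OF b] r C0 norm_ge_zero)
    qed
    finally show "norm ((fd (f i) x - fd (f i) y) v) \<le> ?D * r * norm v" by (simp add: mult_ac)
  qed
  have "norm (f i (x + y) - f i x - fd (f i) x y) \<le> ?D * norm y ^ 2" if i: "i \<in> I" for i x y
  proof -
    have "norm (f i (x + y) - f i x - fd (f i) x ((x + y) - x)) \<le> norm ((x + y) - x) * (?D * norm y)"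
    proof (rule differentiable_bound_linearization[where S="cball x (norm y)"])
      show "x + t *\<^sub>R (x + y - x) \<in> cball x (norm y)" if "t \<in> {0..1}" for t
        using that by (auto simp: dist_norm mult_left_le_one_le)
      show "(f i has_derivative fd (f i) z) (at z within cball x (norm y))" for z
        using bdd_Cinf_has_fd[OF f i] by (rule has_derivative_at_withinI)
      show "onorm (fd (f i) z - fd (f i) x) \<le> ?D * norm y" if "z \<in> cball x (norm y)" for z
        using that by (intro on[OF i]) (simp add: dist_norm norm_minus_commute)
    qed simp
    then show ?thesis by (simp add: power2_eq_square mult_ac)
  qed
  then show thesis using C0 by (intro that[of ?D]) simp_all
qed

text \<open>The Landau interpolation inequality: sup bounds on a family with bounded second derivatives
  control its first derivatives, since
  \<open>s D f(x) v = f (x + s v) - f x + O(s^2)\<close>.\<close>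

lemma bdd_Cinf_interpolation:
  fixes f :: "'i \<Rightarrow> 'a::euclidean_space \<Rightarrow> 'b::euclidean_space"
  assumes f: "bdd_Cinf I f" and e: "\<eta> > 0"
  obtains \<epsilon> s where "\<epsilon> > 0" "\<And>i x. i \<in> I \<Longrightarrow> norm (f i x) \<le> \<epsilon> \<Longrightarrow> norm (f i (x + s *\<^sub>R v)) \<le> \<epsilon> \<Longrightarrow>
     norm (fd (f i) x v) \<le> \<eta>"
proof -
  obtain C where C: "C \<ge> 0" "\<And>i x y. i \<in> I \<Longrightarrow> norm (f i (x + y) - f i x - fd (f i) x y) \<le> C * norm y ^ 2"
    by (rule bdd_Cinf_quadratic[OF f]) (rule that)
  define K where "K = C * norm v ^ 2 + 1"
  have K: "K > 0" unfolding K_def using C(1) by (simp add: add_nonneg_pos)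
  \<comment> \<open>This makes the quadratic error s^2 K equal to s \<eta> / 2, so the two function
    values may contribute s \<eta> / 4 each. The summand 1 in K keeps the denominator
    positive.\<close>
  define s where "s = \<eta> / (2 * K)"
  have s: "s > 0" unfolding s_def using K e by simp
  show thesis
  proof (rule that[of "s * \<eta> / 4" s])
    show "s * \<eta> / 4 > 0" using s e by simp
    fix i x assume i: "i \<in> I" and 1: "norm (f i x) \<le> s * \<eta> / 4" and 2: "norm (f i (x + s *\<^sub>R v)) \<le> s * \<eta> / 4"
    have lin: "fd (f i) x (s *\<^sub>R v) = s *\<^sub>R fd (f i) x v"
      using has_derivative_linear[OF bdd_Cinf_has_fd[OF f i]] by (simp add: linear_scale)
    let ?r = "f i (x + s *\<^sub>R v) - f i x - fd (f i) x (s *\<^sub>R v)"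
    have r: "norm ?r \<le> C * norm (s *\<^sub>R v) ^ 2" by (rule C(2)[OF i])
    have "s * norm (fd (f i) x v) = norm (fd (f i) x (s *\<^sub>R v))"
      using s by (simp add: lin)
    also have "\<dots> = norm (f i (x + s *\<^sub>R v) - f i x - ?r)" by simp
    also have "\<dots> \<le> s * \<eta> / 4 + s * \<eta> / 4 + C * norm (s *\<^sub>R v) ^ 2"
      using norm_triangle_ineq4[of "f i (x + s *\<^sub>R v) - f i x" ?r]
        norm_triangle_ineq4[of "f i (x + s *\<^sub>R v)" "f i x"] 1 2 r by linarith
    also have "C * norm (s *\<^sub>R v) ^ 2 \<le> s * s * K"
      using s by (simp add: K_def power2_eq_square algebra_simps)
    also have "s * s * K = s * (\<eta> / 2)" using K by (simp add: s_def field_simps)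
    finally have "s * norm (fd (f i) x v) \<le> s * \<eta>" by (simp add: mult.commute)
    then show "norm (fd (f i) x v) \<le> \<eta>" using s by simp
  qed
qed

lemma bdd_Cinf_reindex:
  "bdd_Cinf I f \<Longrightarrow> (\<And>j. j \<in> J \<Longrightarrow> s j \<in> I) \<Longrightarrow> bdd_Cinf J (\<lambda>j. f (s j))"
  unfolding bdd_Cinf_def by (simp add: bdd_Ck_reindex[of _ I f J s])

lemma bdd_Cinf_cong:
  "bdd_Cinf I f \<Longrightarrow> (\<And>i x. i \<in> I \<Longrightarrow> f i x = g i x) \<Longrightarrow> bdd_Cinf I g"
  unfolding bdd_Cinf_def by (simp add: bdd_Ck_cong[of _ I f g])

lemma bdd_Cinf_const: "(\<And>i. i \<in> I \<Longrightarrow> norm (c i) \<le> M) \<Longrightarrow> bdd_Cinf I (\<lambda>i x. c i)"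
  unfolding bdd_Cinf_def by (simp add: bdd_Ck_const[of I c M])

lemma bdd_Cinf_add: "bdd_Cinf I f \<Longrightarrow> bdd_Cinf I g \<Longrightarrow> bdd_Cinf I (\<lambda>i x. f i x + g i x)"
  unfolding bdd_Cinf_def by (simp add: bdd_Ck_add[of _ I f g])

lemma bdd_Cinf_diff: "bdd_Cinf I f \<Longrightarrow> bdd_Cinf I g \<Longrightarrow> bdd_Cinf I (\<lambda>i x. f i x - g i x)"
  unfolding bdd_Cinf_def by (simp add: bdd_Ck_diff[of _ I f g])

lemma bdd_Cinf_scale_const:
  "(\<And>i. i \<in> I \<Longrightarrow> \<bar>c i\<bar> \<le> M) \<Longrightarrow> bdd_Cinf I f \<Longrightarrow> bdd_Cinf I (\<lambda>i x. c i *\<^sub>R f i x)"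
  unfolding bdd_Cinf_def by (simp add: bdd_Ck_scale_const[of I c M _ f])

lemma bdd_Cinf_comp: "bdd_Cinf I u \<Longrightarrow> bdd_Cinf I g \<Longrightarrow> bdd_Cinf I (\<lambda>i x. u i (x + g i x))"
  unfolding bdd_Cinf_def by (simp add: bdd_Ck_comp[of _ I u g])

lemma bdd_Cinf_translate: "bdd_Cinf I u \<Longrightarrow> bdd_Cinf I (\<lambda>i x. u i (x + c i))"
  unfolding bdd_Cinf_def by (simp add: bdd_Ck_translate[of _ I u c])

lemma bdd_Cinf_bounded_linear: "bounded_linear T \<Longrightarrow> bdd_Cinf I f \<Longrightarrow> bdd_Cinf I (\<lambda>i x. T (f i x))"
  unfolding bdd_Cinf_def by (simp add: bdd_Ck_bounded_linear[of T _ I f])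

lemma bdd_Cinf_sum:
  "finite A \<Longrightarrow> (\<And>a. a \<in> A \<Longrightarrow> bdd_Cinf I (f a)) \<Longrightarrow> bdd_Cinf I (\<lambda>i x. \<Sum>a\<in>A. f a i x)"
  unfolding bdd_Cinf_def by (simp add: bdd_Ck_sum[of A _ I f])

lemma bdd_Cinf_Basis_expand:
  "bdd_Cinf I w \<Longrightarrow> (\<And>b. b \<in> Basis \<Longrightarrow> bdd_Cinf I (a b)) \<Longrightarrow>
    bdd_Cinf I (\<lambda>i x. \<Sum>b\<in>Basis. (w i x \<bullet> b) *\<^sub>R a b i x)"
  unfolding bdd_Cinf_def by (simp add: bdd_Ck_Basis_expand[of _ I w a])

section \<open>Pointwise limits and integrals of bounded families\<close>

lemma fd_eqI: "(f has_derivative f') (at x) \<Longrightarrow> fd f x = f'"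
  by (rule frechet_derivative_at[symmetric])

text \<open>Limits and integrals of derivatives are recognised as derivatives through this
  criterion, since the quadratic bound passes to them.\<close>

lemma has_derivative_quadratic_remainder:
  fixes f :: "'a::euclidean_space \<Rightarrow> 'b::euclidean_space"
  assumes "linear L" "\<And>y. norm (f (x + y) - f x - L y) \<le> C * norm y ^ 2"
  shows "(f has_derivative L) (at x)"
  unfolding has_derivative_at
proof
  show "bounded_linear L" using assms(1) by (simp add: linear_conv_bounded_linear)
  show "(\<lambda>h. norm (f (x + h) - f x - L h) / norm h) \<midarrow>0\<rightarrow> 0"
  proof (rule Lim_null_comparison)
    have "norm (norm (f (x + h) - f x - L h) / norm h) \<le> C * norm h" if "h \<noteq> 0" for h
      using assms(2)[of h] that by (simp add: field_simps power2_eq_square)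
    then show "\<forall>\<^sub>F h in at 0. norm (norm (f (x + h) - f x - L h) / norm h) \<le> C * norm h"
      by (auto simp: eventually_at_filter)
    have "(\<lambda>h::'a. C * norm h) \<midarrow>0\<rightarrow> C * norm (0::'a)" by (intro tendsto_intros)
    then show "(\<lambda>h::'a. C * norm h) \<midarrow>0\<rightarrow> 0" by simp
  qed
qed

text \<open>The differences F m - F n form a bounded family, to which interpolation applies. It asks
  for small values only at the two points x and x + s v, so pointwise convergence already makes the
  derivatives Cauchy at x; the quadratic estimate then identifies their limit.\<close>

lemma bdd_Cinf_pointwise_limit_deriv:
  fixes F :: "nat \<times> 'i \<Rightarrow> 'a::euclidean_space \<Rightarrow> 'b::euclidean_space"
  assumes F: "bdd_Cinf (UNIV \<times> I) F"
    and lim: "\<And>i x. i \<in> I \<Longrightarrow> (\<lambda>n. F (n, i) x) \<longlonglongrightarrow> f i x"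
  shows "i \<in> I \<Longrightarrow> (f i has_derivative fd (f i) x) (at x)"
    and "i \<in> I \<Longrightarrow> (\<lambda>n. fd (F (n, i)) x v) \<longlonglongrightarrow> fd (f i) x v"
proof -
  have hF: "(F (n, i) has_derivative fd (F (n, i)) x) (at x)" if "i \<in> I" for n i x
    using bdd_Cinf_has_fd[OF F] that by simp
  let ?D = "\<lambda>((m, n), i) x. F (m, i) x - F (n, i) x"
  have D: "bdd_Cinf ((UNIV \<times> UNIV) \<times> I) ?D"
  proof (rule bdd_Cinf_cong)
    show "bdd_Cinf ((UNIV \<times> UNIV) \<times> I) (\<lambda>p x. F (fst (fst p), snd p) x - F (snd (fst p), snd p) x)"
      by (intro bdd_Cinf_diff bdd_Cinf_reindex[OF F]) auto
  qed auto
  have fdD: "fd (?D ((m, n), i)) x = (\<lambda>v. fd (F (m, i)) x v - fd (F (n, i)) x v)" if "i \<in> I" for m n i x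
    by (rule fd_eqI) (use that in \<open>auto intro!: has_derivative_diff hF\<close>)
  have "convergent (\<lambda>n. fd (F (n, i)) x v)" if i: "i \<in> I" for i x v
  proof (rule Cauchy_convergent, rule metric_CauchyI)
    fix \<eta> :: real assume "\<eta> > 0"
    then have "\<eta> / 2 > 0" by simp
    obtain \<epsilon> s where e: "\<epsilon> > 0" and est: "\<And>p x. p \<in> (UNIV \<times> UNIV) \<times> I \<Longrightarrow> norm (?D p x) \<le> \<epsilon> \<Longrightarrow>
        norm (?D p (x + s *\<^sub>R v)) \<le> \<epsilon> \<Longrightarrow> norm (fd (?D p) x v) \<le> \<eta> / 2"
      by (rule bdd_Cinf_interpolation[OF D \<open>\<eta> / 2 > 0\<close>, of v]) (rule that)
    obtain N1 where N1: "\<And>m n. m \<ge> N1 \<Longrightarrow> n \<ge> N1 \<Longrightarrow> dist (F (m, i) x) (F (n, i) x) < \<epsilon>"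
      using metric_CauchyD[OF LIMSEQ_imp_Cauchy[OF lim[OF i, of x]] e] by blast
    obtain N2 where N2: "\<And>m n. m \<ge> N2 \<Longrightarrow> n \<ge> N2 \<Longrightarrow> dist (F (m, i) (x + s *\<^sub>R v)) (F (n, i) (x + s *\<^sub>R v)) < \<epsilon>"
      using metric_CauchyD[OF LIMSEQ_imp_Cauchy[OF lim[OF i, of "x + s *\<^sub>R v"]] e] by blast
    show "\<exists>N. \<forall>m\<ge>N. \<forall>n\<ge>N. dist (fd (F (m, i)) x v) (fd (F (n, i)) x v) < \<eta>"
    proof (intro exI allI impI)
      fix m n assume mn: "max N1 N2 \<le> m" "max N1 N2 \<le> n"
      have "norm (fd (?D ((m, n), i)) x v) \<le> \<eta> / 2"
        using N1[of m n] N2[of m n] mn i by (intro est) (auto simp: dist_norm)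
      then show "dist (fd (F (m, i)) x v) (fd (F (n, i)) x v) < \<eta>"
        using \<open>\<eta> > 0\<close> unfolding fdD[OF i] dist_norm by linarith
    qed
  qed
  then have L: "(\<lambda>n. fd (F (n, i)) x v) \<longlonglongrightarrow> lim (\<lambda>n. fd (F (n, i)) x v)" if "i \<in> I" for i x v
    using that by (simp add: convergent_LIMSEQ_iff)
  obtain C where C: "C \<ge> 0" "\<And>p x y. p \<in> UNIV \<times> I \<Longrightarrow> norm (F p (x + y) - F p x - fd (F p) x y) \<le> C * norm y ^ 2"
    by (rule bdd_Cinf_quadratic[OF F]) (rule that)
  have der: "(f i has_derivative (\<lambda>v. lim (\<lambda>n. fd (F (n, i)) x v))) (at x)" if i: "i \<in> I" for i x
  proof (rule has_derivative_quadratic_remainder)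
    have lin: "linear (fd (F (n, i)) x)" for n using hF[OF i] by (rule has_derivative_linear)
    show "linear (\<lambda>v. lim (\<lambda>n. fd (F (n, i)) x v))"
    proof (rule linearI)
      fix v w
      have "(\<lambda>n. fd (F (n, i)) x v + fd (F (n, i)) x w) \<longlonglongrightarrow>
          lim (\<lambda>n. fd (F (n, i)) x v) + lim (\<lambda>n. fd (F (n, i)) x w)"
        by (intro tendsto_add L i)
      then show "lim (\<lambda>n. fd (F (n, i)) x (v + w)) =
          lim (\<lambda>n. fd (F (n, i)) x v) + lim (\<lambda>n. fd (F (n, i)) x w)"
        using L[OF i, of x "v + w"] by (simp add: linear_add[OF lin] LIMSEQ_unique)
    next
      fix r v
      have "(\<lambda>n. r *\<^sub>R fd (F (n, i)) x v) \<longlonglongrightarrow> r *\<^sub>R lim (\<lambda>n. fd (F (n, i)) x v)"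
        by (intro tendsto_intros L i)
      then show "lim (\<lambda>n. fd (F (n, i)) x (r *\<^sub>R v)) = r *\<^sub>R lim (\<lambda>n. fd (F (n, i)) x v)"
        using L[OF i, of x "r *\<^sub>R v"] by (simp add: linear_scale[OF lin] LIMSEQ_unique)
    qed
    fix y
    have "(\<lambda>n. norm (F (n, i) (x + y) - F (n, i) x - fd (F (n, i)) x y))
        \<longlonglongrightarrow> norm (f i (x + y) - f i x - lim (\<lambda>n. fd (F (n, i)) x y))"
      by (intro tendsto_intros L lim i)
    then show "norm (f i (x + y) - f i x - lim (\<lambda>n. fd (F (n, i)) x y)) \<le> C * norm y ^ 2"
      by (rule LIMSEQ_le_const2) (use C(2) i in auto)
  qed
  show "i \<in> I \<Longrightarrow> (f i has_derivative fd (f i) x) (at x)"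
    using der by (simp add: fd_eqI[OF der])
  show "i \<in> I \<Longrightarrow> (\<lambda>n. fd (F (n, i)) x v) \<longlonglongrightarrow> fd (f i) x v"
    using L by (simp add: fd_eqI[OF der])
qed

lemma bdd_Cinf_pointwise_limit:
  fixes F :: "nat \<times> 'i \<Rightarrow> 'a::euclidean_space \<Rightarrow> 'b::euclidean_space"
  assumes F: "bdd_Cinf (UNIV \<times> I) F"
    and lim: "\<And>i x. i \<in> I \<Longrightarrow> (\<lambda>n. F (n, i) x) \<longlonglongrightarrow> f i x"
  shows "bdd_Cinf I f"
proof -
  \<comment> \<open>The class for the coinduction: pointwise limits of bounded families. It is
    closed under differentiation by the preceding lemma.\<close>
  define P where "P = (\<lambda>f. \<exists>F :: nat \<times> 'i \<Rightarrow> 'a \<Rightarrow> 'b. bdd_Cinf (UNIV \<times> I) F \<and>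
    (\<forall>i\<in>I. \<forall>x. (\<lambda>n. F (n, i) x) \<longlonglongrightarrow> f i x))"
  have "P f" unfolding P_def using assms by blast
  then show ?thesis
  proof (rule bdd_Cinf_coinduct[where P=P])
    fix f assume "P f"
    then obtain F :: "nat \<times> 'i \<Rightarrow> 'a \<Rightarrow> 'b" where F: "bdd_Cinf (UNIV \<times> I) F"
      and lim: "\<And>i x. i \<in> I \<Longrightarrow> (\<lambda>n. F (n, i) x) \<longlonglongrightarrow> f i x" unfolding P_def by blast
    obtain M where M: "M \<ge> 0" "\<And>i x. i \<in> UNIV \<times> I \<Longrightarrow> norm (F i x) \<le> M"
      by (rule bdd_Cinf_bounded[OF F]) (rule that)
    note d = bdd_Cinf_pointwise_limit_deriv[OF F lim]
    have "norm (f i x) \<le> M" if "i \<in> I" for i x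
      by (rule LIMSEQ_le_const2[OF tendsto_norm[OF lim[OF that]]]) (use M that in auto)
    moreover have "P (\<lambda>i x. fd (f i) x v)" for v
      unfolding P_def using d(2) bdd_Cinf_fd_fam[OF F, of v] by blast
    ultimately show "(\<exists>M. \<forall>i\<in>I. \<forall>x. norm (f i x) \<le> M) \<and>
       (\<exists>f'. (\<forall>i\<in>I. \<forall>x. (f i has_derivative f' i x) (at x)) \<and> (\<forall>v. P (\<lambda>i x. f' i x v)))"
      using d(1)
      by (intro conjI exI[of _ M] exI[of _ "\<lambda>i. fd (f i)"] ballI allI)
  qed
qed

text \<open>Along a convergent sequence of parameters the functions form a bounded family with a
  pointwise limit, so continuity of the values carries over to the derivatives.\<close>

lemma bdd_Cinf_continuous_fd:
  fixes f :: "'s::metric_space \<Rightarrow> 'a::euclidean_space \<Rightarrow> 'b::euclidean_space"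
  assumes f: "bdd_Cinf S f" and cont: "\<And>x. continuous_on S (\<lambda>s. f s x)"
  shows "continuous_on S (\<lambda>s. fd (f s) x v)"
  unfolding continuous_on_sequentially
proof (intro allI ballI impI)
  fix X a assume a: "a \<in> S" and X: "(\<forall>n. X n \<in> S) \<and> X \<longlonglongrightarrow> a"
  have "bdd_Cinf (UNIV \<times> {()}) (\<lambda>p. f (X (fst p)))"
    using X by (intro bdd_Cinf_reindex[OF f]) auto
  moreover have "(\<lambda>n. f (X (fst (n, i))) x) \<longlonglongrightarrow> f a x" for i x
    using cont[of x] a X unfolding continuous_on_sequentially comp_def by simp
  ultimately show "((\<lambda>s. fd (f s) x v) \<circ> X) \<longlonglongrightarrow> fd (f a) x v"
    using bdd_Cinf_pointwise_limit_deriv(2)[of "{()}" "\<lambda>p. f (X (fst p))" "\<lambda>_. f a" "()" x v]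
    by (simp add: comp_def)
qed

text \<open>Differentiation under the integral sign: the quadratic remainder is uniform in s and may
  simply be integrated.\<close>

lemma bdd_Cinf_integral:
  fixes f :: "'i \<times> real \<Rightarrow> 'a::euclidean_space \<Rightarrow> 'b::euclidean_space"
  assumes f: "bdd_Cinf (I \<times> {0..1}) f"
    and cont: "\<And>i x. i \<in> I \<Longrightarrow> continuous_on {0..1} (\<lambda>s. f (i, s) x)"
  shows "bdd_Cinf I (\<lambda>i x. integral {0..1} (\<lambda>s. f (i, s) x))"
proof -
  \<comment> \<open>The class of parameter integrals is closed under differentiation, because the
    derivative of the integrand is again bounded and continuous in s.\<close>
  define P where "P = (\<lambda>g. \<exists>f :: 'i \<times> real \<Rightarrow> 'a \<Rightarrow> 'b. bdd_Cinf (I \<times> {0..1}) f \<and>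
     (\<forall>i\<in>I. \<forall>x. continuous_on {0..1} (\<lambda>s. f (i, s) x)) \<and>
     g = (\<lambda>i x. integral {0..1} (\<lambda>s. f (i, s) x)))"
  have "P (\<lambda>i x. integral {0..1} (\<lambda>s. f (i, s) x))" unfolding P_def using assms by blast
  then show ?thesis
  proof (rule bdd_Cinf_coinduct[where P=P])
    fix g assume "P g"
    then obtain f :: "'i \<times> real \<Rightarrow> 'a \<Rightarrow> 'b" where f: "bdd_Cinf (I \<times> {0..1}) f"
      and cont: "\<And>i x. i \<in> I \<Longrightarrow> continuous_on {0..1} (\<lambda>s. f (i, s) x)"
      and g: "g = (\<lambda>i x. integral {0..1} (\<lambda>s. f (i, s) x))" unfolding P_def by blast
    obtain M where M: "M \<ge> 0" "\<And>p x. p \<in> I \<times> {0..1} \<Longrightarrow> norm (f p x) \<le> M"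
      by (rule bdd_Cinf_bounded[OF f]) (rule that)
    obtain C where C: "C \<ge> 0" "\<And>p x y. p \<in> I \<times> {0..1} \<Longrightarrow> norm (f p (x + y) - f p x - fd (f p) x y) \<le> C * norm y ^ 2"
      by (rule bdd_Cinf_quadratic[OF f]) (rule that)
    have cd: "continuous_on {0..1} (\<lambda>s. fd (f (i, s)) x v)" if i: "i \<in> I" for i x v
      by (rule bdd_Cinf_continuous_fd[of "{0..1}" "\<lambda>s. f (i, s)"])
         (use i in \<open>auto intro!: bdd_Cinf_reindex[OF f] cont\<close>)
    note int = integrable_continuous_real[OF cont] integrable_continuous_real[OF cd]
    let ?f' = "\<lambda>i x v. integral {0..1} (\<lambda>s. fd (f (i, s)) x v)"
    have lin: "linear (fd (f (i, s)) x)" if "i \<in> I" "s \<in> {0..1}" for i s x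
      using bdd_Cinf_has_fd[OF f, of "(i, s)"] that by (auto intro: has_derivative_linear)
    show "(\<exists>M. \<forall>i\<in>I. \<forall>x. norm (g i x) \<le> M) \<and>
       (\<exists>f'. (\<forall>i\<in>I. \<forall>x. (g i has_derivative f' i x) (at x)) \<and> (\<forall>v. P (\<lambda>i x. f' i x v)))"
    proof (intro conjI exI[of _ M] exI[of _ ?f'] ballI allI)
      fix i x assume i: "i \<in> I"
      show "norm (g i x) \<le> M"
        unfolding g using integral_bound[of 0 1 "\<lambda>s. f (i, s) x" M] cont[OF i] M i by auto
      show "(g i has_derivative ?f' i x) (at x)"
      proof (rule has_derivative_quadratic_remainder)
        show "linear (?f' i x)"
        proof (rule linearI)
          fix v w
          have "?f' i x (v + w) = integral {0..1} (\<lambda>s. fd (f (i, s)) x v + fd (f (i, s)) x w)"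
            by (intro integral_cong) (simp add: linear_add[OF lin] i)
          then show "?f' i x (v + w) = ?f' i x v + ?f' i x w"
            by (simp add: integral_add int i)
        next
          fix r v
          have "?f' i x (r *\<^sub>R v) = integral {0..1} (\<lambda>s. r *\<^sub>R fd (f (i, s)) x v)"
            by (intro integral_cong) (simp add: linear_scale[OF lin] i)
          then show "?f' i x (r *\<^sub>R v) = r *\<^sub>R ?f' i x v" by simp
        qed
        fix y
        have "g i (x + y) - g i x - ?f' i x y =
            integral {0..1} (\<lambda>s. f (i, s) (x + y) - f (i, s) x - fd (f (i, s)) x y)"
          unfolding g by (simp add: integral_diff integrable_diff int i)
        also have "norm \<dots> \<le> C * norm y ^ 2 * (1 - 0)"
          by (rule integral_bound) (use C i in \<open>auto intro!: continuous_intros cont cd\<close>)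
        finally show "norm (g i (x + y) - g i x - ?f' i x y) \<le> C * norm y ^ 2" by simp
      qed
    next
      fix v show "P (\<lambda>i x. ?f' i x v)"
        unfolding P_def using bdd_Cinf_fd_fam[OF f, of v] cd by blast
    qed
  qed
qed

section \<open>Flows of bounded Lipschitz vector fields\<close>

text \<open>Derivatives are taken within the half-line to agree with \<open>is_flow\<close>, which
  is one-sided at time 0.\<close>

definition ivp :: "('a::euclidean_space \<Rightarrow> 'a) \<Rightarrow> 'a \<Rightarrow> (real \<Rightarrow> 'a) \<Rightarrow> bool" where
  "ivp u x X \<longleftrightarrow> X 0 = x \<and> (\<forall>t\<ge>0. (X has_vector_derivative u (X t)) (at t within {0..}))"

definition flow :: "('a::euclidean_space \<Rightarrow> 'a) \<Rightarrow> real \<Rightarrow> 'a \<Rightarrow> 'a" where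
  "flow u t x = (SOME X. ivp u x X) t"

definition Lip_bdd :: "('a::euclidean_space \<Rightarrow> 'a) \<Rightarrow> bool" where
  "Lip_bdd u \<longleftrightarrow> (\<exists>M. \<forall>x. norm (u x) \<le> M) \<and> (\<exists>L. \<forall>x y. norm (u x - u y) \<le> L * norm (x - y))"

text \<open>Enlarging the Lipschitz constant to at least 1 gives t \<le> exp (2 L t), the estimate
  that starts the Picard iteration.\<close>

lemma Lip_bddE:
  assumes "Lip_bdd u"
  obtains M L where "M \<ge> 0" "\<And>x. norm (u x) \<le> M" "L \<ge> 1" "\<And>x y. norm (u x - u y) \<le> L * norm (x - y)"
proof -
  obtain M L where M: "\<And>x. norm (u x) \<le> M" and L: "\<And>x y. norm (u x - u y) \<le> L * norm (x - y)"
    using assms unfolding Lip_bdd_def by blast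
  have "M \<ge> 0" using M order_trans[OF norm_ge_zero] by blast
  moreover have "norm (u x - u y) \<le> max L 1 * norm (x - y)" for x y
    by (rule order_trans[OF L]) (simp add: mult_right_mono)
  ultimately show thesis using M that[of M "max L 1"] by simp
qed

lemma Lip_bdd_continuous:
  assumes "Lip_bdd u" shows "continuous_on S u"
proof -
  obtain M L where "L \<ge> 1" and L: "\<And>x y. norm (u x - u y) \<le> L * norm (x - y)"
    by (rule Lip_bddE[OF assms]) (rule that)
  then have "L-lipschitz_on S u" by (intro lipschitz_onI) (auto simp: dist_norm)
  then show ?thesis by (rule lipschitz_on_continuous_on)
qed

text \<open>The squared distance is used because the norm is not differentiable at 0, and adding e^2
  makes the differential inequality homogeneous. The rate is 2 L from the Lipschitz bound plus 1
  from 2 a e \<le> a^2 + e^2. The case e = 0 gives uniqueness, the general case continuous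
  dependence on field and initial point.\<close>

lemma ivp_gronwall:
  fixes u v :: "'a::euclidean_space \<Rightarrow> 'a"
  assumes X: "ivp u x X" and Y: "ivp v y Y"
    and L: "L \<ge> 0" "\<And>x y. norm (u x - u y) \<le> L * norm (x - y)"
    and e: "\<And>z. norm (u z - v z) \<le> e" and t: "t \<ge> 0"
  shows "norm (X t - Y t) ^ 2 + e ^ 2 \<le> (norm (x - y) ^ 2 + e ^ 2) * exp ((2 * L + 1) * t)"
proof -
  let ?D = "\<lambda>t. X t - Y t"
  \<comment> \<open>Multiplied by the decaying exponential, the quantity to be bounded is
    nonincreasing.\<close>
  define g where "g = (\<lambda>t. (?D t \<bullet> ?D t + e ^ 2) * exp (- ((2 * L + 1) * t)))"
  define g' where "g' = (\<lambda>t. 2 * (?D t \<bullet> (u (X t) - v (Y t))) * exp (- ((2 * L + 1) * t))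
     - (2 * L + 1) * g t)"
  have g: "(g has_real_derivative g' t) (at t within {0..})" if "t \<ge> 0" for t
  proof -
    have dX: "(X has_derivative (\<lambda>h. h *\<^sub>R u (X t))) (at t within {0..})"
     and dY: "(Y has_derivative (\<lambda>h. h *\<^sub>R v (Y t))) (at t within {0..})"
      using X Y that unfolding ivp_def has_vector_derivative_def by auto
    show ?thesis
      unfolding g_def g'_def has_field_derivative_def
      by (rule derivative_eq_intros dX dY refl | simp)+
         (auto simp: fun_eq_iff inner_diff_left inner_diff_right inner_commute algebra_simps)
  qed
  have le: "g' t \<le> 0" for t
  proof -
    have "norm (u (X t) - v (Y t)) \<le> L * norm (?D t) + e"
      using norm_triangle_ineq[of "u (X t) - u (Y t)" "u (Y t) - v (Y t)"] L(2)[of "X t" "Y t"] e[of "Y t"]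
      by simp
    then have "?D t \<bullet> (u (X t) - v (Y t)) \<le> norm (?D t) * (L * norm (?D t) + e)"
      by (intro order_trans[OF norm_cauchy_schwarz] mult_left_mono) auto
    then have "2 * (?D t \<bullet> (u (X t) - v (Y t))) \<le> 2 * L * norm (?D t) ^ 2 + 2 * norm (?D t) * e"
      by (simp add: power2_eq_square algebra_simps)
    also have "\<dots> \<le> 2 * L * norm (?D t) ^ 2 + (norm (?D t) ^ 2 + e ^ 2)"
      using sum_squares_bound[of "norm (?D t)" e] by simp
    also have "\<dots> \<le> (2 * L + 1) * (norm (?D t) ^ 2 + e ^ 2)"
      using L(1) by (simp add: algebra_simps)
    also have "norm (?D t) ^ 2 = ?D t \<bullet> ?D t" by (rule power2_norm_eq_inner)
    finally have "2 * (?D t \<bullet> (u (X t) - v (Y t))) * exp (- ((2 * L + 1) * t))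
       \<le> (2 * L + 1) * (?D t \<bullet> ?D t + e ^ 2) * exp (- ((2 * L + 1) * t))"
      by (intro mult_right_mono) auto
    then show ?thesis unfolding g'_def g_def by (simp add: mult.assoc)
  qed
  have "g t \<le> g 0"
  proof (rule DERIV_nonpos_imp_decreasing_open[OF t])
    fix s assume s: "0 < s" "s < t"
    have "at s within {0..} = at s" using s by (intro at_within_interior) auto
    then show "\<exists>y. (g has_real_derivative y) (at s) \<and> y \<le> 0"
      using g[of s] le[of s] s by auto
  next
    show "continuous_on {0..t} g"
      by (rule continuous_on_subset[of "{0..}"])
         (auto simp: continuous_on_eq_continuous_within intro!: DERIV_continuous[OF g])
  qed
  then have "(norm (X t - Y t) ^ 2 + e ^ 2) * exp (- ((2 * L + 1) * t)) \<le> norm (x - y) ^ 2 + e ^ 2"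
    using X Y by (simp add: g_def power2_norm_eq_inner ivp_def)
  from mult_right_mono[OF this, of "exp ((2 * L + 1) * t)"] show ?thesis
    by (simp add: mult.assoc exp_add[symmetric])
qed

text \<open>Near t the half-line agrees with the interval from 0 to t + 1, in which t is not the
  right end point; the compact case therefore applies.\<close>

lemma integral_has_vector_derivative_halfline:
  fixes f :: "real \<Rightarrow> 'a::banach"
  assumes "continuous_on {0..} f" "t \<ge> 0"
  shows "((\<lambda>t. integral {0..t} f) has_vector_derivative f t) (at t within {0..})"
proof -
  have "((\<lambda>t. integral {0..t} f) has_vector_derivative f t) (at t within {0..t+1})"
    by (rule integral_has_vector_derivative) (use assms in \<open>auto intro: continuous_on_subset\<close>)
  moreover have "at t within {0..t+1} = at t within {0..}"
    by (rule at_within_nhd[of t "{..<t+1}"]) auto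
  ultimately show ?thesis by simp
qed

lemma uniform_limit_Lipschitz:
  fixes u :: "'a::real_normed_vector \<Rightarrow> 'b::real_normed_vector"
  assumes lim: "uniform_limit S f l F" and L: "\<And>x y. norm (u x - u y) \<le> L * norm (x - y)"
  shows "uniform_limit S (\<lambda>n x. u (f n x)) (\<lambda>x. u (l x)) F"
proof (rule uniform_limitI)
  fix e :: real assume e: "e > 0"
  let ?L = "max L 1"
  have "\<forall>\<^sub>F n in F. \<forall>x\<in>S. dist (f n x) (l x) < e / ?L"
    using uniform_limitD[OF lim, of "e / ?L"] e by simp
  then show "\<forall>\<^sub>F n in F. \<forall>x\<in>S. dist (u (f n x)) (u (l x)) < e"
  proof (rule eventually_mono, intro ballI)
    fix n x assume "\<forall>x\<in>S. dist (f n x) (l x) < e / ?L" "x \<in> S"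
    then have "norm (f n x - l x) < e / ?L" by (simp add: dist_norm)
    then have "?L * norm (f n x - l x) < e" by (simp add: pos_less_divide_eq mult.commute)
    moreover have "norm (u (f n x) - u (l x)) \<le> ?L * norm (f n x - l x)"
      by (rule order_trans[OF L]) (simp add: mult_right_mono)
    ultimately show "dist (u (f n x)) (u (l x)) < e" by (simp add: dist_norm)
  qed
qed

text \<open>Picard iteration; in the weight \<open>exp (2 L t)\<close> each step gains a factor \<open>1/2\<close>.\<close>

lemma ivp_exists:
  fixes u :: "'a::euclidean_space \<Rightarrow> 'a"
  assumes u: "Lip_bdd u"
  shows "\<exists>X. ivp u x X"
proof -
  obtain M L where M: "M \<ge> 0" "\<And>x. norm (u x) \<le> M"
    and L: "L \<ge> 1" "\<And>x y. norm (u x - u y) \<le> L * norm (x - y)"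
    by (rule Lip_bddE[OF u]) (rule that)
  define z where "z = rec_nat (\<lambda>_. x) (\<lambda>_ f t. x + integral {0..t::real} (\<lambda>s. u (f s)))"
  have z0: "z 0 = (\<lambda>_. x)" and zS: "z (Suc m) = (\<lambda>t. x + integral {0..t} (\<lambda>s. u (z m s)))" for m
    by (simp_all add: z_def)
  have cont: "continuous_on {0..} (z m)" for m
  proof (induction m)
    case (Suc m)
    have "continuous_on {0..} (\<lambda>s. u (z m s))"
      by (rule continuous_on_compose2[OF Lip_bdd_continuous[OF u, of UNIV] Suc]) auto
    from integral_has_vector_derivative_halfline[OF this]
    have "continuous_on {0..} (\<lambda>t. integral {0..t} (\<lambda>s. u (z m s)))"
      unfolding continuous_on_eq_continuous_within
      by (blast intro: has_vector_derivative_continuous)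
    then show ?case unfolding zS by (intro continuous_intros)
  qed (simp add: z0)
  have contu: "continuous_on S (\<lambda>s. u (f s))" if "continuous_on S f" for S and f :: "real \<Rightarrow> 'a"
    by (rule continuous_on_compose2[OF Lip_bdd_continuous[OF u, of UNIV] that]) auto
  have cont': "continuous_on {0..t} (z m)" for m t
    by (rule continuous_on_subset[OF cont]) auto
  have bd: "norm (z (Suc m) t - z m t) \<le> M * (1/2) ^ m * exp (2 * L * t)" if "t \<ge> 0" for m t
    using that
  proof (induction m arbitrary: t)
    case 0
    have "t \<le> exp (2 * L * t)"
      using exp_ge_add_one_self[of "2 * L * t"] 0 mult_right_mono[OF L(1) 0] by linarith
    then have "M * t \<le> M * exp (2 * L * t)" by (intro mult_left_mono M)
    moreover have "t * norm (u x) \<le> t * M" using M 0 by (intro mult_left_mono) auto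
    ultimately show ?case using 0 by (simp add: zS z0 mult.commute)
  next
    case (Suc m)
    let ?c = "M * (1/2) ^ m"
    have int: "((\<lambda>s. L * (?c * exp (2 * L * s))) has_integral
       (?c/2 * exp (2 * L * t) - ?c/2 * exp (2 * L * 0))) {0..t}"
      by (rule fundamental_theorem_of_calculus)
         (use Suc.prems L in \<open>auto simp: has_real_derivative_iff_has_vector_derivative[symmetric]
            intro!: derivative_eq_intros\<close>)
    have "z (Suc (Suc m)) t - z (Suc m) t = integral {0..t} (\<lambda>s. u (z (Suc m) s) - u (z m s))"
      unfolding zS[of "Suc m"] by (subst (2) zS)
        (simp add: integral_diff integrable_continuous_real[OF contu[OF cont']])
    also have "norm \<dots> \<le> integral {0..t} (\<lambda>s. L * (?c * exp (2 * L * s)))"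
    proof (rule integral_norm_bound_integral)
      show "(\<lambda>s. u (z (Suc m) s) - u (z m s)) integrable_on {0..t}"
        by (intro integrable_continuous_real continuous_intros contu cont')
      show "(\<lambda>s. L * (?c * exp (2 * L * s))) integrable_on {0..t}" using int by blast
      fix s assume "s \<in> {0..t}"
      then show "norm (u (z (Suc m) s) - u (z m s)) \<le> L * (?c * exp (2 * L * s))"
        using L by (intro order_trans[OF L(2)] mult_left_mono Suc.IH) auto
    qed
    also have "\<dots> = ?c/2 * exp (2 * L * t) - ?c/2 * exp (2 * L * 0)"
      using int by (rule integral_unique)
    also have "\<dots> \<le> M * (1/2) ^ Suc m * exp (2 * L * t)" using M by simp
    finally show ?case .
  qed
  \<comment> \<open>The limit is written as a telescoping series, so that the geometric bound on the
    increments gives uniform convergence on compact intervals by the Weierstrass test.\<close>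
  define Z where "Z = (\<lambda>t. x + (\<Sum>m. z (Suc m) t - z m t))"
  have tele: "z m t = x + (\<Sum>i<m. z (Suc i) t - z i t)" for m t
    by (subst sum_lessThan_telescope) (simp add: z0)
  have ul: "uniform_limit {0..t} z Z sequentially" for t
  proof -
    have "uniform_limit {0..t} (\<lambda>m s. \<Sum>i<m. z (Suc i) s - z i s) (\<lambda>s. \<Sum>m. z (Suc m) s - z m s) sequentially"
    proof (rule Weierstrass_m_test)
      fix m s assume s: "s \<in> {0..t}"
      have "M * (1/2) ^ m * exp (2 * L * s) \<le> M * (1/2) ^ m * exp (2 * L * t)"
        using s L M by (intro mult_left_mono) auto
      then show "norm (z (Suc m) s - z m s) \<le> M * exp (2 * L * t) * (1/2) ^ m"
        using bd[of s m] s by (simp add: mult_ac)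
    qed (intro summable_mult summable_geometric, simp)
    then have "uniform_limit {0..t} (\<lambda>m s. x + (\<Sum>i<m. z (Suc i) s - z i s)) Z sequentially"
      unfolding Z_def by (intro uniform_limit_intros)
    then show ?thesis by (simp add: tele[symmetric])
  qed
  have contZ: "continuous_on {0..t} Z" for t
    by (rule uniform_limit_theorem[OF _ ul]) (auto simp: cont')
  have eq: "Z t = x + integral {0..t} (\<lambda>s. u (Z s))" if t: "t \<ge> 0" for t
  proof -
    obtain I J where I: "\<And>n. ((\<lambda>s. u (z n s)) has_integral I n) {0..t}"
      and J: "((\<lambda>s. u (Z s)) has_integral J) {0..t}" and IJ: "I \<longlonglongrightarrow> J"
      by (rule uniform_limit_integral[OF uniform_limit_Lipschitz[OF ul L(2)]]) (auto intro!: contu cont')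
    have "(\<lambda>n. z (Suc n) t) \<longlonglongrightarrow> x + J"
      unfolding zS integral_unique[OF I] by (intro tendsto_intros IJ)
    moreover have "(\<lambda>n. z (Suc n) t) \<longlonglongrightarrow> Z t"
      by (rule LIMSEQ_Suc[OF tendsto_uniform_limitI[OF ul]]) (use t in auto)
    ultimately have "Z t = x + J" by (rule LIMSEQ_unique[symmetric])
    then show ?thesis using J by (simp add: integral_unique)
  qed
  have contZ': "continuous_on {0..} Z"
    unfolding continuous_on_eq_continuous_within
  proof
    fix t :: real assume t: "t \<in> {0..}"
    have "at t within {0..t+1} = at t within {0..}"
      using t by (intro at_within_nhd[of t "{..<t+1}"]) auto
    then show "continuous (at t within {0..}) Z"
      using contZ[of "t+1"] t unfolding continuous_on_eq_continuous_within
      by (metis atLeastAtMost_iff atLeast_iff less_add_one less_imp_le)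
  qed
  have "(Z has_vector_derivative u (Z t)) (at t within {0..})" if t: "t \<ge> 0" for t
  proof (rule has_vector_derivative_transform[OF _ eq])
    show "((\<lambda>t. x + integral {0..t} (\<lambda>s. u (Z s))) has_vector_derivative u (Z t)) (at t within {0..})"
      using has_vector_derivative_add[OF has_vector_derivative_const
          integral_has_vector_derivative_halfline[OF contu[OF contZ'] t], of x] by simp
  qed (use t in auto)
  then have "ivp u x Z" unfolding ivp_def using eq[of 0] by simp
  then show ?thesis by blast
qed

section \<open>The flow and its symmetries\<close>

lemma flow_ivp: "Lip_bdd u \<Longrightarrow> ivp u x (\<lambda>t. flow u t x)"
  unfolding flow_def eta_contract_eq by (rule someI_ex[of "ivp u x"]) (rule ivp_exists)

lemma flow_unique:
  assumes u: "Lip_bdd u" and X: "ivp u x X" and t: "t \<ge> 0"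
  shows "X t = flow u t x"
proof -
  obtain M L where L: "L \<ge> 1" "\<And>x y. norm (u x - u y) \<le> L * norm (x - y)"
    by (rule Lip_bddE[OF u]) (rule that)
  have "norm (X t - flow u t x) ^ 2 + 0 ^ 2 \<le> (norm (x - x) ^ 2 + 0 ^ 2) * exp ((2 * L + 1) * t)"
    by (rule ivp_gronwall[OF X flow_ivp[OF u] _ L(2)]) (use L t in auto)
  then show ?thesis by simp
qed

lemma flow_has_vector_derivative:
  "Lip_bdd u \<Longrightarrow> t \<ge> 0 \<Longrightarrow> ((\<lambda>t. flow u t x) has_vector_derivative u (flow u t x)) (at t within {0..})"
  using flow_ivp unfolding ivp_def by blast

lemma flow_0: "Lip_bdd u \<Longrightarrow> flow u 0 x = x"
  using flow_ivp[of u x] unfolding ivp_def by blast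

text \<open>One chain rule serves both symmetries in time: c = 1 gives the semigroup law and s = 0
  the scaling of the field.\<close>

lemma flow_rescale:
  assumes u: "Lip_bdd u" and c: "c \<ge> 0" "s \<ge> 0" and "t \<ge> 0"
  shows "((\<lambda>t. flow u (s + c * t) x) has_vector_derivative c *\<^sub>R u (flow u (s + c * t) x)) (at t within {0..})"
proof -
  have "((\<lambda>t. flow u t x) \<circ> (\<lambda>t. s + c * t) has_vector_derivative c *\<^sub>R u (flow u (s + c * t) x)) (at t within {0..})"
  proof (rule vector_diff_chain_within)
    show "((\<lambda>t. s + c * t) has_vector_derivative c) (at t within {0..})"
      by (auto simp: has_real_derivative_iff_has_vector_derivative[symmetric] intro!: derivative_eq_intros)
    show "((\<lambda>t. flow u t x) has_vector_derivative u (flow u (s + c * t) x)) (at (s + c * t) within (\<lambda>t. s + c * t) ` {0..})"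
      by (rule has_vector_derivative_within_subset[OF flow_has_vector_derivative[OF u]])
         (use assms in auto)
  qed
  then show ?thesis by (simp add: comp_def)
qed

lemma flow_semigroup:
  assumes u: "Lip_bdd u" and "t \<ge> 0" "s \<ge> 0"
  shows "flow u (s + t) x = flow u t (flow u s x)"
proof -
  have "ivp u (flow u s x) (\<lambda>t. flow u (s + 1 * t) x)"
    unfolding ivp_def using flow_rescale[OF u, of 1 s] assms by simp
  from flow_unique[OF u this \<open>t \<ge> 0\<close>] show ?thesis by simp
qed

lemma Lip_bdd_scale: "Lip_bdd u \<Longrightarrow> Lip_bdd (\<lambda>x. c *\<^sub>R u x)"
proof -
  assume "Lip_bdd u"
  then obtain M L where M: "\<And>x. norm (u x) \<le> M" and L: "\<And>x y. norm (u x - u y) \<le> L * norm (x - y)"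
    unfolding Lip_bdd_def by blast
  have "norm (c *\<^sub>R u x) \<le> \<bar>c\<bar> * M" for x using M by (simp add: mult_left_mono)
  moreover have "norm (c *\<^sub>R u x - c *\<^sub>R u y) \<le> (\<bar>c\<bar> * L) * norm (x - y)" for x y
    using mult_left_mono[OF L[of x y], of "\<bar>c\<bar>"] by (simp add: scaleR_diff_right[symmetric] mult_ac)
  ultimately show ?thesis unfolding Lip_bdd_def by blast
qed

lemma Lip_bdd_translate: "Lip_bdd u \<Longrightarrow> Lip_bdd (\<lambda>x. u (x + c))"
  unfolding Lip_bdd_def by (metis add_diff_cancel_right)

lemma flow_scale:
  assumes u: "Lip_bdd u" and "c \<ge> 0" "t \<ge> 0"
  shows "flow (\<lambda>x. c *\<^sub>R u x) t x = flow u (c * t) x"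
proof -
  have "ivp (\<lambda>x. c *\<^sub>R u x) x (\<lambda>t. flow u (0 + c * t) x)"
    unfolding ivp_def using flow_rescale[OF u, of c 0] assms by (simp add: flow_0[OF u])
  from flow_unique[OF Lip_bdd_scale[OF u] this \<open>t \<ge> 0\<close>] show ?thesis by simp
qed

text \<open>Translating the field conjugates its flow by the translation. This is the source of the
  translation equivariance of \<open>duhamel\<close>.\<close>

lemma flow_translate:
  assumes u: "Lip_bdd u" and "t \<ge> 0"
  shows "flow (\<lambda>x. u (x + c)) t x = flow u t (x + c) - c"
proof -
  have "ivp (\<lambda>x. u (x + c)) x (\<lambda>t. flow u t (x + c) - c)"
    unfolding ivp_def
  proof (intro conjI allI impI)
    fix t :: real assume "t \<ge> 0"
    from has_vector_derivative_diff[OF flow_has_vector_derivative[OF u this] has_vector_derivative_const]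
    show "((\<lambda>t. flow u t (x + c) - c) has_vector_derivative u (flow u t (x + c) - c + c)) (at t within {0..})"
      by simp
  qed (simp add: flow_0[OF u])
  from flow_unique[OF Lip_bdd_translate[OF u] this \<open>t \<ge> 0\<close>] show ?thesis by simp
qed

lemma Lip_bdd_const: "Lip_bdd (\<lambda>_. c)"
  unfolding Lip_bdd_def by (auto intro: exI[of _ 0])

lemma flow_const:
  assumes "t \<ge> 0" shows "flow (\<lambda>_. c) t x = x + t *\<^sub>R c"
proof -
  have "ivp (\<lambda>_. c) x (\<lambda>t. x + t *\<^sub>R c)"
    unfolding ivp_def has_vector_derivative_def by (auto intro!: derivative_eq_intros)
  from flow_unique[OF Lip_bdd_const this assms] show ?thesis by simp
qed

lemma flow_time_Lipschitz:
  assumes u: "Lip_bdd u" and M: "\<And>x. norm (u x) \<le> M" and "s \<ge> 0" "t \<ge> 0"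
  shows "norm (flow u t x - flow u s x) \<le> M * \<bar>t - s\<bar>"
proof -
  have "norm (flow u t x - flow u s x) \<le> M * norm (t - s)"
  proof (rule differentiable_bound[of "{0..}"])
    show "((\<lambda>t. flow u t x) has_derivative (\<lambda>h. h *\<^sub>R u (flow u r x))) (at r within {0..})" if "r \<in> {0..}" for r
      using flow_has_vector_derivative[OF u, of r x] that by (simp add: has_vector_derivative_def)
    show "onorm (\<lambda>h. h *\<^sub>R u (flow u r x)) \<le> M" for r
      by (rule onorm_le) (simp add: mult.commute[of M] mult_left_mono M)
  qed (use assms in auto)
  then show ?thesis by simp
qed

section \<open>Smoothness of flows via the Euler scheme\<close>

lemma bdd_Ck_fd:
  assumes "bdd_Ck (Suc k) I f"
  shows bdd_Ck_has_fd: "i \<in> I \<Longrightarrow> (f i has_derivative fd (f i) x) (at x)"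
    and bdd_Ck_fd_fam: "bdd_Ck k I (\<lambda>i x. fd (f i) x v)"
proof -
  obtain f' where f': "\<And>i x. i \<in> I \<Longrightarrow> (f i has_derivative f' i x) (at x)"
    by (rule bdd_Ck_SucE[OF assms]) (rule that)
  have d: "(f i has_derivative fd (f i) x) (at x)" if "i \<in> I" for i x
    using differentiableI[OF f'[OF that]] by (simp add: frechet_derivative_works)
  then show "i \<in> I \<Longrightarrow> (f i has_derivative fd (f i) x) (at x)" .
  show "bdd_Ck k I (\<lambda>i x. fd (f i) x v)"
    by (intro bdd_Ck_deriv[OF assms] d)
qed

lemma bdd_Cinf_Lip_bdd:
  assumes "bdd_Cinf I u" "i \<in> I" shows "Lip_bdd (u i)"
proof -
  obtain M where "M \<ge> 0" "\<And>i x. i \<in> I \<Longrightarrow> norm (u i x) \<le> M"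
    by (rule bdd_Cinf_bounded[OF assms(1)]) (rule that)
  moreover obtain L where "L \<ge> 0" "\<And>i x y. i \<in> I \<Longrightarrow> norm (u i x - u i y) \<le> L * norm (x - y)"
    by (rule bdd_Cinf_Lipschitz[OF assms(1)]) (rule that)
  ultimately show ?thesis using assms(2) unfolding Lip_bdd_def by blast
qed

text \<open>A discrete Gronwall argument; differentiating the recursion in the parameter \<open>x\<close> yields
  a recursion with the same linear part.\<close>

lemma bdd_Ck_linear_recursion:
  fixes w c :: "'p \<times> nat \<Rightarrow> 'a::euclidean_space \<Rightarrow> 'b::euclidean_space"
  assumes h: "\<And>p. p \<in> P \<Longrightarrow> 0 \<le> h p" "\<And>p. p \<in> P \<Longrightarrow> h p * real (n p) \<le> 1"
    and J: "J = {(p, j). p \<in> P \<and> j \<le> n p}"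
    and "\<And>b. b \<in> Basis \<Longrightarrow> bdd_Ck k J (a b)" and "bdd_Ck k J c"
    and "\<And>p x. p \<in> P \<Longrightarrow> w (p, 0) x = 0"
    and "\<And>p j x. p \<in> P \<Longrightarrow> j < n p \<Longrightarrow>
      w (p, Suc j) x = w (p, j) x + h p *\<^sub>R (c (p, j) x + (\<Sum>b\<in>Basis. (w (p, j) x \<bullet> b) *\<^sub>R a b (p, j) x))"
  shows "bdd_Ck k J w"
  using assms(4-)
proof (induction k arbitrary: w c)
  case (0 w c)
  note prems0 = 0
  have "\<exists>M. \<forall>b\<in>Basis. M b \<ge> 0 \<and> (\<forall>q\<in>J. \<forall>x. norm (a b q x) \<le> M b)"
  proof (rule bchoice, rule ballI)
    fix b :: 'b assume "b \<in> Basis"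
    show "\<exists>M. M \<ge> 0 \<and> (\<forall>q\<in>J. \<forall>x. norm (a b q x) \<le> M)"
      by (rule bdd_Ck_bounded[OF 0(1)[OF \<open>b \<in> Basis\<close>]]) (intro exI conjI ballI allI, assumption, simp)
  qed
  then obtain M where M: "\<And>b. b \<in> Basis \<Longrightarrow> M b \<ge> 0"
     "\<And>b q x. b \<in> Basis \<Longrightarrow> q \<in> J \<Longrightarrow> norm (a b q x) \<le> M b"
    by blast
  obtain C' where C': "C' \<ge> 0" "\<And>q x. q \<in> J \<Longrightarrow> norm (c q x) \<le> C'"
    by (rule bdd_Ck_bounded[OF 0(2)]) (rule that)
  define C where "C = (\<Sum>b\<in>(Basis::'b set). M b)"
  have C0: "C \<ge> 0" unfolding C_def by (intro sum_nonneg M)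
  have MC: "M b \<le> C" if "b \<in> Basis" for b unfolding C_def by (intro member_le_sum that M finite_Basis) auto
  define B where "B = C' + real DIM('b) * C"
  have B0: "B \<ge> 0" unfolding B_def using C0 C' by simp
  \<comment> \<open>The summand 1 absorbs the source term: C' + D C |w| \<le> B (1 + |w|), with D
    the dimension, so the affine recursion becomes a purely multiplicative one.\<close>
  have grow: "1 + norm (w (p, j) x) \<le> (1 + h p * B) ^ j" if p: "p \<in> P" and "j \<le> n p" for p j x
    using that(2)
  proof (induction j)
    case 0 show ?case using prems0(3)[OF p] by simp
  next
    case (Suc j)
    let ?w = "w (p, j) x"
    have q: "(p, j) \<in> J" using p Suc.prems J by simp
    have "norm (\<Sum>b\<in>Basis. (?w \<bullet> b) *\<^sub>R a b (p, j) x) \<le> real DIM('b) * C * norm ?w"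
      by (rule norm_Basis_combination_le) (rule order_trans[OF M(2)[OF _ q] MC])
    then have "norm (c (p, j) x + (\<Sum>b\<in>Basis. (?w \<bullet> b) *\<^sub>R a b (p, j) x)) \<le> C' + real DIM('b) * C * norm ?w"
      using C'(2)[OF q] by (rule norm_triangle_mono[rotated])
    also have "\<dots> \<le> B * (1 + norm ?w)" unfolding B_def using C'(1) C0 by (simp add: algebra_simps)
    finally have 1: "norm (h p *\<^sub>R (c (p, j) x + (\<Sum>b\<in>Basis. (?w \<bullet> b) *\<^sub>R a b (p, j) x))) \<le> h p * (B * (1 + norm ?w))"
      using h(1)[OF p] by (simp add: mult_left_mono)
    have "1 + norm (w (p, Suc j) x) \<le> (1 + h p * B) * (1 + norm ?w)"
      using norm_triangle_le[OF add_left_mono[OF 1, of "norm ?w"]] Suc.prems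
      by (simp add: prems0(4)[OF p] algebra_simps)
    also have "\<dots> \<le> (1 + h p * B) * (1 + h p * B) ^ j"
      using Suc h(1)[OF p] B0 by (intro mult_left_mono) auto
    finally show ?case by simp
  qed
  have "norm (w q x) \<le> exp B" if "q \<in> J" for q x
  proof -
    obtain p j where q: "q = (p, j)" "p \<in> P" "j \<le> n p" using \<open>q \<in> J\<close> J by auto
    have hB: "h p * B \<ge> 0" using h(1)[OF q(2)] B0 by simp
    have "norm (w q x) \<le> (1 + h p * B) ^ j" using grow[OF q(2,3), of x] q(1) by simp
    also have "\<dots> \<le> exp (h p * B) ^ j"
      using hB by (intro power_mono) (auto simp: add.commute exp_ge_add_one_self[simplified add.commute])
    also have "\<dots> = exp (real j * h p * B)" by (simp add: exp_of_nat_mult mult.assoc)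
    \<comment> \<open>At most n steps of size h with h n \<le> 1 are made, so the bound depends
      neither on the step size nor on the number of steps.\<close>
    also have "\<dots> \<le> exp B"
    proof -
      have "real j * h p \<le> real (n p) * h p" using q h(1)[OF q(2)] by (intro mult_right_mono) auto
      then have "real j * h p \<le> 1" using h(2)[OF q(2)] by (simp add: mult.commute)
      then show ?thesis using B0 mult_right_mono[of "real j * h p" 1 B] by simp
    qed
    finally show ?thesis .
  qed
  then show ?case unfolding bdd_Ck.simps by blast
next
  case (Suc k w c)
  note a' = bdd_Ck_has_fd[OF Suc.prems(1)] and c' = bdd_Ck_has_fd[OF Suc.prems(2)]
  have a0: "bdd_Ck k J (a b)" if "b \<in> Basis" for b by (rule bdd_Ck_SucD[OF Suc.prems(1)[OF that]])
  \<comment> \<open>The induction hypothesis is used twice. Here it bounds w itself to order k,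
    because w enters the source term of the recursion for its derivative.\<close>
  have w0: "bdd_Ck k J w"
    by (rule Suc.IH[OF a0 bdd_Ck_SucD[OF Suc.prems(2)] Suc.prems(3,4)])
  have step: "(w (p, Suc j) has_derivative (\<lambda>v. fd (w (p, j)) x v + h p *\<^sub>R
       ((fd (c (p, j)) x v + (\<Sum>b\<in>Basis. (w (p, j) x \<bullet> b) *\<^sub>R fd (a b (p, j)) x v)) +
       (\<Sum>b\<in>Basis. (fd (w (p, j)) x v \<bullet> b) *\<^sub>R a b (p, j) x)))) (at x)"
    if p: "p \<in> P" and j: "j < n p" and d: "(w (p, j) has_derivative fd (w (p, j)) x) (at x)" for p j x
  proof -
    have q: "(p, j) \<in> J" using p j J by simp
    have eq: "w (p, Suc j) = (\<lambda>x. w (p, j) x + h p *\<^sub>R (c (p, j) x + (\<Sum>b\<in>Basis. (w (p, j) x \<bullet> b) *\<^sub>R a b (p, j) x)))"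
      using Suc.prems(4)[OF p j] by blast
    show ?thesis
      unfolding eq
      by (rule derivative_eq_intros d a' c' q refl | assumption)+
         (simp add: fun_eq_iff sum.distrib scaleR_add_right add_ac)
  qed
  have hd: "(w (p, j) has_derivative fd (w (p, j)) x) (at x)" if p: "p \<in> P" and "j \<le> n p" for p j x
    using that(2)
  proof (induction j)
    case 0
    have "w (p, 0) = (\<lambda>_. 0)" using Suc.prems(3)[OF p] by blast
    then show ?case by simp
  next
    case (Suc j)
    then have "(w (p, j) has_derivative fd (w (p, j)) x) (at x)" by simp
    from differentiableI[OF step[OF p _ this]] Suc.prems show ?case
      by (simp add: frechet_derivative_works)
  qed
  obtain M where M: "\<And>q x. q \<in> J \<Longrightarrow> norm (w q x) \<le> M"
    by (rule bdd_Ck_bounded[OF w0]) (rule that)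
  show ?case
  proof (rule bdd_Ck_SucI[OF M])
    show "(w q has_derivative fd (w q) x) (at x)" if "q \<in> J" for q x
      using hd that J by auto
    show "bdd_Ck k J (\<lambda>q x. fd (w q) x v)" for v
    proof (rule Suc.IH[where c = "\<lambda>q x. fd (c q) x v + (\<Sum>b\<in>Basis. (w q x \<bullet> b) *\<^sub>R fd (a b q) x v)"])
      show "bdd_Ck k J (\<lambda>q x. fd (c q) x v + (\<Sum>b\<in>Basis. (w q x \<bullet> b) *\<^sub>R fd (a b q) x v))"
        by (intro bdd_Ck_add bdd_Ck_Basis_expand w0 bdd_Ck_fd_fam Suc.prems(1,2))
      show "fd (w (p, 0)) x v = 0" if "p \<in> P" for p x
      proof -
        have "w (p, 0) = (\<lambda>_. 0)" using Suc.prems(3)[OF that] by blast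
        then show ?thesis by simp
      qed
      show "fd (w (p, Suc j)) x v = fd (w (p, j)) x v + h p *\<^sub>R
         ((fd (c (p, j)) x v + (\<Sum>b\<in>Basis. (w (p, j) x \<bullet> b) *\<^sub>R fd (a b (p, j)) x v)) +
          (\<Sum>b\<in>Basis. (fd (w (p, j)) x v \<bullet> b) *\<^sub>R a b (p, j) x))"
        if "p \<in> P" "j < n p" for p j x
        using fd_eqI[OF step[OF that hd[OF that(1)]]] that(2) by simp
    qed (rule a0)
  qed
qed

text \<open>The recursion stores the displacement from x, which stays bounded over unit time; the
  Euler point itself is x plus this value.\<close>

primrec euler :: "('a::euclidean_space \<Rightarrow> 'a) \<Rightarrow> real \<Rightarrow> nat \<Rightarrow> 'a \<Rightarrow> 'a" where
  "euler u h 0 x = 0"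
| "euler u h (Suc j) x = euler u h j x + h *\<^sub>R u (x + euler u h j x)"

text \<open>The Euler recursion is nonlinear, but the derivatives of its iterates obey a linear one
  whose coefficients are Du at the iterates. A bound of order k on the iterates bounds these
  coefficients to order k, hence the derivatives to order k, hence the iterates to order k +
  1.\<close>

lemma bdd_Cinf_euler:
  fixes u :: "'i \<Rightarrow> 'a::euclidean_space \<Rightarrow> 'a"
  assumes u: "bdd_Cinf I u"
  defines "J \<equiv> {(p, j). p \<in> I \<times> (UNIV :: nat set) \<and> j \<le> Suc (snd p)}"
  shows "bdd_Cinf J (\<lambda>q. euler (u (fst (fst q))) (1 / real (Suc (snd (fst q)))) (snd q))"
    (is "bdd_Cinf J ?E")
  unfolding bdd_Cinf_def
proof
  let ?h = "\<lambda>p :: 'i \<times> nat. 1 / real (Suc (snd p))"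
  fix k
  show "bdd_Ck k J ?E"
  proof (induction k)
    case 0
    obtain M where M: "M \<ge> 0" "\<And>i x. i \<in> I \<Longrightarrow> norm (u i x) \<le> M"
      by (rule bdd_Cinf_bounded[OF u]) (rule that)
    have "norm (euler (u i) h j x) \<le> real j * h * M" if i: "i \<in> I" and "h \<ge> 0" for i h j x
    proof (induction j)
      case (Suc j)
      have "norm (h *\<^sub>R u i (x + euler (u i) h j x)) \<le> h * M"
        using M(2)[OF i] \<open>h \<ge> 0\<close> by (simp add: mult_left_mono)
      from norm_triangle_mono[OF Suc this] show ?case by (simp add: algebra_simps)
    qed simp
    note bd = this
    have "norm (?E q x) \<le> M" if "q \<in> J" for q x
    proof -
      obtain i n j where q: "q = ((i, n), j)" "i \<in> I" "j \<le> Suc n" using \<open>q \<in> J\<close> J_def by auto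
      have "real j * (1 / real (Suc n)) * M \<le> 1 * M"
        using q M by (intro mult_right_mono) auto
      then show ?thesis using bd[OF q(2), of "1 / real (Suc n)" j x] q(1) by simp
    qed
    then show ?case unfolding bdd_Ck.simps by blast
  next
    case (Suc k)
    have q_I: "fst (fst q) \<in> I" if "q \<in> J" for q using that J_def by auto
    note u' = bdd_Cinf_has_fd[OF u]
    have step: "(euler (u i) h (Suc j) has_derivative (\<lambda>v. fd (euler (u i) h j) x v + h *\<^sub>R
         (fd (u i) (x + euler (u i) h j x) v +
         (\<Sum>b\<in>Basis. (fd (euler (u i) h j) x v \<bullet> b) *\<^sub>R fd (u i) (x + euler (u i) h j x) b)))) (at x)"
      if i: "i \<in> I" and d: "(euler (u i) h j has_derivative fd (euler (u i) h j) x) (at x)" for i h j x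
    proof -
      let ?e = "euler (u i) h j"
      have "((\<lambda>x. x + ?e x) has_derivative (\<lambda>v. v + fd ?e x v)) (at x)"
        by (intro has_derivative_add has_derivative_ident d)
      note D = has_derivative_compose[OF this u'[OF i]]
      have lin: "linear (fd (u i) (x + ?e x))" using u'[OF i] by (rule has_derivative_linear)
      have expand: "fd (u i) (x + ?e x) (v + w) =
          fd (u i) (x + ?e x) v + (\<Sum>b\<in>Basis. (w \<bullet> b) *\<^sub>R fd (u i) (x + ?e x) b)" for v w
        by (subst linear_add[OF lin], subst linear_Basis_expand[OF lin, of w]) (rule refl)
      have "euler (u i) h (Suc j) = (\<lambda>x. ?e x + h *\<^sub>R u i (x + ?e x))" by (simp add: fun_eq_iff)
      moreover have "((\<lambda>x. ?e x + h *\<^sub>R u i (x + ?e x)) has_derivative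
           (\<lambda>v. fd ?e x v + h *\<^sub>R fd (u i) (x + ?e x) (v + fd ?e x v))) (at x)"
        by (intro has_derivative_add d has_derivative_scaleR_right D)
      ultimately show ?thesis
        by (simp only: expand)
    qed
    have hd: "(euler (u i) h j has_derivative fd (euler (u i) h j) x) (at x)" if i: "i \<in> I" for i h j x
    proof (induction j)
      case 0
      have "euler (u i) h 0 = (\<lambda>_. 0)" by (simp add: fun_eq_iff)
      then show ?case by simp
    next
      case (Suc j)
      from differentiableI[OF step[OF i Suc]] show ?case unfolding frechet_derivative_works .
    qed
    obtain M where M: "\<And>q x. q \<in> J \<Longrightarrow> norm (?E q x) \<le> M"
      by (rule bdd_Ck_bounded[OF Suc.IH]) (rule that)
    \<comment> \<open>Serves both as coefficient, with b a basis vector, and as source term, with b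
      the direction of differentiation.\<close>
    have uk: "bdd_Ck k J (\<lambda>q x. fd (u (fst (fst q))) (x + ?E q x) b)" for b
      by (rule bdd_Ck_comp[OF _ Suc.IH])
         (rule bdd_Ck_reindex[OF bdd_Cinf_fd_fam[OF u, unfolded bdd_Cinf_def, rule_format] q_I])
    show ?case
    proof (rule bdd_Ck_SucI[OF M])
      show "(?E q has_derivative fd (?E q) x) (at x)" if "q \<in> J" for q x
        by (rule hd[OF q_I[OF that]])
      show "bdd_Ck k J (\<lambda>q x. fd (?E q) x v)" for v
      proof (rule bdd_Ck_linear_recursion[where P = "I \<times> UNIV" and h = ?h and n = "\<lambda>p. Suc (snd p)"
            and c = "\<lambda>q x. fd (u (fst (fst q))) (x + ?E q x) v"
            and a = "\<lambda>b q x. fd (u (fst (fst q))) (x + ?E q x) b"])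
        show "bdd_Ck k J (\<lambda>q x. fd (u (fst (fst q))) (x + ?E q x) v)" by (rule uk)
        show "bdd_Ck k J (\<lambda>q x. fd (u (fst (fst q))) (x + ?E q x) b)" for b by (rule uk)
        fix p :: "'i \<times> nat" assume p: "p \<in> I \<times> UNIV"
        have "?E (p, 0) = (\<lambda>_. 0)" by (simp add: fun_eq_iff)
        then show "fd (?E (p, 0)) x v = 0" for x by simp
        have pI: "fst p \<in> I" using p by auto
        show "fd (?E (p, Suc j)) x v = fd (?E (p, j)) x v + ?h p *\<^sub>R
          (fd (u (fst (fst (p, j)))) (x + ?E (p, j) x) v +
           (\<Sum>b\<in>Basis. (fd (?E (p, j)) x v \<bullet> b) *\<^sub>R fd (u (fst (fst (p, j)))) (x + ?E (p, j) x) b))" for j x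
          using fd_eqI[OF step[OF pI hd[OF pI]]] by simp
      qed (auto simp: J_def)
    qed
  qed
qed

text \<open>Within one step the velocity along the trajectory changes by at most L M h, so each step
  adds a local error L M h^2 and multiplies the earlier error by at most 1 + L h.\<close>

lemma euler_error:
  assumes u: "Lip_bdd u" and M: "M \<ge> 0" "\<And>x. norm (u x) \<le> M"
    and L: "L \<ge> 0" "\<And>x y. norm (u x - u y) \<le> L * norm (x - y)" and h: "h \<ge> 0"
  shows "norm (x + euler u h j x - flow u (real j * h) x) \<le> real j * (L * M * h ^ 2) * (1 + L * h) ^ j"
proof (induction j)
  case 0 then show ?case by (simp add: flow_0[OF u])
next
  case (Suc j)
  let ?s = "real j * h" and ?y = "x + euler u h j x"
  let ?X = "\<lambda>t. flow u t x"
  have trunc: "norm (?X (?s + h) - ?X ?s - (?s + h - ?s) *\<^sub>R u (?X ?s)) \<le> norm (?s + h - ?s) * (L * (M * h))"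
  proof (rule vector_differentiable_bound_linearization[where S="{?s..?s + h}" and f' = "\<lambda>t. u (?X t)"])
    show "(?X has_vector_derivative u (?X t)) (at t within {?s..?s + h})" if "t \<in> {?s..?s + h}" for t
    proof (rule has_vector_derivative_within_subset[OF flow_has_vector_derivative[OF u]])
      have "?s \<ge> 0" using h by simp
      then show "{?s..?s + h} \<subseteq> {0..}" by (meson Icc_subset_Ici_iff)
      then show "t \<ge> 0" using that by blast
    qed
    show "closed_segment ?s (?s + h) \<subseteq> {?s..?s + h}" using h by (simp add: closed_segment_eq_real_ivl)
    show "norm (u (?X t) - u (?X ?s)) \<le> L * (M * h)" if t: "t \<in> {?s..?s + h}" for t
    proof -
      have s0: "?s \<ge> 0" using h by simp
      then have t0: "t \<ge> 0" using t by (meson atLeastAtMost_iff order_trans)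
      have "norm (?X t - ?X ?s) \<le> M * \<bar>t - ?s\<bar>"
        by (rule flow_time_Lipschitz[OF u M(2) s0 t0])
      also have "\<dots> \<le> M * h" using t M by (intro mult_left_mono) auto
      finally show ?thesis using L(1) by (intro order_trans[OF L(2)] mult_left_mono)
    qed
  qed (use h in auto)
  have "x + euler u h (Suc j) x - ?X (real (Suc j) * h) =
     (?y - ?X ?s) + h *\<^sub>R (u ?y - u (?X ?s)) - (?X (?s + h) - ?X ?s - h *\<^sub>R u (?X ?s))"
    by (simp add: algebra_simps)
  also have "norm \<dots> \<le> norm (?y - ?X ?s) + h * (L * norm (?y - ?X ?s)) + L * M * h ^ 2"
  proof -
    have "norm (h *\<^sub>R (u ?y - u (?X ?s))) \<le> h * (L * norm (?y - ?X ?s))"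
      using L(2)[of ?y "?X ?s"] h by (simp add: mult_left_mono)
    moreover have "norm (?X (?s + h) - ?X ?s - h *\<^sub>R u (?X ?s)) \<le> L * M * h ^ 2"
      using trunc h by (simp add: power2_eq_square mult_ac)
    ultimately show ?thesis
      using norm_triangle_ineq4[of "(?y - ?X ?s) + h *\<^sub>R (u ?y - u (?X ?s))" "?X (?s + h) - ?X ?s - h *\<^sub>R u (?X ?s)"]
        norm_triangle_ineq[of "?y - ?X ?s" "h *\<^sub>R (u ?y - u (?X ?s))"] by linarith
  qed
  also have "\<dots> = (1 + L * h) * norm (?y - ?X ?s) + L * M * h ^ 2" by (simp add: algebra_simps)
  \<comment> \<open>The new local error is enlarged by the factor (1 + L h)^(j+1) \<ge> 1 to fit the
    closed form of the bound.\<close>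
  also have "\<dots> \<le> (1 + L * h) * (real j * (L * M * h ^ 2) * (1 + L * h) ^ j) + L * M * h ^ 2 * (1 + L * h) ^ Suc j"
  proof (rule add_mono)
    show "(1 + L * h) * norm (?y - ?X ?s) \<le> (1 + L * h) * (real j * (L * M * h ^ 2) * (1 + L * h) ^ j)"
      using Suc L h by (intro mult_left_mono) auto
    have "1 \<le> (1 + L * h) ^ Suc j" using L h by (intro one_le_power) simp
    then show "L * M * h ^ 2 \<le> L * M * h ^ 2 * (1 + L * h) ^ Suc j"
      using mult_left_mono[of 1 "(1 + L * h) ^ Suc j" "L * M * h ^ 2"] L M by simp
  qed
  also have "\<dots> = real (Suc j) * (L * M * h ^ 2) * (1 + L * h) ^ Suc j" by (simp add: algebra_simps)
  finally show ?case .
qed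

lemma euler_tendsto_flow:
  assumes u: "Lip_bdd u"
  shows "(\<lambda>n. euler u (1 / real (Suc n)) (Suc n) x) \<longlonglongrightarrow> flow u 1 x - x"
proof -
  obtain M L where M: "M \<ge> 0" "\<And>x. norm (u x) \<le> M"
    and L: "L \<ge> 1" "\<And>x y. norm (u x - u y) \<le> L * norm (x - y)"
    by (rule Lip_bddE[OF u]) (rule that)
  have "norm (euler u (1 / real (Suc n)) (Suc n) x - (flow u 1 x - x)) \<le> (L * M * exp L) * inverse (real (Suc n))" for n
  proof -
    let ?h = "1 / real (Suc n)"
    have "norm (x + euler u ?h (Suc n) x - flow u (real (Suc n) * ?h) x)
        \<le> real (Suc n) * (L * M * ?h ^ 2) * (1 + L * ?h) ^ Suc n"
      by (rule euler_error[OF u M _ L(2)]) (use L in auto)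
    also have "\<dots> \<le> real (Suc n) * (L * M * ?h ^ 2) * exp L"
    proof (rule mult_left_mono)
      have "(1 + L * ?h) ^ Suc n \<le> exp (L * ?h) ^ Suc n"
        using L by (intro power_mono exp_ge_add_one_self) auto
      also have "\<dots> = exp (real (Suc n) * (L * ?h))" by (rule exp_of_nat_mult[symmetric])
      also have "real (Suc n) * (L * ?h) = L" by simp
      finally show "(1 + L * ?h) ^ Suc n \<le> exp L" .
    qed (use L M in auto)
    also have "\<dots> = (L * M * exp L) * inverse (real (Suc n))"
    proof -
      have "a * (c * (1 / a) ^ 2) * e = c * e * inverse a" if "a \<noteq> 0" for a c e :: real
        using that by (simp add: power2_eq_square field_simps)
      then show ?thesis by (metis of_nat_eq_0_iff nat.distinct(1))
    qed
    finally show ?thesis by (simp add: algebra_simps)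
  qed
  then have "(\<lambda>n. euler u (1 / real (Suc n)) (Suc n) x - (flow u 1 x - x)) \<longlonglongrightarrow> 0"
    by (intro Lim_null_comparison[OF always_eventually tendsto_mult_right_zero[OF LIMSEQ_inverse_real_of_nat]]) blast
  then show ?thesis by (simp add: LIM_zero_iff)
qed

lemma bdd_Cinf_flow1:
  fixes u :: "'i \<Rightarrow> 'a::euclidean_space \<Rightarrow> 'a"
  assumes u: "bdd_Cinf I u"
  shows "bdd_Cinf I (\<lambda>i x. flow (u i) 1 x - x)"
proof (rule bdd_Cinf_pointwise_limit)
  show "bdd_Cinf (UNIV \<times> I) (\<lambda>p. euler (u (snd p)) (1 / real (Suc (fst p))) (Suc (fst p)))"
    using bdd_Cinf_reindex[OF bdd_Cinf_euler[OF u], of "UNIV \<times> I" "\<lambda>p. ((snd p, fst p), Suc (fst p))"]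
    by auto
  show "(\<lambda>n. euler (u (snd (n, i))) (1 / real (Suc (fst (n, i)))) (Suc (fst (n, i))) x) \<longlonglongrightarrow> flow (u i) 1 x - x"
    if "i \<in> I" for i x
    using euler_tendsto_flow[OF bdd_Cinf_Lip_bdd[OF u that]] by simp
qed

text \<open>The pair (i, t) indexes the field t u_i. As t stays in the unit interval these fields
  form a bounded family, and the result at time 1 gives uniformity in time.\<close>

lemma bdd_Cinf_flow:
  fixes u :: "'i \<Rightarrow> 'a::euclidean_space \<Rightarrow> 'a"
  assumes u: "bdd_Cinf I u"
  shows "bdd_Cinf (I \<times> {0..1}) (\<lambda>p x. flow (u (fst p)) (snd p) x - x)"
proof (rule bdd_Cinf_cong)
  show "bdd_Cinf (I \<times> {0..1}) (\<lambda>p x. flow (\<lambda>y. snd p *\<^sub>R u (fst p) y) 1 x - x)"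
    by (intro bdd_Cinf_flow1 bdd_Cinf_scale_const[of _ snd 1] bdd_Cinf_reindex[OF u]) auto
  fix p :: "'i \<times> real" and x assume "p \<in> I \<times> {0..1}"
  then show "flow (\<lambda>y. snd p *\<^sub>R u (fst p) y) 1 x - x = flow (u (fst p)) (snd p) x - x"
    using flow_scale[OF bdd_Cinf_Lip_bdd[OF u], of "fst p" "snd p" 1 x] by auto
qed

section \<open>Derivatives of flows and the Alekseev-Groebner operator\<close>

abbreviation Cinf_bdd :: "('a::euclidean_space \<Rightarrow> 'b::euclidean_space) \<Rightarrow> bool" where
  "Cinf_bdd u \<equiv> bdd_Cinf {()} (\<lambda>_. u)"

lemma bdd_Cinf_member: "bdd_Cinf I u \<Longrightarrow> i \<in> I \<Longrightarrow> Cinf_bdd (u i)"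
  by (rule bdd_Cinf_reindex[of I u "{()}" "\<lambda>_. i"]) simp_all

lemma Cinf_bdd_family: "Cinf_bdd u \<Longrightarrow> bdd_Cinf I (\<lambda>_. u)"
  by (rule bdd_Cinf_reindex[of "{()}" "\<lambda>_. u" I "\<lambda>_. ()"]) simp_all

lemma Cinf_bdd_Lip_bdd: "Cinf_bdd u \<Longrightarrow> Lip_bdd u"
  using bdd_Cinf_Lip_bdd[of "{()}" "\<lambda>_. u" "()"] by simp

lemma fd_flow:
  assumes u: "Cinf_bdd u" and t: "t \<in> {0..1}"
  shows flow_has_fd: "(flow u t has_derivative fd (flow u t) x) (at x)"
    and fd_flow_eq: "fd (flow u t) x b = b + fd (\<lambda>x. flow u t x - x) x b"
proof -
  have "((\<lambda>x. flow u t x - x) has_derivative fd (\<lambda>x. flow u t x - x) x) (at x)"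
    using bdd_Cinf_has_fd[OF bdd_Cinf_flow[OF u], of "((), t)" x] t by simp
  from has_derivative_add[OF has_derivative_ident this]
  have d: "(flow u t has_derivative (\<lambda>b. b + fd (\<lambda>x. flow u t x - x) x b)) (at x)"
    by simp
  then show "(flow u t has_derivative fd (flow u t) x) (at x)" by (simp add: fd_eqI[OF d])
  show "fd (flow u t) x b = b + fd (\<lambda>x. flow u t x - x) x b" by (simp add: fd_eqI[OF d])
qed

lemma bdd_Cinf_fd_flow:
  assumes u: "bdd_Cinf I u"
  shows "bdd_Cinf (I \<times> {0..1}) (\<lambda>p x. fd (flow (u (fst p)) (snd p)) x b)"
proof (rule bdd_Cinf_cong)
  show "bdd_Cinf (I \<times> {0..1}) (\<lambda>p x. b + fd (\<lambda>x. flow (u (fst p)) (snd p) x - x) x b)"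
    by (intro bdd_Cinf_add bdd_Cinf_const[where M="norm b"] bdd_Cinf_fd_fam bdd_Cinf_flow u order_refl)
  fix p :: "'a \<times> real" and x assume "p \<in> I \<times> {0..1}"
  then show "b + fd (\<lambda>x. flow (u (fst p)) (snd p) x - x) x b = fd (flow (u (fst p)) (snd p)) x b"
    by (intro fd_flow_eq[symmetric] bdd_Cinf_member[OF u]) auto
qed

lemma bdd_Cinf_comp_flow:
  assumes v: "bdd_Cinf I v" and g: "bdd_Cinf (I \<times> {0..1}) g"
  shows "bdd_Cinf (I \<times> {0..1}) (\<lambda>p x. g p (flow (v (fst p)) (snd p) x))"
  using bdd_Cinf_comp[OF g bdd_Cinf_flow[OF v]] by simp

text \<open>The operator A of the overview: the perturbation h, felt at time s along the trajectory
  of v, is transported to time 1 by the linearised flow of u.\<close>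

definition duhamel :: "('a::euclidean_space \<Rightarrow> 'a) \<Rightarrow> ('a \<Rightarrow> 'a) \<Rightarrow> ('a \<Rightarrow> 'a) \<Rightarrow> 'a \<Rightarrow> 'a" where
  "duhamel u v h x = integral {0..1} (\<lambda>s. fd (flow u (1 - s)) (flow v s x) (h (flow v s x)))"

lemma duhamel_integrand_expand:
  assumes "Cinf_bdd u" "s \<in> {0..1}"
  shows "fd (flow u (1 - s)) y w = (\<Sum>b\<in>Basis. (w \<bullet> b) *\<^sub>R fd (flow u (1 - s)) y b)"
  using assms by (intro has_derivative_Basis_expand[OF flow_has_fd]) auto

text \<open>A Lipschitz constant that is uniform in the parameter upgrades continuity at each fixed
  point to continuity along a moving point.\<close>

lemma continuous_on_Lipschitz_param:
  fixes K :: "'s::topological_space \<Rightarrow> 'a::real_normed_vector \<Rightarrow> 'b::real_normed_vector"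
  assumes L: "\<And>s x y. s \<in> S \<Longrightarrow> norm (K s x - K s y) \<le> L * norm (x - y)"
    and K: "\<And>y. continuous_on S (\<lambda>s. K s y)" and \<xi>: "continuous_on S \<xi>"
  shows "continuous_on S (\<lambda>s. K s (\<xi> s))"
  unfolding continuous_on_def
proof
  fix a assume a: "a \<in> S"
  have 1: "((\<lambda>s. K s (\<xi> a)) \<longlongrightarrow> K a (\<xi> a)) (at a within S)"
    using K a unfolding continuous_on_def by blast
  have "((\<lambda>s. L * norm (\<xi> s - \<xi> a)) \<longlongrightarrow> L * norm (\<xi> a - \<xi> a)) (at a within S)"
    using \<xi> a unfolding continuous_on_def by (intro tendsto_intros) blast
  then have "((\<lambda>s. L * norm (\<xi> s - \<xi> a)) \<longlongrightarrow> 0) (at a within S)" by simp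
  moreover have "\<forall>\<^sub>F s in at a within S. norm (K s (\<xi> s) - K s (\<xi> a)) \<le> L * norm (\<xi> s - \<xi> a)"
    using L by (auto simp: eventually_at_filter)
  ultimately have "((\<lambda>s. K s (\<xi> s) - K s (\<xi> a)) \<longlongrightarrow> 0) (at a within S)"
    by (rule Lim_null_comparison[rotated])
  from tendsto_add[OF this 1] show "((\<lambda>s. K s (\<xi> s)) \<longlongrightarrow> K a (\<xi> a)) (at a within S)" by simp
qed

lemma flow_continuous_time: "Lip_bdd u \<Longrightarrow> continuous_on {0..} (\<lambda>t. flow u t x)"
  unfolding continuous_on_eq_continuous_within
  by (auto intro: has_vector_derivative_continuous flow_has_vector_derivative)

lemma continuous_on_duhamel_integrand:
  assumes u: "Cinf_bdd u" and v: "Cinf_bdd v" and h: "Cinf_bdd h"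
  shows "continuous_on {0..1} (\<lambda>s. fd (flow u (1 - s)) (flow v s x) (h (flow v s x)))"
proof -
  have \<xi>: "continuous_on {0..1} (\<lambda>s. flow v s x)"
    by (rule continuous_on_subset[OF flow_continuous_time[OF Cinf_bdd_Lip_bdd[OF v]]]) auto
  have ch: "continuous_on {0..1} (\<lambda>s. h (flow v s x))"
    by (rule continuous_on_compose2[OF _ \<xi>, of UNIV])
       (use bdd_Cinf_has_fd[OF h, of "()"] in \<open>auto intro!: continuous_at_imp_continuous_on dest: has_derivative_continuous\<close>)
  have cK: "continuous_on {0..1} (\<lambda>s. fd (flow u (1 - s)) (flow v s x) b)" for b
  proof -
    let ?f = "\<lambda>s x. flow u (1 - s) x - x"
    have F: "bdd_Cinf {0..1} ?f"
      using bdd_Cinf_reindex[OF bdd_Cinf_flow[OF u], of "{0..1}" "\<lambda>s. ((), 1 - s)"] by simp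
    have "continuous_on {0..1} (\<lambda>s. ?f s y)" for y
      by (intro continuous_intros continuous_on_compose2[OF flow_continuous_time[OF Cinf_bdd_Lip_bdd[OF u]]]) auto
    note c = bdd_Cinf_continuous_fd[OF F this, of _ b]
    obtain L where L: "L \<ge> 0" "\<And>s x y. s \<in> {0..1} \<Longrightarrow> norm (fd (?f s) x b - fd (?f s) y b) \<le> L * norm (x - y)"
      by (rule bdd_Cinf_Lipschitz[OF bdd_Cinf_fd_fam[OF F, of b]]) (rule that)
    have "continuous_on {0..1} (\<lambda>s. b + fd (?f s) (flow v s x) b)"
      by (intro continuous_on_add continuous_on_const continuous_on_Lipschitz_param[OF L(2) c \<xi>])
    then show ?thesis
      by (rule continuous_on_eq) (use fd_flow_eq[OF u] in auto)
  qed
  have "continuous_on {0..1} (\<lambda>s. \<Sum>b\<in>Basis. (h (flow v s x) \<bullet> b) *\<^sub>R fd (flow u (1 - s)) (flow v s x) b)"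
    by (intro continuous_intros ch cK)
  then show ?thesis
    by (rule continuous_on_eq) (rule duhamel_integrand_expand[OF u, symmetric])
qed

lemma bdd_Cinf_duhamel:
  assumes u: "bdd_Cinf I u" and v: "bdd_Cinf I v" and h: "bdd_Cinf I h"
  shows "bdd_Cinf I (\<lambda>i. duhamel (u i) (v i) (h i))"
proof -
  let ?f = "\<lambda>p x. fd (flow (u (fst p)) (1 - snd p)) (flow (v (fst p)) (snd p) x) (h (fst p) (flow (v (fst p)) (snd p) x))"
  have "bdd_Cinf (I \<times> {0..1}) ?f"
  proof (rule bdd_Cinf_cong)
    have "bdd_Cinf (I \<times> {0..1}) (\<lambda>p x. fd (flow (u (fst p)) (1 - snd p)) x b)" for b
      using bdd_Cinf_reindex[OF bdd_Cinf_fd_flow[OF u, of b], of "I \<times> {0..1}" "\<lambda>p. (fst p, 1 - snd p)"] by auto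
    moreover have "bdd_Cinf (I \<times> {0..1}) (\<lambda>p. h (fst p))"
      by (rule bdd_Cinf_reindex[OF h]) auto
    \<comment> \<open>The integrand is treated as a family indexed by (i, s); its direction, the
      value of h at the moving point, is expanded in the basis.\<close>
    ultimately show "bdd_Cinf (I \<times> {0..1}) (\<lambda>p x. \<Sum>b\<in>Basis. (h (fst p) (flow (v (fst p)) (snd p) x) \<bullet> b) *\<^sub>R
        fd (flow (u (fst p)) (1 - snd p)) (flow (v (fst p)) (snd p) x) b)"
      by (intro bdd_Cinf_Basis_expand bdd_Cinf_comp_flow[OF v])
    show "(\<Sum>b\<in>Basis. (h (fst p) (flow (v (fst p)) (snd p) x) \<bullet> b) *\<^sub>R
        fd (flow (u (fst p)) (1 - snd p)) (flow (v (fst p)) (snd p) x) b) = ?f p x"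
      if "p \<in> I \<times> {0..1}" for p x
      using that by (intro duhamel_integrand_expand[symmetric] bdd_Cinf_member[OF u]) auto
  qed
  from bdd_Cinf_integral[OF this] show ?thesis
    using continuous_on_duhamel_integrand[OF bdd_Cinf_member[OF u] bdd_Cinf_member[OF v] bdd_Cinf_member[OF h]]
    by (simp add: duhamel_def[abs_def])
qed

lemma has_vector_derivative_unique_halfline:
  assumes "(f has_vector_derivative a) (at (0::real) within {0..})"
    "(f has_vector_derivative b) (at 0 within {0..})"
  shows "a = b"
proof (rule vector_derivative_unique_within[OF _ assms])
  show "at (0::real) within {0..} \<noteq> bot"
  proof -
    have "{0..} - {0} = {0::real<..}" by auto
    then show ?thesis by (simp add: at_within_eq_bot_iff)
  qed
qed

text \<open>A field is invariant under its own flow: the two sides are the derivatives at r = 0 of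
  flow u t (flow u r x) and of flow u (t + r) x, which agree by the semigroup law.\<close>

lemma flow_pushforward:
  assumes u: "Cinf_bdd u" and t: "t \<in> {0..1}"
  shows "fd (flow u t) x (u x) = u (flow u t x)"
proof -
  note ul = Cinf_bdd_Lip_bdd[OF u]
  have "((\<lambda>r. flow u (t + 1 * r) x) has_vector_derivative 1 *\<^sub>R u (flow u (t + 1 * 0) x)) (at 0 within {0..})"
    by (rule flow_rescale[OF ul]) (use t in auto)
  then have 1: "((\<lambda>r. flow u (t + r) x) has_vector_derivative u (flow u t x)) (at 0 within {0..})"
    by simp
  have d0: "((\<lambda>r. flow u r x) has_derivative (\<lambda>h. h *\<^sub>R u x)) (at 0 within {0..})"
    using flow_has_vector_derivative[OF ul, of 0 x] flow_0[OF ul] by (simp add: has_vector_derivative_def)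
  have lin: "linear (fd (flow u t) x)" using flow_has_fd[OF u t] by (rule has_derivative_linear)
  have "((\<lambda>r. flow u t (flow u r x)) has_derivative (\<lambda>h. fd (flow u t) x (h *\<^sub>R u x))) (at 0 within {0..})"
    using has_derivative_compose[OF d0, of "flow u t" "fd (flow u t) x"] flow_has_fd[OF u t, of x] flow_0[OF ul]
    by simp
  then have 2: "((\<lambda>r. flow u t (flow u r x)) has_vector_derivative fd (flow u t) x (u x)) (at 0 within {0..})"
    by (simp add: has_vector_derivative_def linear_scale[OF lin])
  have "((\<lambda>r. flow u (t + r) x) has_vector_derivative fd (flow u t) x (u x)) (at 0 within {0..})"
    by (rule has_vector_derivative_transform[OF _ _ 2])
       (use t flow_semigroup[OF ul, of t] in \<open>simp_all add: add.commute[of t]\<close>)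
  from has_vector_derivative_unique_halfline[OF this 1] show ?thesis .
qed

text \<open>Gronwall's bound without squares, from a^2 + e^2 \<le> (a + e)^2 and, as the exponential
  is at least 1, E \<le> E^2.\<close>

lemma flow_dependence:
  assumes u: "Lip_bdd u" and v: "Lip_bdd v" and L: "L \<ge> 0" "\<And>x y. norm (u x - u y) \<le> L * norm (x - y)"
    and e: "\<And>z. norm (u z - v z) \<le> e" and t: "t \<ge> 0"
  shows "norm (flow u t x - flow v t y) \<le> (norm (x - y) + e) * exp ((2 * L + 1) * t)"
proof -
  have e0: "e \<ge> 0" using order_trans[OF norm_ge_zero e] .
  let ?E = "exp ((2 * L + 1) * t)"
  have E: "?E \<ge> 1" using L t by simp
  have "norm (flow u t x - flow v t y) ^ 2 + e ^ 2 \<le> (norm (x - y) ^ 2 + e ^ 2) * ?E"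
    by (rule ivp_gronwall[OF flow_ivp[OF u] flow_ivp[OF v] L e t])
  also have "\<dots> \<le> (norm (x - y) + e) ^ 2 * ?E ^ 2"
  proof (rule mult_mono)
    show "norm (x - y) ^ 2 + e ^ 2 \<le> (norm (x - y) + e) ^ 2" using e0 by (simp add: power2_sum)
    show "?E \<le> ?E ^ 2" using E by (simp add: power2_eq_square)
  qed auto
  finally have "norm (flow u t x - flow v t y) ^ 2 \<le> ((norm (x - y) + e) * ?E) ^ 2"
    using zero_le_power2[of e] by (simp only: power_mult_distrib)
  then show ?thesis by (rule power2_le_imp_le) (use e0 in auto)
qed

text \<open>In the Alekseev-Groebner formula point and time vary together. Joint differentiability
  needs one jointly continuous partial derivative, and the time derivative is one: it is u at the
  flow, so continuity of the flow is enough.\<close>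

lemma flow_joint_derivative:
  assumes u: "Cinf_bdd u" and t: "t \<in> {0..1}"
  shows "((\<lambda>(y, t). flow u t y) has_derivative (\<lambda>(dy, dt). fd (flow u t) y dy + dt *\<^sub>R u (flow u t y)))
     (at (y, t) within UNIV \<times> {0..})"
proof -
  note ul = Cinf_bdd_Lip_bdd[OF u]
  obtain M L where M: "M \<ge> 0" "\<And>x. norm (u x) \<le> M" and L: "L \<ge> 1" "\<And>x y. norm (u x - u y) \<le> L * norm (x - y)"
    by (rule Lip_bddE[OF ul]) (rule that)
  have "((\<lambda>(y, t). flow u t y) has_derivative
     (\<lambda>(tx, ty). fd (flow u t) y tx + blinfun_apply (blinfun_scaleR_left (u (flow u t y))) ty)) (at (y, t) within UNIV \<times> {0..})"
  proof (rule has_derivative_partialsI)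
    show "(flow u t has_derivative fd (flow u t) y) (at y within UNIV)" by (rule flow_has_fd[OF u t])
    show "((\<lambda>t. flow u t x) has_derivative blinfun_apply (blinfun_scaleR_left (u (flow u s x)))) (at s within {0..})"
      if "s \<in> {0..}" for x s
      using flow_has_vector_derivative[OF ul, of s x] that by (simp add: has_vector_derivative_def)
    have "((\<lambda>p. flow u (snd p) (fst p)) \<longlongrightarrow> flow u t y) (at (y, t) within UNIV \<times> {0..})"
    proof (rule Lim_null_comparison[THEN Lim_null[THEN iffD2]])
      let ?g = "\<lambda>p. M * \<bar>snd p - t\<bar> + (norm (fst p - y) + 0) * exp ((2 * L + 1) * t)"
      show "\<forall>\<^sub>F p in at (y, t) within UNIV \<times> {0..}. norm (flow u (snd p) (fst p) - flow u t y) \<le> ?g p"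
        unfolding eventually_at_filter
      proof (intro always_eventually allI impI)
        fix p :: "'a \<times> real" assume p: "p \<in> UNIV \<times> {0..}"
        have "norm (flow u (snd p) (fst p) - flow u t (fst p)) \<le> M * \<bar>snd p - t\<bar>"
          by (rule flow_time_Lipschitz[OF ul M(2)]) (use p t in auto)
        moreover have "norm (flow u t (fst p) - flow u t y) \<le> (norm (fst p - y) + 0) * exp ((2 * L + 1) * t)"
          by (rule flow_dependence[OF ul ul _ L(2)]) (use L t in auto)
        ultimately show "norm (flow u (snd p) (fst p) - flow u t y) \<le> ?g p"
          using norm_triangle_ineq[of "flow u (snd p) (fst p) - flow u t (fst p)" "flow u t (fst p) - flow u t y"] by simp
      qed
      have "(?g \<longlongrightarrow> M * \<bar>snd (y, t) - t\<bar> + (norm (fst (y, t) - y) + 0) * exp ((2 * L + 1) * t)) (at (y, t) within UNIV \<times> {0..})"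
        by (intro tendsto_intros)
      then show "(?g \<longlongrightarrow> 0) (at (y, t) within UNIV \<times> {0..})" by simp
    qed
    then have "((\<lambda>p. u (flow u (snd p) (fst p))) \<longlongrightarrow> u (flow u t y)) (at (y, t) within UNIV \<times> {0..})"
      using Lip_bdd_continuous[OF ul, of UNIV] by (auto simp: continuous_on_eq_continuous_at isCont_def intro: isCont_tendsto_compose)
    then have "((\<lambda>p. blinfun_scaleR_left (u (flow u (snd p) (fst p)))) \<longlongrightarrow> blinfun_scaleR_left (u (flow u t y))) (at (y, t) within UNIV \<times> {0..})"
      by (rule bounded_linear.tendsto[OF bounded_linear_blinfun_scaleR_left])
    then show "continuous (at (y, t) within UNIV \<times> {0..}) (\<lambda>(y, t). blinfun_scaleR_left (u (flow u t y)))"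
      unfolding continuous_within by (simp add: case_prod_beta')
  qed (use t in auto)
  then show ?thesis by simp
qed

text \<open>The Alekseev--Groebner formula: differentiate \<open>flow u (1 - s) (flow v s x)\<close> in \<open>s\<close>.\<close>

lemma flow_difference:
  assumes u: "Cinf_bdd u" and v: "Cinf_bdd v"
  shows "flow v 1 x - flow u 1 x = duhamel u v (\<lambda>y. v y - u y) x"
proof -
  note ul = Cinf_bdd_Lip_bdd[OF u] and vl = Cinf_bdd_Lip_bdd[OF v]
  let ?G = "\<lambda>s. flow u (1 - s) (flow v s x)"
  let ?G' = "\<lambda>s. fd (flow u (1 - s)) (flow v s x) (v (flow v s x) - u (flow v s x))"
  have "(?G has_vector_derivative ?G' s) (at s within {0..1})" if s: "s \<in> {0..1}" for s
  proof -
    let ?y = "flow v s x"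
    have s': "1 - s \<in> {0..1}" using s by auto
    have lin: "linear (fd (flow u (1 - s)) ?y)"
      using flow_has_fd[OF u s'] by (rule has_derivative_linear)
    have dv: "((\<lambda>s. flow v s x) has_derivative (\<lambda>h. h *\<^sub>R v ?y)) (at s within {0..1})"
      using has_vector_derivative_within_subset[OF flow_has_vector_derivative[OF vl, of s x], of "{0..1}"] s
      by (simp add: has_vector_derivative_def)
    have "((\<lambda>s. (flow v s x, 1 - s)) has_derivative (\<lambda>h. (h *\<^sub>R v ?y, 0 - h))) (at s within {0..1})"
      by (intro has_derivative_Pair dv has_derivative_diff has_derivative_const has_derivative_ident)
    moreover have "((\<lambda>(y, t). flow u t y) has_derivative (\<lambda>(dy, dt). fd (flow u (1 - s)) ?y dy + dt *\<^sub>R u (flow u (1 - s) ?y)))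
      (at (?y, 1 - s) within (\<lambda>s. (flow v s x, 1 - s)) ` {0..1})"
      by (rule has_derivative_subset[OF flow_joint_derivative[OF u s']]) auto
    ultimately have "((\<lambda>s. (\<lambda>(y, t). flow u t y) (flow v s x, 1 - s)) has_derivative
      (\<lambda>h. (\<lambda>(dy, dt). fd (flow u (1 - s)) ?y dy + dt *\<^sub>R u (flow u (1 - s) ?y)) (h *\<^sub>R v ?y, 0 - h))) (at s within {0..1})"
      by (rule has_derivative_in_compose)
    \<comment> \<open>Invariance of u under its flow rewrites the time derivative as the linearised
      flow applied to u, so that both contributions merge into the linearised flow applied to v -
      u.\<close>
    then show ?thesis
      unfolding has_vector_derivative_def
      by (simp add: linear_scale[OF lin] linear_diff[OF lin] flow_pushforward[OF u s'] scaleR_diff_right)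
  qed
  from fundamental_theorem_of_calculus[OF _ this]
  have "(?G' has_integral (?G 1 - ?G 0)) {0..1}" by simp
  then have "duhamel u v (\<lambda>y. v y - u y) x = ?G 1 - ?G 0"
    unfolding duhamel_def by (rule integral_unique)
  then show ?thesis by (simp add: flow_0[OF ul] flow_0[OF vl])
qed

lemma duhamel_scale:
  assumes "Cinf_bdd u"
  shows "duhamel u v (\<lambda>x. c *\<^sub>R h x) x = c *\<^sub>R duhamel u v h x"
proof -
  have "duhamel u v (\<lambda>x. c *\<^sub>R h x) x = integral {0..1} (\<lambda>s. c *\<^sub>R fd (flow u (1 - s)) (flow v s x) (h (flow v s x)))"
    unfolding duhamel_def
  proof (rule integral_cong)
    fix s :: real assume "s \<in> {0..1}"
    then have "linear (fd (flow u (1 - s)) (flow v s x))"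
      by (intro has_derivative_linear[OF flow_has_fd[OF assms]]) auto
    then show "fd (flow u (1 - s)) (flow v s x) (c *\<^sub>R h (flow v s x)) = c *\<^sub>R fd (flow u (1 - s)) (flow v s x) (h (flow v s x))"
      by (rule linear_scale)
  qed
  then show ?thesis by (simp add: duhamel_def)
qed

text \<open>Since the field is invariant under its own flow, the integrand is the same vector for
  every s.\<close>

lemma duhamel_self:
  assumes "Cinf_bdd u" shows "duhamel u u u x = u (flow u 1 x)"
proof -
  have "duhamel u u u x = integral {0..1} (\<lambda>s::real. u (flow u 1 x))"
    unfolding duhamel_def
  proof (rule integral_cong)
    fix s :: real assume s: "s \<in> {0..1}"
    then show "fd (flow u (1 - s)) (flow u s x) (u (flow u s x)) = u (flow u 1 x)"
      using flow_semigroup[OF Cinf_bdd_Lip_bdd[OF assms], of "1 - s" s x] by (simp add: flow_pushforward[OF assms])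
  qed
  then show ?thesis by simp
qed

lemma duhamel_const: "duhamel (\<lambda>_. c) (\<lambda>_. c) h x = integral {0..1} (\<lambda>s. h (x + s *\<^sub>R c))"
  unfolding duhamel_def
proof (rule integral_cong)
  fix s :: real assume s: "s \<in> {0..1}"
  have "fd (flow (\<lambda>_. c) (1 - s)) y = (\<lambda>w. w)" for y
  proof (rule fd_eqI)
    have "flow (\<lambda>_. c) (1 - s) = (\<lambda>x. x + (1 - s) *\<^sub>R c)" using s by (simp add: flow_const fun_eq_iff)
    then show "(flow (\<lambda>_. c) (1 - s) has_derivative (\<lambda>w. w)) (at y)"
      by (auto intro!: derivative_eq_intros)
  qed
  then show "fd (flow (\<lambda>_. c) (1 - s)) (flow (\<lambda>_. c) s x) (h (flow (\<lambda>_. c) s x)) = h (x + s *\<^sub>R c)"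
    using s by (simp add: flow_const)
qed

text \<open>Both flows are conjugated by the translation, and subtracting the constant c leaves the
  derivative of a flow unchanged.\<close>

lemma duhamel_translate:
  assumes u: "Cinf_bdd u" and v: "Cinf_bdd v"
  shows "duhamel (\<lambda>x. u (x + c)) (\<lambda>x. v (x + c)) (\<lambda>x. h (x + c)) x = duhamel u v h (x + c)"
  unfolding duhamel_def
proof (rule integral_cong)
  fix s :: real assume s: "s \<in> {0..1}"
  note ul = Cinf_bdd_Lip_bdd[OF u] and vl = Cinf_bdd_Lip_bdd[OF v]
  have "fd (flow (\<lambda>x. u (x + c)) (1 - s)) y = fd (flow u (1 - s)) (y + c)" for y
  proof (rule fd_eqI)
    have eq: "flow (\<lambda>x. u (x + c)) (1 - s) = (\<lambda>x. flow u (1 - s) (x + c) - c)"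
      using s by (simp add: flow_translate[OF ul] fun_eq_iff)
    have "((\<lambda>x. x + c) has_derivative (\<lambda>w. w)) (at y)" by (auto intro!: derivative_eq_intros)
    from has_derivative_diff[OF has_derivative_compose[OF this flow_has_fd[OF u, of "1 - s"]] has_derivative_const[of c]]
    show "(flow (\<lambda>x. u (x + c)) (1 - s) has_derivative fd (flow u (1 - s)) (y + c)) (at y)"
      unfolding eq using s by simp
  qed
  then show "fd (flow (\<lambda>x. u (x + c)) (1 - s)) (flow (\<lambda>x. v (x + c)) s x) (h (flow (\<lambda>x. v (x + c)) s x + c)) =
     fd (flow u (1 - s)) (flow v s (x + c)) (h (flow v s (x + c)))"
    using s by (simp add: flow_translate[OF vl])
qed

section \<open>Continuity of the operator in the sup norm\<close>

text \<open>Interpolation applied to f - g: its threshold depends on neither index nor point, so sup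
  convergence of bounded families gives sup convergence of their derivatives.\<close>

lemma uniform_limit_fd:
  fixes f :: "'e \<times> 's \<Rightarrow> 'a::euclidean_space \<Rightarrow> 'b::euclidean_space"
  assumes f: "bdd_Cinf (I \<times> S) f" and g: "bdd_Cinf S g" and ev: "\<forall>\<^sub>F e in F. e \<in> I"
    and lim: "uniform_limit (S \<times> UNIV) (\<lambda>e p. f (e, fst p) (snd p)) (\<lambda>p. g (fst p) (snd p)) F"
  shows "uniform_limit (S \<times> UNIV) (\<lambda>e p. fd (f (e, fst p)) (snd p) v) (\<lambda>p. fd (g (fst p)) (snd p) v) F"
proof (rule uniform_limitI)
  fix \<eta> :: real assume "\<eta> > 0"
  then have \<eta>: "\<eta> / 2 > 0" by simp
  let ?D = "\<lambda>q x. f q x - g (snd q) x"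
  have D: "bdd_Cinf (I \<times> S) ?D"
    by (intro bdd_Cinf_diff f bdd_Cinf_reindex[OF g]) auto
  have fdD: "fd (?D q) x = (\<lambda>v. fd (f q) x v - fd (g (snd q)) x v)" if "q \<in> I \<times> S" for q x
    by (rule fd_eqI) (use that in \<open>auto intro!: has_derivative_diff bdd_Cinf_has_fd[OF f] bdd_Cinf_has_fd[OF g]\<close>)
  obtain \<epsilon> s where e: "\<epsilon> > 0" and est: "\<And>q x. q \<in> I \<times> S \<Longrightarrow> norm (?D q x) \<le> \<epsilon> \<Longrightarrow>
      norm (?D q (x + s *\<^sub>R v)) \<le> \<epsilon> \<Longrightarrow> norm (fd (?D q) x v) \<le> \<eta> / 2"
    by (rule bdd_Cinf_interpolation[OF D \<eta>, of v]) (rule that)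
  show "\<forall>\<^sub>F e in F. \<forall>p\<in>S \<times> UNIV. dist (fd (f (e, fst p)) (snd p) v) (fd (g (fst p)) (snd p) v) < \<eta>"
    using ev uniform_limitD[OF lim e]
  proof eventually_elim
    case (elim e)
    show ?case
    proof
      fix p :: "'s \<times> 'a" assume p: "p \<in> S \<times> UNIV"
      have q: "(e, fst p) \<in> I \<times> S" using p elim(1) by auto
      have "norm (?D (e, fst p) y) \<le> \<epsilon>" for y
        using elim(2)[rule_format, of "(fst p, y)"] p by (auto simp: dist_norm)
      from est[OF q this this, of "snd p"]
      have "norm (fd (f (e, fst p)) (snd p) v - fd (g (fst p)) (snd p) v) \<le> \<eta> / 2"
        unfolding fdD[OF q] by simp
      then show "dist (fd (f (e, fst p)) (snd p) v) (fd (g (fst p)) (snd p) v) < \<eta>"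
        unfolding dist_norm using \<open>\<eta> > 0\<close> by linarith
    qed
  qed
qed

lemma uniform_limit_flow:
  assumes u0: "Lip_bdd u0" and u: "\<forall>\<^sub>F e in F. Lip_bdd (u e)" and lim: "uniform_limit UNIV u u0 F"
  shows "uniform_limit ({0..1} \<times> UNIV) (\<lambda>e p. flow (u e) (fst p) (snd p)) (\<lambda>p. flow u0 (fst p) (snd p)) F"
proof (rule uniform_limitI)
  fix \<eta> :: real assume \<eta>: "\<eta> > 0"
  obtain M L where L: "L \<ge> 1" "\<And>x y. norm (u0 x - u0 y) \<le> L * norm (x - y)"
    by (rule Lip_bddE[OF u0]) (rule that)
  let ?E = "exp (2 * L + 1)"
  \<comment> \<open>Over unit time Gronwall magnifies the distance of the fields by at most ?E, so
    this tolerance leaves \<eta> / 2.\<close>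
  define e where "e = \<eta> / (2 * ?E)"
  have e: "e > 0" unfolding e_def using \<eta> by simp
  show "\<forall>\<^sub>F i in F. \<forall>p\<in>{0..1} \<times> UNIV. dist (flow (u i) (fst p) (snd p)) (flow u0 (fst p) (snd p)) < \<eta>"
    using u uniform_limitD[OF lim e]
  proof eventually_elim
    case (elim i)
    show ?case
    proof
      fix p :: "real \<times> 'a" assume p: "p \<in> {0..1} \<times> UNIV"
      have "norm (flow u0 (fst p) (snd p) - flow (u i) (fst p) (snd p)) \<le> (norm (snd p - snd p) + e) * exp ((2 * L + 1) * fst p)"
        by (rule flow_dependence[OF u0 elim(1) _ L(2)])
           (use L p elim(2) in \<open>auto simp: dist_norm norm_minus_commute less_imp_le\<close>)
      also have "\<dots> \<le> e * ?E"
        using p L e by (auto intro!: mult_left_mono simp: mult_left_le)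
      also have "\<dots> = \<eta> / 2" by (simp add: e_def)
      also have "\<dots> < \<eta>" using \<eta> by simp
      finally show "dist (flow (u i) (fst p) (snd p)) (flow u0 (fst p) (snd p)) < \<eta>"
        by (simp add: dist_norm norm_minus_commute)
    qed
  qed
qed

lemma uniform_limit_fd_flow:
  fixes u :: "'e \<Rightarrow> 'a::euclidean_space \<Rightarrow> 'a"
  assumes u: "bdd_Cinf I u" and u0: "Cinf_bdd u0" and ev: "\<forall>\<^sub>F e in F. e \<in> I"
    and lim: "uniform_limit UNIV u u0 F"
  shows "uniform_limit ({0..1} \<times> UNIV) (\<lambda>e p. fd (flow (u e) (fst p)) (snd p) b)
    (\<lambda>p. fd (flow u0 (fst p)) (snd p) b) F"
proof -
  have "uniform_limit ({0..1} \<times> UNIV) (\<lambda>e p. flow (u e) (fst p) (snd p)) (\<lambda>p. flow u0 (fst p) (snd p)) F"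
    by (rule uniform_limit_flow[OF Cinf_bdd_Lip_bdd[OF u0] _ lim])
       (use ev in eventually_elim, rule bdd_Cinf_Lip_bdd[OF u])
  then have l: "uniform_limit ({0..1} \<times> UNIV) (\<lambda>e p. flow (u e) (fst p) (snd p) - snd p)
     (\<lambda>p. flow u0 (fst p) (snd p) - snd p) F"
    by (intro uniform_limit_intros)
  have g: "bdd_Cinf {0..1} (\<lambda>t x. flow u0 t x - x)"
    using bdd_Cinf_reindex[OF bdd_Cinf_flow[OF u0], of "{0..1}" "\<lambda>t. ((), t)"] by simp
  have "uniform_limit ({0..1} \<times> UNIV) (\<lambda>e p. fd (\<lambda>x. flow (u e) (fst p) x - x) (snd p) b)
     (\<lambda>p. fd (\<lambda>x. flow u0 (fst p) x - x) (snd p) b) F"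
    using uniform_limit_fd[OF bdd_Cinf_flow[OF u] g ev] l by simp
  then have "uniform_limit ({0..1} \<times> UNIV) (\<lambda>e p. b + fd (\<lambda>x. flow (u e) (fst p) x - x) (snd p) b)
     (\<lambda>p. b + fd (\<lambda>x. flow u0 (fst p) x - x) (snd p) b) F"
    by (intro uniform_limit_intros)
  then show ?thesis
  proof (rule uniform_limit_cong[THEN iffD1, rotated 2])
    show "\<forall>\<^sub>F e in F. \<forall>p\<in>{0..1} \<times> UNIV. b + fd (\<lambda>x. flow (u e) (fst p) x - x) (snd p) b = fd (flow (u e) (fst p)) (snd p) b"
      using ev by eventually_elim (use fd_flow_eq[OF bdd_Cinf_member[OF u]] in auto)
  qed (use fd_flow_eq[OF u0] in auto)
qed

text \<open>The error is split at the limit function evaluated at the approximate point: uniform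
  convergence handles one part, the Lipschitz bound of the limit the other.\<close>

lemma uniform_limit_param_comp:
  fixes G :: "'e \<Rightarrow> 's \<Rightarrow> 'a::real_normed_vector \<Rightarrow> 'b::real_normed_vector"
  assumes G: "uniform_limit (S \<times> UNIV) (\<lambda>e p. G e (fst p) (snd p)) (\<lambda>p. H (fst p) (snd p)) F"
    and L: "\<And>s x y. s \<in> S \<Longrightarrow> norm (H s x - H s y) \<le> L * norm (x - y)"
    and \<xi>: "uniform_limit X \<xi> \<zeta> F" and \<sigma>: "\<And>p. p \<in> X \<Longrightarrow> \<sigma> p \<in> S"
  shows "uniform_limit X (\<lambda>e p. G e (\<sigma> p) (\<xi> e p)) (\<lambda>p. H (\<sigma> p) (\<zeta> p)) F"
proof (rule uniform_limitI)
  fix \<eta> :: real assume \<eta>: "\<eta> > 0"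
  let ?L = "max L 1"
  have 1: "\<eta> / 2 > 0" and 2: "\<eta> / (2 * ?L) > 0" using \<eta> by auto
  show "\<forall>\<^sub>F e in F. \<forall>p\<in>X. dist (G e (\<sigma> p) (\<xi> e p)) (H (\<sigma> p) (\<zeta> p)) < \<eta>"
    using uniform_limitD[OF G 1] uniform_limitD[OF \<xi> 2]
  proof eventually_elim
    case (elim e)
    show ?case
    proof
      fix p assume p: "p \<in> X"
      have "dist (G e (\<sigma> p) (\<xi> e p)) (H (\<sigma> p) (\<xi> e p)) < \<eta> / 2"
        using elim(1)[rule_format, of "(\<sigma> p, \<xi> e p)"] \<sigma>[OF p] by simp
      moreover have "dist (H (\<sigma> p) (\<xi> e p)) (H (\<sigma> p) (\<zeta> p)) < \<eta> / 2"
      proof -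
        have "norm (H (\<sigma> p) (\<xi> e p) - H (\<sigma> p) (\<zeta> p)) \<le> ?L * norm (\<xi> e p - \<zeta> p)"
          by (rule order_trans[OF L[OF \<sigma>[OF p]]]) (simp add: mult_right_mono)
        also have "\<dots> < ?L * (\<eta> / (2 * ?L))"
          using elim(2) p by (intro mult_strict_left_mono) (auto simp: dist_norm)
        also have "\<dots> = \<eta> / 2" by simp
        finally show ?thesis by (simp add: dist_norm)
      qed
      ultimately show "dist (G e (\<sigma> p) (\<xi> e p)) (H (\<sigma> p) (\<zeta> p)) < \<eta>"
        using dist_triangle[of "G e (\<sigma> p) (\<xi> e p)" "H (\<sigma> p) (\<zeta> p)" "H (\<sigma> p) (\<xi> e p)"] by linarith
    qed
  qed
qed

lemma uniform_limit_sum: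
  fixes f :: "'b \<Rightarrow> 'e \<Rightarrow> 'x \<Rightarrow> 'c::real_normed_vector"
  assumes "finite B" "\<And>b. b \<in> B \<Longrightarrow> uniform_limit X (f b) (g b) F"
  shows "uniform_limit X (\<lambda>e x. \<Sum>b\<in>B. f b e x) (\<lambda>x. \<Sum>b\<in>B. g b x) F"
  using assms
proof (induction B rule: finite_induct)
  case empty then show ?case by (simp add: uniform_limit_const)
next
  case (insert b B)
  then have "uniform_limit X (\<lambda>e x. f b e x + (\<Sum>b\<in>B. f b e x)) (\<lambda>x. g b x + (\<Sum>b\<in>B. g b x)) F"
    by (intro uniform_limit_add) auto
  then show ?case using insert by simp
qed

text \<open>After expansion in the basis, coefficients and derivatives converge uniformly on the
  strip of all times and points. Their limits are bounded, so the products converge uniformly too,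
  and integrating over s keeps the bound.\<close>

lemma uniform_limit_duhamel:
  fixes u v h :: "'e \<Rightarrow> 'a::euclidean_space \<Rightarrow> 'a"
  assumes u: "bdd_Cinf I u" "Cinf_bdd u0" "uniform_limit UNIV u u0 F"
    and v: "bdd_Cinf I v" "Cinf_bdd v0" "uniform_limit UNIV v v0 F"
    and h: "bdd_Cinf I h" "Cinf_bdd h0" "uniform_limit UNIV h h0 F"
    and ev: "\<forall>\<^sub>F e in F. e \<in> I"
  shows "uniform_limit UNIV (\<lambda>e. duhamel (u e) (v e) (h e)) (duhamel u0 v0 h0) F"
proof -
  let ?X = "{0..1::real} \<times> (UNIV :: 'a set)"
  let ?\<xi> = "\<lambda>e p. flow (v e) (fst p) (snd p)" and ?zeta = "\<lambda>p. flow v0 (fst p) (snd p)"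
  have \<xi>: "uniform_limit ?X ?\<xi> ?zeta F"
    by (rule uniform_limit_flow[OF Cinf_bdd_Lip_bdd[OF v(2)] _ v(3)])
       (use ev in eventually_elim, rule bdd_Cinf_Lip_bdd[OF v(1)])
  obtain M where M: "M \<ge> 0" "\<And>i x. i \<in> {()} \<Longrightarrow> norm (h0 x) \<le> M"
    by (rule bdd_Cinf_bounded[OF h(2)]) (rule that)
  obtain Lh where Lh: "Lh \<ge> 0" "\<And>i x y. i \<in> {()} \<Longrightarrow> norm (h0 x - h0 y) \<le> Lh * norm (x - y)"
    by (rule bdd_Cinf_Lipschitz[OF h(2)]) (rule that)
  have lh: "uniform_limit ?X (\<lambda>e p. h e (?\<xi> e p)) (\<lambda>p. h0 (?zeta p)) F"
  proof (rule uniform_limit_param_comp[where S="{()}" and \<sigma>="\<lambda>_. ()" and G="\<lambda>e _. h e" and H="\<lambda>_. h0", OF _ Lh(2) \<xi>])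
    show "uniform_limit ({()} \<times> UNIV) (\<lambda>e p. h e (snd p)) (\<lambda>p. h0 (snd p)) F"
      by (rule uniform_limit_compose'[OF h(3), of snd]) auto
  qed auto
  have lK: "uniform_limit ?X (\<lambda>e p. fd (flow (u e) (1 - fst p)) (?\<xi> e p) b) (\<lambda>p. fd (flow u0 (1 - fst p)) (?zeta p) b) F"
    and bK: "bounded ((\<lambda>p. fd (flow u0 (1 - fst p)) (?zeta p) b) ` ?X)" for b
  proof -
    have K0: "bdd_Cinf {0..1} (\<lambda>t x. fd (flow u0 t) x b)"
      using bdd_Cinf_reindex[OF bdd_Cinf_fd_flow[OF u(2), of b], of "{0..1}" "\<lambda>t. ((), t)"] by simp
    obtain L where L: "L \<ge> 0" "\<And>t x y. t \<in> {0..1} \<Longrightarrow> norm (fd (flow u0 t) x b - fd (flow u0 t) y b) \<le> L * norm (x - y)"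
      by (rule bdd_Cinf_Lipschitz[OF K0]) (rule that)
    show "uniform_limit ?X (\<lambda>e p. fd (flow (u e) (1 - fst p)) (?\<xi> e p) b) (\<lambda>p. fd (flow u0 (1 - fst p)) (?zeta p) b) F"
      by (rule uniform_limit_param_comp[where \<sigma>="\<lambda>p. 1 - fst p" and G="\<lambda>e t x. fd (flow (u e) t) x b",
          OF uniform_limit_fd_flow[OF u(1,2) ev u(3)] L(2) \<xi>]) auto
    obtain N where N: "N \<ge> 0" "\<And>t x. t \<in> {0..1} \<Longrightarrow> norm (fd (flow u0 t) x b) \<le> N"
      by (rule bdd_Cinf_bounded[OF K0]) (rule that)
    show "bounded ((\<lambda>p. fd (flow u0 (1 - fst p)) (?zeta p) b) ` ?X)"
      unfolding bounded_iff by (rule exI[of _ N]) (auto intro!: N(2))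
  qed
  have bh: "bounded ((\<lambda>p. h0 (?zeta p) \<bullet> b) ` ?X)" for b
  proof -
    have "\<bar>h0 y \<bullet> b\<bar> \<le> M * norm b" for y
      by (rule order_trans[OF Cauchy_Schwarz_ineq2]) (simp add: M mult_right_mono)
    then show ?thesis unfolding bounded_iff by (intro exI[of _ "M * norm b"]) auto
  qed
  have lim: "uniform_limit ?X
     (\<lambda>e p. \<Sum>b\<in>Basis. (h e (?\<xi> e p) \<bullet> b) *\<^sub>R fd (flow (u e) (1 - fst p)) (?\<xi> e p) b)
     (\<lambda>p. \<Sum>b\<in>Basis. (h0 (?zeta p) \<bullet> b) *\<^sub>R fd (flow u0 (1 - fst p)) (?zeta p) b) F"
    by (intro uniform_limit_sum finite_Basis bounded_bilinear.bounded_uniform_limit[OF bounded_bilinear_scaleR]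
         bounded_linear.uniform_limit[OF bounded_linear_inner_left] lh lK bK bh)
  show ?thesis
  proof (rule uniform_limitI)
    fix \<eta> :: real assume "\<eta> > 0"
    then have \<eta>: "\<eta> / 2 > 0" by simp
    show "\<forall>\<^sub>F e in F. \<forall>x\<in>UNIV. dist (duhamel (u e) (v e) (h e) x) (duhamel u0 v0 h0 x) < \<eta>"
      using ev uniform_limitD[OF lim \<eta>]
    proof eventually_elim
      case (elim e)
      note m = bdd_Cinf_member[OF u(1) elim(1)] bdd_Cinf_member[OF v(1) elim(1)] bdd_Cinf_member[OF h(1) elim(1)]
      show ?case
      proof
        fix x
        let ?f = "\<lambda>s. fd (flow (u e) (1 - s)) (flow (v e) s x) (h e (flow (v e) s x))"
        let ?g = "\<lambda>s. fd (flow u0 (1 - s)) (flow v0 s x) (h0 (flow v0 s x))"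
        have cf: "continuous_on {0..1} ?f" by (rule continuous_on_duhamel_integrand[OF m])
        have cg: "continuous_on {0..1} ?g" by (rule continuous_on_duhamel_integrand[OF u(2) v(2) h(2)])
        have "duhamel (u e) (v e) (h e) x - duhamel u0 v0 h0 x = integral {0..1} (\<lambda>s. ?f s - ?g s)"
          unfolding duhamel_def by (rule integral_diff[symmetric]) (intro integrable_continuous_real cf cg)+
        also have "norm \<dots> \<le> \<eta> / 2 * (1 - 0)"
        proof (rule integral_bound)
          fix s :: real assume s: "s \<in> {0..1}"
          show "norm (?f s - ?g s) \<le> \<eta> / 2"
            using elim(2)[rule_format, of "(s, x)"] s
            unfolding duhamel_integrand_expand[OF m(1) s, of "flow (v e) s x" "h e (flow (v e) s x)"]
              duhamel_integrand_expand[OF u(2) s, of "flow v0 s x" "h0 (flow v0 s x)"] dist_norm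
            by (simp add: less_imp_le)
        qed (auto intro!: continuous_intros cf cg)
        finally show "dist (duhamel (u e) (v e) (h e) x) (duhamel u0 v0 h0 x) < \<eta>"
          using \<open>\<eta> > 0\<close> by (simp add: dist_norm)
      qed
    qed
  qed
qed

section \<open>Almost periodic functions\<close>

lemma pd_has_derivative:
  assumes "(g has_derivative g') (at x)"
  shows "((\<lambda>t. g (x + t *\<^sub>R axis i 1)) has_real_derivative g' (axis i 1)) (at 0)"
    and "pd i g x = g' (axis i 1)"
proof -
  have 1: "((\<lambda>t. x + t *\<^sub>R axis i 1) has_derivative (\<lambda>t. t *\<^sub>R axis i 1)) (at (0::real))"
    by (auto intro!: derivative_eq_intros)
  have "((\<lambda>t. g (x + t *\<^sub>R axis i 1)) has_derivative (\<lambda>t. g' (t *\<^sub>R axis i 1))) (at 0)"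
    using has_derivative_compose[OF 1, of g g'] assms by simp
  then show d: "((\<lambda>t. g (x + t *\<^sub>R axis i 1)) has_real_derivative g' (axis i 1)) (at 0)"
    using has_derivative_linear[OF assms]
    by (simp add: has_field_derivative_def linear_scale mult_commute_abs)
  show "pd i g x = g' (axis i 1)" unfolding pd_def by (rule DERIV_imp_deriv[OF d])
qed

lemma bdd_Cinf_pdl:
  fixes f :: "'i \<Rightarrow> real^'n::finite \<Rightarrow> real"
  assumes f: "bdd_Cinf I f"
  shows "bdd_Cinf I (\<lambda>i. pdl js (f i))"
proof (induction js)
  case Nil then show ?case using f by simp
next
  case (Cons j js)
  show ?case
    by (rule bdd_Cinf_cong[OF bdd_Cinf_fd_fam[OF Cons, of "axis j 1"]])
       (simp add: pd_has_derivative(2)[OF bdd_Cinf_has_fd[OF Cons]])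
qed

lemma pdl_Cons_fd:
  fixes f :: "'i \<Rightarrow> real^'n::finite \<Rightarrow> real"
  assumes "bdd_Cinf I f" "i \<in> I"
  shows "pdl (j # js) (f i) x = fd (pdl js (f i)) x (axis j 1)"
  using pd_has_derivative(2)[OF bdd_Cinf_has_fd[OF bdd_Cinf_pdl[OF assms(1)] assms(2)]] by simp

lemma Cinf_bdd_Ckb:
  fixes g :: "real^'n::finite \<Rightarrow> real"
  assumes "Cinf_bdd g"
  shows "Ckb k g"
proof -
  note P = bdd_Cinf_pdl[OF assms]
  have "continuous_on UNIV (pdl js g)" for js
    using bdd_Cinf_has_fd[OF P, of "()" js]
    by (auto intro!: continuous_at_imp_continuous_on dest: has_derivative_continuous)
  moreover have "bounded (range (pdl js g))" for js
  proof -
    obtain M where "M \<ge> 0" "\<And>i x. i \<in> {()} \<Longrightarrow> norm (pdl js g x) \<le> M"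
      by (rule bdd_Cinf_bounded[OF P[of js]]) (rule that)
    then show ?thesis unfolding bounded_iff by blast
  qed
  moreover have "((\<lambda>t. pdl js g (x + t *\<^sub>R axis i 1)) has_real_derivative pdl (i # js) g x) (at 0)" for js i x
    using pd_has_derivative[OF bdd_Cinf_has_fd[OF P, of "()" js x], of i] by simp
  ultimately show ?thesis unfolding Ckb_def by blast
qed

lemma finite_multi_indices: "finite {js :: 'n::finite list. length js \<le> k}"
  using finite_lists_length_le[of "UNIV :: 'n set" k] by simp

lemma normk_le:
  fixes g :: "real^'n::finite \<Rightarrow> real"
  assumes "\<And>js x. length js \<le> k \<Longrightarrow> \<bar>pdl js g x\<bar> \<le> M"
  shows "normk k g \<le> M"
  unfolding normk_def
proof (rule cSUP_least)
  have "([], undefined) \<in> {js :: 'n list. length js \<le> k} \<times> (UNIV :: (real^'n) set)" by simp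
  then show "{js :: 'n list. length js \<le> k} \<times> (UNIV :: (real^'n) set) \<noteq> {}" by blast
qed (use assms in auto)

text \<open>A real supremum dominates its members only if they are bounded above. Here this follows
  from \<open>Ckb\<close>, which bounds each of the finitely many derivatives.\<close>

lemma pdl_le_normk:
  fixes g :: "real^'n::finite \<Rightarrow> real"
  assumes g: "Ckb k g" and js: "length js \<le> k"
  shows "\<bar>pdl js g x\<bar> \<le> normk k g"
proof -
  let ?A = "{js :: 'n list. length js \<le> k}"
  have "bdd_above ((\<lambda>p. \<bar>pdl (fst p) g (snd p)\<bar>) ` (?A \<times> (UNIV :: (real^'n) set)))"
  proof -
    have "bdd_above (\<Union>js\<in>?A. range (\<lambda>x. \<bar>pdl js g x\<bar>))"
      unfolding bdd_above_UN[OF finite_multi_indices]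
    proof
      fix js :: "'n list" assume "js \<in> ?A"
      then have "bounded (range (pdl js g))" using g unfolding Ckb_def by blast
      then show "bdd_above (range (\<lambda>x. \<bar>pdl js g x\<bar>))"
        unfolding bounded_iff bdd_above_def by auto
    qed
    then show ?thesis
    proof (rule bdd_above_mono, intro image_subsetI)
      fix p assume "p \<in> ?A \<times> (UNIV :: (real^'n) set)"
      then show "\<bar>pdl (fst p) g (snd p)\<bar> \<in> (\<Union>js\<in>?A. range (\<lambda>x. \<bar>pdl js g x\<bar>))"
        by (intro UN_I[of "fst p"] rangeI) auto
    qed
  qed
  from cSUP_upper[OF _ this, of "(js, x)"] js show ?thesis unfolding normk_def by simp
qed

lemma normk_nonneg: "Ckb k g \<Longrightarrow> 0 \<le> normk k g"
  using pdl_le_normk[of k g "[]" undefined] by simp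

lemma pdl_translate:
  fixes g :: "real^'n::finite \<Rightarrow> real"
  shows "pdl js (\<lambda>x. g (x + c)) = (\<lambda>x. pdl js g (x + c))"
  by (induction js) (simp_all add: pd_def fun_eq_iff add_ac)

lemma Ckb_translate:
  fixes g :: "real^'n::finite \<Rightarrow> real"
  assumes "Ckb k g" shows "Ckb k (\<lambda>x. g (x + c))"
  unfolding Ckb_def
proof (intro conjI allI impI)
  fix js :: "'n list" assume "length js \<le> k"
  then have c: "continuous_on UNIV (pdl js g)" and b: "bounded (range (pdl js g))"
    using assms unfolding Ckb_def by blast+
  show "continuous_on UNIV (pdl js (\<lambda>x. g (x + c)))"
    unfolding pdl_translate by (rule continuous_on_compose2[OF c]) (auto intro!: continuous_intros)
  show "bounded (range (pdl js (\<lambda>x. g (x + c))))"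
    unfolding pdl_translate by (rule bounded_subset[OF b]) auto
next
  fix js :: "'n list" and i x assume "length js < k"
  then have "((\<lambda>t. pdl js g (x + c + t *\<^sub>R axis i 1)) has_real_derivative pdl (i # js) g (x + c)) (at 0)"
    using assms unfolding Ckb_def by blast
  then show "((\<lambda>t. pdl js (\<lambda>x. g (x + c)) (x + t *\<^sub>R axis i 1)) has_real_derivative
      pdl (i # js) (\<lambda>x. g (x + c)) x) (at 0)"
    unfolding pdl_translate by (simp add: add_ac)
qed

text \<open>\<open>deriv\<close> has no useful value where the derivative does not exist, so
  linearity rests on the differentiability recorded in \<open>Ckb\<close>.\<close>

lemma pdl_diff:
  fixes f g :: "real^'n::finite \<Rightarrow> real"
  assumes f: "Ckb k f" and g: "Ckb k g" and "length js \<le> k"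
  shows "pdl js (\<lambda>x. f x - g x) = (\<lambda>x. pdl js f x - pdl js g x)"
  using assms(3)
proof (induction js)
  case (Cons j js)
  show ?case
  proof
    fix x
    have "((\<lambda>t. pdl js f (x + t *\<^sub>R axis j 1) - pdl js g (x + t *\<^sub>R axis j 1)) has_real_derivative
        pdl (j # js) f x - pdl (j # js) g x) (at 0)"
      using f g Cons.prems unfolding Ckb_def by (intro DERIV_diff) auto
    then show "pdl (j # js) (\<lambda>x. f x - g x) x = pdl (j # js) f x - pdl (j # js) g x"
      using Cons DERIV_imp_deriv by (fastforce simp: pd_def)
  qed
qed simp

lemma Ckb_diff:
  fixes f g :: "real^'n::finite \<Rightarrow> real"
  assumes f: "Ckb k f" and g: "Ckb k g"
  shows "Ckb k (\<lambda>x. f x - g x)"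
  unfolding Ckb_def
proof (intro conjI allI impI)
  fix js :: "'n list" assume js: "length js \<le> k"
  then show "continuous_on UNIV (pdl js (\<lambda>x. f x - g x))"
    unfolding pdl_diff[OF f g js] using f g unfolding Ckb_def by (intro continuous_on_diff) auto
  show "bounded (range (pdl js (\<lambda>x. f x - g x)))"
    unfolding pdl_diff[OF f g js] using f g js unfolding Ckb_def by (intro bounded_minus_comp) auto
next
  fix js :: "'n list" and i x assume js: "length js < k"
  then have l: "length js \<le> k" "length (i # js) \<le> k" by auto
  show "((\<lambda>t. pdl js (\<lambda>x. f x - g x) (x + t *\<^sub>R axis i 1)) has_real_derivative
      pdl (i # js) (\<lambda>x. f x - g x) x) (at 0)"
    unfolding pdl_diff[OF f g l(1)] pdl_diff[OF f g l(2)]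
    using f g js unfolding Ckb_def by (intro DERIV_diff) auto
qed

section \<open>From partial derivatives and norms to bounded families\<close>

text \<open>Coordinates are released one at a time: if g is differentiable at x along the
  coordinates in S, the continuous partial in direction i makes it differentiable along S and i
  together.\<close>

lemma has_derivative_continuous_partials:
  fixes g :: "real^'n::finite \<Rightarrow> real"
  assumes d: "\<And>x i. ((\<lambda>t. g (x + t *\<^sub>R axis i 1)) has_real_derivative p i x) (at 0)"
    and c: "\<And>i. continuous_on UNIV (p i)"
  shows "(g has_derivative (\<lambda>v. \<Sum>i\<in>UNIV. v $ i * p i x)) (at x)"
proof -
  let ?P = "\<lambda>S y. \<Sum>i\<in>S. (y $ i) *\<^sub>R axis i (1::real) :: real^'n"
  have d': "((\<lambda>t. g (z + t *\<^sub>R axis i 1)) has_derivative (\<lambda>h. h * p i (z + t0 *\<^sub>R axis i 1))) (at t0)" for z i t0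
  proof -
    have "((\<lambda>t. g (z + (t0 + t) *\<^sub>R axis i 1)) has_real_derivative p i (z + t0 *\<^sub>R axis i 1)) (at 0)"
      using d[of "z + t0 *\<^sub>R axis i 1" i] by (simp add: scaleR_left_distrib add_ac)
    then have "((\<lambda>t. g (z + t *\<^sub>R axis i 1)) has_real_derivative p i (z + t0 *\<^sub>R axis i 1)) (at t0)"
      using DERIV_shift[of "\<lambda>t. g (z + t *\<^sub>R axis i 1)" _ 0 t0] by (simp add: add.commute)
    then show ?thesis by (simp add: has_field_derivative_def mult.commute[of _ "p i _"])
  qed
  have "((\<lambda>y. g (x + ?P S y)) has_derivative (\<lambda>v. \<Sum>i\<in>S. v $ i * p i x)) (at 0)" if "finite S" for S
    using that
  proof (induction S rule: finite_induct)
    case empty then show ?case by simp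
  next
    case (insert i S)
    let ?F = "\<lambda>y t. g (x + ?P S y + t *\<^sub>R axis i 1)"
    have "((\<lambda>(y, t). ?F y t) has_derivative
       (\<lambda>(ty, tt). (\<Sum>i\<in>S. ty $ i * p i x) + blinfun_apply (blinfun_scaleR_left (p i (x + ?P S 0 + 0 *\<^sub>R axis i 1))) tt))
       (at (0, 0) within UNIV \<times> UNIV)"
    proof (rule has_derivative_partialsI)
      show "((\<lambda>y. ?F y 0) has_derivative (\<lambda>ty. \<Sum>i\<in>S. ty $ i * p i x)) (at 0 within UNIV)"
        using insert.IH by simp
      show "((\<lambda>t. ?F y t) has_derivative blinfun_apply (blinfun_scaleR_left (p i (x + ?P S y + t *\<^sub>R axis i 1)))) (at t within UNIV)" for y t
        using d'[of "x + ?P S y" i t] by simp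
      have cp: "isCont (p i) z" for z using c[of i] by (simp add: continuous_on_eq_continuous_at)
      have "isCont (\<lambda>q::(real^'n) \<times> real. x + ?P S (fst q) + snd q *\<^sub>R axis i 1) (0, 0)"
        by (intro continuous_add continuous_const continuous_sum continuous_scaleR continuous_fst
              continuous_snd continuous_ident bounded_linear.continuous[OF bounded_linear_vec_nth])
      from isCont_o2[OF this cp]
      have "continuous (at (0, 0)) (\<lambda>q::(real^'n) \<times> real. p i (x + ?P S (fst q) + snd q *\<^sub>R axis i 1))" .
      then have "continuous (at (0, 0)) (\<lambda>q::(real^'n) \<times> real. blinfun_scaleR_left (p i (x + ?P S (fst q) + snd q *\<^sub>R axis i 1)))"
        by (rule bounded_linear.continuous[OF bounded_linear_blinfun_scaleR_left])
      then show "continuous (at (0, 0) within UNIV \<times> UNIV) (\<lambda>(y, t). blinfun_scaleR_left (p i (x + ?P S y + t *\<^sub>R axis i 1)))"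
        by (simp add: case_prod_beta')
    qed auto
    then have F: "((\<lambda>q. ?F (fst q) (snd q)) has_derivative (\<lambda>q. (\<Sum>i\<in>S. fst q $ i * p i x) + snd q * p i x)) (at (0, 0))"
      by (simp add: case_prod_beta')
    \<comment> \<open>The additional variable t was independent of y; composing with y \<mapsto> (y,
      y_i) identifies it with the coordinate i.\<close>
    have "((\<lambda>y :: real^'n. (y, y $ i)) has_derivative (\<lambda>y. (y, y $ i))) (at 0)"
      by (intro has_derivative_Pair has_derivative_ident bounded_linear_imp_has_derivative bounded_linear_vec_nth)
    from has_derivative_compose[OF this, of "\<lambda>q. ?F (fst q) (snd q)"
        "\<lambda>q. (\<Sum>i\<in>S. fst q $ i * p i x) + snd q * p i x"] F
    have "((\<lambda>y. ?F y (y $ i)) has_derivative (\<lambda>y. (\<Sum>i\<in>S. y $ i * p i x) + y $ i * p i x)) (at 0)"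
      by simp
    then show ?case using insert.hyps by (simp add: add_ac)
  qed
  from this[of UNIV] have "((\<lambda>y. g (x + y)) has_derivative (\<lambda>v. \<Sum>i\<in>UNIV. v $ i * p i x)) (at 0)"
    using basis_expansion[where 'n='n and ?'a=real] by (simp add: scalar_mult_eq_scaleR)
  then show ?thesis by (simp add: has_derivative_at)
qed

text \<open>The passage from the given norms to \<open>bdd_Cinf\<close>. The derivative of
  \<open>pdl js\<close> is a combination of the next partials \<open>pdl (j # js)\<close>, so the
  induction on the order runs over all \<open>js\<close> at once.\<close>

lemma bdd_Cinf_of_normk:
  fixes f :: "'i \<Rightarrow> real^'n::finite \<Rightarrow> real"
  assumes f: "\<And>i k. i \<in> I \<Longrightarrow> Ckb k (f i)" and M: "\<And>k. \<exists>M. \<forall>i\<in>I. normk k (f i) \<le> M"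
  shows "bdd_Cinf I f"
proof -
  have bd: "\<exists>M. \<forall>i\<in>I. \<forall>x. norm (pdl js (f i) x) \<le> M" for js
  proof -
    obtain M where M: "\<forall>i\<in>I. normk (length js) (f i) \<le> M" using M by blast
    have "norm (pdl js (f i) x) \<le> M" if "i \<in> I" for i x
      using pdl_le_normk[OF f[OF that] order_refl, of js x] M that by force
    then show ?thesis by blast
  qed
  have der: "(pdl js (f i) has_derivative (\<lambda>v. \<Sum>j\<in>UNIV. v $ j * pdl (j # js) (f i) x)) (at x)" if "i \<in> I" for i js x
  proof (rule has_derivative_continuous_partials)
    have C: "Ckb (Suc (length js)) (f i)" by (rule f[OF that])
    show "((\<lambda>t. pdl js (f i) (x + t *\<^sub>R axis j 1)) has_real_derivative pdl (j # js) (f i) x) (at 0)" for x j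
      using C unfolding Ckb_def by simp
    show "continuous_on UNIV (pdl (j # js) (f i))" for j
      using C unfolding Ckb_def by (simp del: pdl.simps)
  qed
  have "bdd_Ck k I (\<lambda>i. pdl js (f i))" for k js
  proof (induction k arbitrary: js)
    case 0 then show ?case using bd by simp
  next
    case (Suc k)
    obtain M where M: "\<forall>i\<in>I. \<forall>x. norm (pdl js (f i) x) \<le> M" using bd by blast
    show ?case
    proof (rule bdd_Ck_SucI)
      show "norm (pdl js (f i) x) \<le> M" if "i \<in> I" for i x using M that by blast
      show "bdd_Ck k I (\<lambda>i x. \<Sum>j\<in>UNIV. v $ j * pdl (j # js) (f i) x)" for v
        using bdd_Ck_sum[of UNIV k I "\<lambda>j i x. v $ j *\<^sub>R pdl (j # js) (f i) x"]
          bdd_Ck_scale_const[OF order_refl Suc.IH] by (simp del: pdl.simps)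
    qed (rule der)
  qed
  from this[of _ "[]"] show ?thesis unfolding bdd_Cinf_def by simp
qed

lemma bdd_Cinf_comp_fun: "bdd_Cinf I f \<Longrightarrow> bdd_Cinf I (\<lambda>i. comp_fun (f i) j)"
  unfolding comp_fun_def by (rule bdd_Cinf_bounded_linear[OF bounded_linear_vec_nth])

lemma bdd_Cinf_componentwise:
  fixes f :: "'i \<Rightarrow> real^'n::finite \<Rightarrow> real^'n"
  assumes "\<And>j. bdd_Cinf I (\<lambda>i. comp_fun (f i) j)"
  shows "bdd_Cinf I f"
proof (rule bdd_Cinf_cong)
  show "bdd_Cinf I (\<lambda>i x. \<Sum>j\<in>UNIV. comp_fun (f i) j x *\<^sub>R axis j (1::real))"
    by (intro bdd_Cinf_sum bdd_Cinf_bounded_linear[OF bounded_linear_scaleR_left] assms finite)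
  show "(\<Sum>j\<in>UNIV. comp_fun (f i) j x *\<^sub>R axis j (1::real)) = f i x" for i x
    using basis_expansion[of "f i x"] by (simp add: scalar_mult_eq_scaleR comp_fun_def)
qed

lemma uniform_limit_pdl:
  fixes f :: "'e \<Rightarrow> real^'n::finite \<Rightarrow> real"
  assumes f: "bdd_Cinf I f" and g: "Cinf_bdd g" and ev: "\<forall>\<^sub>F e in F. e \<in> I"
    and lim: "uniform_limit UNIV f g F"
  shows "uniform_limit UNIV (\<lambda>e. pdl js (f e)) (pdl js g) F"
proof (induction js)
  case Nil then show ?case using lim by simp
next
  case (Cons j js)
  \<comment> \<open>The one-point second index fits the form of \<open>uniform_limit_fd\<close>,
    which carries a parameter set.\<close>
  have f': "bdd_Cinf (I \<times> {()}) (\<lambda>q. pdl js (f (fst q)))"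
    by (rule bdd_Cinf_reindex[OF bdd_Cinf_pdl[OF f]]) auto
  have "uniform_limit ({()} \<times> UNIV) (\<lambda>e p. pdl js (f e) (snd p)) (\<lambda>p. pdl js g (snd p)) F"
    by (rule uniform_limit_compose'[OF Cons, of snd]) auto
  from uniform_limit_fd[OF f' bdd_Cinf_pdl[OF g] ev, of js "axis j 1"] this
  have "uniform_limit ({()} \<times> UNIV) (\<lambda>e p. fd (pdl js (f e)) (snd p) (axis j 1)) (\<lambda>p. fd (pdl js g) (snd p) (axis j 1)) F"
    by simp
  from uniform_limit_compose'[OF this, of "\<lambda>x. ((), x)" UNIV]
  have "uniform_limit UNIV (\<lambda>e x. fd (pdl js (f e)) x (axis j 1)) (\<lambda>x. fd (pdl js g) x (axis j 1)) F"
    by simp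
  then show ?case
  proof (rule uniform_limit_cong[THEN iffD1, rotated 2])
    show "\<forall>\<^sub>F e in F. \<forall>x\<in>UNIV. fd (pdl js (f e)) x (axis j 1) = pdl (j # js) (f e) x"
      using ev by eventually_elim (use pdl_Cons_fd[OF f] in auto)
  qed (use pdl_Cons_fd[OF g, of "()"] in auto)
qed

text \<open>Bounds of every order upgrade sup convergence to convergence in each
  \<open>normk\<close>; there are finitely many derivatives up to order k, so their convergence can
  be used simultaneously.\<close>

lemma tendsto_normk:
  fixes f :: "'e \<Rightarrow> real^'n::finite \<Rightarrow> real"
  assumes f: "bdd_Cinf I f" and g: "Cinf_bdd g" and ev: "\<forall>\<^sub>F e in F. e \<in> I"
    and lim: "uniform_limit UNIV f g F"
  shows "((\<lambda>e. normk k (\<lambda>x. f e x - g x)) \<longlongrightarrow> 0) F"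
proof (rule tendstoI)
  fix \<eta> :: real assume "\<eta> > 0"
  then have \<eta>: "\<eta> / 2 > 0" by simp
  have "\<forall>\<^sub>F e in F. \<forall>js\<in>{js. length js \<le> k}. \<forall>x\<in>UNIV. dist (pdl js (f e) x) (pdl js g x) < \<eta> / 2"
    by (rule eventually_ball_finite[OF finite_multi_indices])
       (intro ballI uniform_limitD[OF uniform_limit_pdl[OF assms] \<eta>])
  with ev show "\<forall>\<^sub>F e in F. dist (normk k (\<lambda>x. f e x - g x)) 0 < \<eta>"
  proof eventually_elim
    case (elim e)
    have C: "Ckb k (f e)" "Ckb k g" using Cinf_bdd_Ckb bdd_Cinf_member[OF f elim(1)] g by blast+
    have "normk k (\<lambda>x. f e x - g x) \<le> \<eta> / 2"
    proof (rule normk_le)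
      fix js :: "'n list" and x assume js: "length js \<le> k"
      show "\<bar>pdl js (\<lambda>x. f e x - g x) x\<bar> \<le> \<eta> / 2"
        unfolding pdl_diff[OF C js] using elim(2) js by (auto simp: dist_norm less_imp_le)
    qed
    then show ?case using normk_nonneg[OF Ckb_diff[OF C]] \<open>\<eta> > 0\<close> by (simp add: dist_norm)
  qed
qed

lemma uniform_limit_of_normk:
  fixes f :: "'e \<Rightarrow> real^'n::finite \<Rightarrow> real"
  assumes f: "\<forall>\<^sub>F e in F. Ckb k (f e)" and h: "Ckb k h"
    and lim: "((\<lambda>e. normk k (\<lambda>x. f e x - h x)) \<longlongrightarrow> 0) F"
  shows "uniform_limit UNIV f h F"
proof (rule uniform_limitI)
  fix \<eta> :: real assume \<eta>: "\<eta> > 0"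
  show "\<forall>\<^sub>F e in F. \<forall>x\<in>UNIV. dist (f e x) (h x) < \<eta>"
    using f tendstoD[OF lim \<eta>]
  proof eventually_elim
    case (elim e)
    have bd: "\<bar>f e x - h x\<bar> \<le> normk k (\<lambda>x. f e x - h x)" for x
      using pdl_le_normk[OF Ckb_diff[OF elim(1) h], of "[]" x] by simp
    have "normk k (\<lambda>x. f e x - h x) < \<eta>" using elim(2) by (simp add: dist_norm abs_less_iff)
    from le_less_trans[OF bd this] show ?case by (simp add: dist_norm)
  qed
qed

section \<open>Almost periodicity through sup convergence of translates\<close>

lemma Cinf_ap_Ckb:
  assumes "f \<in> Cinf_ap" shows "Ckb k (comp_fun f j)"
proof -
  \<comment> \<open>\<open>Cinf_ap\<close> speaks of orders k \<ge> 1 only; passing through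
    \<open>Suc k\<close> includes order 0.\<close>
  have "Ckb (Suc k) (comp_fun f j)" using assms unfolding Cinf_ap_def Ckap_def by simp
  then show ?thesis unfolding Ckb_def by auto
qed

lemma Cinf_ap_Cinf_bdd:
  fixes f :: "real^'n::finite \<Rightarrow> real^'n"
  assumes "f \<in> Cinf_ap" shows "Cinf_bdd f"
  by (rule bdd_Cinf_componentwise, rule bdd_Cinf_of_normk) (use Cinf_ap_Ckb[OF assms] in auto)

lemma uniform_limit_componentwise:
  fixes f :: "'e \<Rightarrow> 'x \<Rightarrow> real^'n::finite"
  assumes "\<And>j. uniform_limit X (\<lambda>e x. f e x $ j) (h j) F"
  shows "uniform_limit X f (\<lambda>x. \<chi> j. h j x) F"
proof -
  have "uniform_limit X (\<lambda>e x. \<Sum>j\<in>UNIV. (f e x $ j) *\<^sub>R axis j (1::real))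
     (\<lambda>x. \<Sum>j\<in>UNIV. h j x *\<^sub>R axis j (1::real)) F"
    by (intro uniform_limit_sum finite bounded_linear.uniform_limit[OF bounded_linear_scaleR_left] assms)
  moreover have "(\<Sum>j\<in>UNIV. h j x *\<^sub>R axis j (1::real)) = (\<chi> j. h j x)" for x
    using basis_expansion[of "\<chi> j. h j x"] by (simp add: scalar_mult_eq_scaleR)
  ultimately show ?thesis
    using basis_expansion[of "f _ _"] by (simp add: scalar_mult_eq_scaleR)
qed

lemma uniform_limit_subseq:
  "uniform_limit X f l sequentially \<Longrightarrow> strict_mono r \<Longrightarrow> uniform_limit X (\<lambda>m. f (r m)) l sequentially"
  by (rule filterlim_compose[OF _ filterlim_subseq])

lemma bdd_Cinf_translates: "Cinf_bdd f \<Longrightarrow> bdd_Cinf UNIV (\<lambda>m x. f (x + c m))"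
  by (rule bdd_Cinf_translate[OF Cinf_bdd_family])

lemma Cinf_bdd_limit:
  fixes f :: "nat \<Rightarrow> 'a::euclidean_space \<Rightarrow> 'b::euclidean_space"
  assumes "bdd_Cinf UNIV f" "uniform_limit UNIV f l sequentially"
  shows "Cinf_bdd l"
proof (rule bdd_Cinf_pointwise_limit)
  show "bdd_Cinf (UNIV \<times> {()}) (\<lambda>p. f (fst p))" by (rule bdd_Cinf_reindex[OF assms(1)]) auto
  show "(\<lambda>n. f (fst (n, i)) x) \<longlonglongrightarrow> l x" for i x
    using tendsto_uniform_limitI[OF assms(2), of x] by simp
qed

text \<open>Precompactness is given for each component separately, so subsequences are refined over
  the finitely many components. Only sup convergence is kept; smoothness of the limit comes from the
  bounds that all translates share.\<close>

lemma Cinf_ap_subseq: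
  fixes f :: "real^'n::finite \<Rightarrow> real^'n" and c :: "nat \<Rightarrow> real^'n"
  assumes f: "f \<in> Cinf_ap"
  obtains r l where "strict_mono r" "Cinf_bdd l"
    "uniform_limit UNIV (\<lambda>m x. f (x + c (r m))) l sequentially"
proof -
  have "\<exists>r h. strict_mono r \<and> (\<forall>j\<in>S. uniform_limit UNIV (\<lambda>m x. f (x + c (r m)) $ j) (h j) sequentially)"
    if "finite S" for S
    using that
  proof (induction S rule: finite_induct)
    case empty
    show ?case by (intro exI[of _ id]) (simp add: strict_mono_def)
  next
    case (insert i S)
    then obtain r h where r: "strict_mono r"
      and h: "\<And>j. j \<in> S \<Longrightarrow> uniform_limit UNIV (\<lambda>m x. f (x + c (r m)) $ j) (h j) sequentially" by blast
    \<comment> \<open>Order 1 is the lowest order that \<open>Cinf_ap\<close> supplies.\<close>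
    have K: "Ckap 1 (comp_fun f i)" using f unfolding Cinf_ap_def by simp
    then obtain r' h' where r': "strict_mono r'" and h': "Ckb 1 h'"
      "(\<lambda>m. normk 1 (\<lambda>x. comp_fun f i (x + (c \<circ> r) (r' m)) - h' x)) \<longlonglongrightarrow> 0"
      unfolding Ckap_def by blast
    have "uniform_limit UNIV (\<lambda>m x. comp_fun f i (x + (c \<circ> r) (r' m))) h' sequentially"
      by (rule uniform_limit_of_normk[OF _ h'])
         (use K in \<open>auto simp: Ckap_def intro!: always_eventually Ckb_translate\<close>)
    then have "uniform_limit UNIV (\<lambda>m x. f (x + c ((r \<circ> r') m)) $ j) ((h(i := h')) j) sequentially"
      if "j \<in> insert i S" for j
      using that insert.hyps uniform_limit_subseq[OF h r'] by (auto simp: comp_fun_def)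
    moreover have "strict_mono (r \<circ> r')" using r r' by (rule strict_mono_o)
    ultimately show ?case by blast
  qed
  from this[of UNIV] obtain r h where r: "strict_mono r"
    and h: "\<And>j. uniform_limit UNIV (\<lambda>m x. f (x + c (r m)) $ j) (h j) sequentially" by auto
  have u: "uniform_limit UNIV (\<lambda>m x. f (x + c (r m))) (\<lambda>x. \<chi> j. h j x) sequentially"
    by (rule uniform_limit_componentwise[OF h])
  show thesis
    by (rule that[OF r Cinf_bdd_limit[OF bdd_Cinf_translates[OF Cinf_ap_Cinf_bdd[OF f]] u] u])
qed

text \<open>Bochner's criterion in the sup norm is enough: all translates of f share its bounds of
  every order, so one subsequence and one limit serve all k and all components.\<close>

lemma Cinf_apI:
  fixes f :: "real^'n::finite \<Rightarrow> real^'n"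
  assumes f: "Cinf_bdd f"
    and c: "\<And>c :: nat \<Rightarrow> real^'n. \<exists>r l. strict_mono r \<and> uniform_limit UNIV (\<lambda>m x. f (x + c (r m))) l sequentially"
  shows "f \<in> Cinf_ap"
  unfolding Cinf_ap_def Ckap_def
proof (intro CollectI allI impI conjI)
  fix k :: nat and j :: 'n
  show "Ckb k (comp_fun f j)" by (rule Cinf_bdd_Ckb[OF bdd_Cinf_comp_fun[OF f]])
  fix c :: "nat \<Rightarrow> real^'n"
  obtain r l where r: "strict_mono r" and l: "uniform_limit UNIV (\<lambda>m x. f (x + c (r m))) l sequentially"
    using c by blast
  have b: "bdd_Cinf UNIV (\<lambda>m x. f (x + c (r m)))" by (rule bdd_Cinf_translates[OF f])
  have lC: "Cinf_bdd l" by (rule Cinf_bdd_limit[OF b l])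
  have "uniform_limit UNIV (\<lambda>m. comp_fun (\<lambda>x. f (x + c (r m))) j) (comp_fun l j) sequentially"
    unfolding comp_fun_def by (rule bounded_linear.uniform_limit[OF bounded_linear_vec_nth l])
  from tendsto_normk[OF bdd_Cinf_comp_fun[OF b] bdd_Cinf_comp_fun[OF lC] _ this, of k]
  have "(\<lambda>m. normk k (\<lambda>x. comp_fun f j (x + c (r m)) - comp_fun l j x)) \<longlonglongrightarrow> 0"
    by (simp add: comp_fun_def)
  then show "\<exists>r h. strict_mono r \<and> Ckb k h \<and>
      (\<lambda>m. normk k (\<lambda>x. comp_fun f j (x + c (r m)) - h x)) \<longlonglongrightarrow> 0"
    using r Cinf_bdd_Ckb[OF bdd_Cinf_comp_fun[OF lC]] by blast
qed

lemma Cinf_ap_subseq3: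
  fixes f g h :: "real^'n::finite \<Rightarrow> real^'n" and c :: "nat \<Rightarrow> real^'n"
  assumes f: "f \<in> Cinf_ap" and g: "g \<in> Cinf_ap" and h: "h \<in> Cinf_ap"
  obtains r f' g' h' where "strict_mono r" "Cinf_bdd f'" "Cinf_bdd g'" "Cinf_bdd h'"
    "uniform_limit UNIV (\<lambda>m x. f (x + c (r m))) f' sequentially"
    "uniform_limit UNIV (\<lambda>m x. g (x + c (r m))) g' sequentially"
    "uniform_limit UNIV (\<lambda>m x. h (x + c (r m))) h' sequentially"
proof -
  obtain r1 f' where 1: "strict_mono r1" "Cinf_bdd f'"
    "uniform_limit UNIV (\<lambda>m x. f (x + c (r1 m))) f' sequentially"
    by (rule Cinf_ap_subseq[OF f]) (rule that)
  obtain r2 g' where 2: "strict_mono r2" "Cinf_bdd g'"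
    "uniform_limit UNIV (\<lambda>m x. g (x + (c \<circ> r1) (r2 m))) g' sequentially"
    by (rule Cinf_ap_subseq[OF g, of "c \<circ> r1"]) (rule that)
  obtain r3 h' where 3: "strict_mono r3" "Cinf_bdd h'"
    "uniform_limit UNIV (\<lambda>m x. h (x + (c \<circ> r1 \<circ> r2) (r3 m))) h' sequentially"
    by (rule Cinf_ap_subseq[OF h, of "c \<circ> r1 \<circ> r2"]) (rule that)
  have sm: "strict_mono (r2 \<circ> r3)" "strict_mono (r1 \<circ> r2 \<circ> r3)"
    using 1(1) 2(1) 3(1) by (auto intro!: strict_mono_o)
  show thesis
    by (rule that[OF sm(2) 1(2) 2(2) 3(2)])
       (use uniform_limit_subseq[OF 1(3) sm(1)] uniform_limit_subseq[OF 2(3) 3(1)] 3(3) in simp_all)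
qed

lemma Cinf_ap_lincomb:
  fixes f g :: "real^'n::finite \<Rightarrow> real^'n"
  assumes f: "f \<in> Cinf_ap" and g: "g \<in> Cinf_ap"
  shows "(\<lambda>x. a *\<^sub>R f x + b *\<^sub>R g x) \<in> Cinf_ap"
proof (rule Cinf_apI)
  show "Cinf_bdd (\<lambda>x. a *\<^sub>R f x + b *\<^sub>R g x)"
    by (intro bdd_Cinf_add bdd_Cinf_scale_const[of _ "\<lambda>_. a" "\<bar>a\<bar>"] bdd_Cinf_scale_const[of _ "\<lambda>_. b" "\<bar>b\<bar>"]
         Cinf_ap_Cinf_bdd f g order_refl)
  fix c :: "nat \<Rightarrow> real^'n"
  obtain r f' g' h' where "strict_mono r" "Cinf_bdd f'" "Cinf_bdd g'" "Cinf_bdd h'"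
    and l: "uniform_limit UNIV (\<lambda>m x. f (x + c (r m))) f' sequentially"
    "uniform_limit UNIV (\<lambda>m x. g (x + c (r m))) g' sequentially"
    "uniform_limit UNIV (\<lambda>m x. g (x + c (r m))) h' sequentially"
    by (rule Cinf_ap_subseq3[OF f g g]) (rule that)
  have "uniform_limit UNIV (\<lambda>m x. a *\<^sub>R f (x + c (r m)) + b *\<^sub>R g (x + c (r m))) (\<lambda>x. a *\<^sub>R f' x + b *\<^sub>R g' x) sequentially"
    by (intro uniform_limit_add bounded_linear.uniform_limit[OF bounded_linear_scaleR_right] l)
  then show "\<exists>r l. strict_mono r \<and> uniform_limit UNIV (\<lambda>m x. a *\<^sub>R f (x + c (r m)) + b *\<^sub>R g (x + c (r m))) l sequentially"
    using \<open>strict_mono r\<close> by blast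
qed

lemma Cinf_ap_const: "(\<lambda>_. c) \<in> (Cinf_ap :: (real^'n::finite \<Rightarrow> real^'n) set)"
proof (rule Cinf_apI)
  show "Cinf_bdd (\<lambda>_. c)" by (rule bdd_Cinf_const[of _ "\<lambda>_. c" "norm c"]) simp
  show "\<exists>(r :: nat \<Rightarrow> nat) l. strict_mono r \<and> uniform_limit UNIV (\<lambda>m (x :: real^'n). c) l sequentially"
    by (intro exI[of _ id] exI[of _ "\<lambda>_. c"] conjI uniform_limit_const) (simp add: strict_mono_def)
qed

lemma Cinf_ap_scale: "f \<in> Cinf_ap \<Longrightarrow> (\<lambda>x. a *\<^sub>R f x) \<in> Cinf_ap"
  using Cinf_ap_lincomb[of f f a 0] by simp

text \<open>The limits of the translated fields are obtained only as \<open>Cinf_bdd\<close>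
  functions, which is why continuity of \<open>duhamel\<close> was established in that larger
  class.\<close>

lemma Cinf_ap_duhamel:
  fixes u v h :: "real^'n::finite \<Rightarrow> real^'n"
  assumes u: "u \<in> Cinf_ap" and v: "v \<in> Cinf_ap" and h: "h \<in> Cinf_ap"
  shows "duhamel u v h \<in> Cinf_ap"
proof (rule Cinf_apI)
  note C = Cinf_ap_Cinf_bdd[OF u] Cinf_ap_Cinf_bdd[OF v] Cinf_ap_Cinf_bdd[OF h]
  show "Cinf_bdd (duhamel u v h)" by (rule bdd_Cinf_duhamel[OF C])
  fix c :: "nat \<Rightarrow> real^'n"
  obtain r u' v' h' where r: "strict_mono r" and C': "Cinf_bdd u'" "Cinf_bdd v'" "Cinf_bdd h'"
    and l: "uniform_limit UNIV (\<lambda>m x. u (x + c (r m))) u' sequentially"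
    "uniform_limit UNIV (\<lambda>m x. v (x + c (r m))) v' sequentially"
    "uniform_limit UNIV (\<lambda>m x. h (x + c (r m))) h' sequentially"
    by (rule Cinf_ap_subseq3[OF u v h]) (rule that)
  have "uniform_limit UNIV (\<lambda>m. duhamel (\<lambda>x. u (x + c (r m))) (\<lambda>x. v (x + c (r m))) (\<lambda>x. h (x + c (r m))))
      (duhamel u' v' h') sequentially"
    by (rule uniform_limit_duhamel[OF bdd_Cinf_translates[OF C(1)] C'(1) l(1) bdd_Cinf_translates[OF C(2)] C'(2) l(2)
          bdd_Cinf_translates[OF C(3)] C'(3) l(3)]) simp
  then have "uniform_limit UNIV (\<lambda>m x. duhamel u v h (x + c (r m))) (duhamel u' v' h') sequentially"
    by (simp add: duhamel_translate[OF C(1,2), abs_def])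
  then show "\<exists>r l. strict_mono r \<and> uniform_limit UNIV (\<lambda>m x. duhamel u v h (x + c (r m))) l sequentially"
    using r by blast
qed

section \<open>Convergence in the Frechet space\<close>

lemma vnormk_tendsto_iff:
  fixes f :: "'e \<Rightarrow> real^'n::finite \<Rightarrow> real^'n"
  assumes "\<forall>\<^sub>F e in F. \<forall>j. Ckb k (comp_fun (f e) j)"
  shows "((\<lambda>e. vnormk k (f e)) \<longlongrightarrow> 0) F \<longleftrightarrow> (\<forall>j. ((\<lambda>e. normk k (comp_fun (f e) j)) \<longlongrightarrow> 0) F)"
proof
  assume lim: "((\<lambda>e. vnormk k (f e)) \<longlongrightarrow> 0) F"
  show "\<forall>j. ((\<lambda>e. normk k (comp_fun (f e) j)) \<longlongrightarrow> 0) F"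
  proof
    fix j
    show "((\<lambda>e. normk k (comp_fun (f e) j)) \<longlongrightarrow> 0) F"
    proof (rule Lim_null_comparison[OF _ lim])
      show "\<forall>\<^sub>F e in F. norm (normk k (comp_fun (f e) j)) \<le> vnormk k (f e)"
        using assms by eventually_elim (auto simp: vnormk_def normk_nonneg intro!: Max_ge)
    qed
  qed
next
  assume lim: "\<forall>j. ((\<lambda>e. normk k (comp_fun (f e) j)) \<longlongrightarrow> 0) F"
  show "((\<lambda>e. vnormk k (f e)) \<longlongrightarrow> 0) F"
  proof (rule tendstoI)
    fix \<eta> :: real assume "\<eta> > 0"
    then have "\<forall>\<^sub>F e in F. \<forall>j\<in>UNIV. dist (normk k (comp_fun (f e) j)) 0 < \<eta>"
      using lim by (intro eventually_ball_finite ballI tendstoD) auto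
    then show "\<forall>\<^sub>F e in F. dist (vnormk k (f e)) 0 < \<eta>"
    proof eventually_elim
      case (elim e)
      have "vnormk k (f e) \<in> range (\<lambda>j. normk k (comp_fun (f e) j))"
        unfolding vnormk_def by (rule Max_in) auto
      then show ?case using elim by auto
    qed
  qed
qed

lemma comp_fun_diff: "comp_fun (\<lambda>x. f x - g x) j = (\<lambda>x. comp_fun f j x - comp_fun g j x)"
  by (simp add: comp_fun_def)

lemma Cinf_ap_diff_Ckb: "f \<in> Cinf_ap \<Longrightarrow> g \<in> Cinf_ap \<Longrightarrow> Ckb k (comp_fun (\<lambda>x. f x - g x) j)"
  unfolding comp_fun_diff by (intro Ckb_diff Cinf_ap_Ckb)

text \<open>Convergence in the Frechet topology is always verified in this form: almost periodic
  terms, bounds of every order, and convergence in the sup norm alone.\<close>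

lemma ap_tendstoI:
  fixes f :: "'e \<Rightarrow> real^'n::finite \<Rightarrow> real^'n"
  assumes f: "bdd_Cinf I f" and ev: "\<forall>\<^sub>F e in F. e \<in> I" and ap: "\<And>e. e \<in> I \<Longrightarrow> f e \<in> Cinf_ap"
    and l: "l \<in> Cinf_ap" and lim: "uniform_limit UNIV f l F"
  shows "ap_tendsto f l F"
  unfolding ap_tendsto_def
proof (intro conjI allI)
  show ev': "\<forall>\<^sub>F e in F. f e \<in> Cinf_ap" using ev by eventually_elim (rule ap)
  fix k
  have "((\<lambda>e. normk k (comp_fun (\<lambda>x. f e x - l x) j)) \<longlongrightarrow> 0) F" for j
    unfolding comp_fun_diff
  proof (rule tendsto_normk[OF bdd_Cinf_comp_fun[OF f] bdd_Cinf_comp_fun[OF Cinf_ap_Cinf_bdd[OF l]] ev])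
    show "uniform_limit UNIV (\<lambda>e. comp_fun (f e) j) (comp_fun l j) F"
      unfolding comp_fun_def by (rule bounded_linear.uniform_limit[OF bounded_linear_vec_nth lim])
  qed
  moreover have "\<forall>\<^sub>F e in F. \<forall>j. Ckb k (comp_fun (\<lambda>x. f e x - l x) j)"
    using ev' by eventually_elim (simp add: Cinf_ap_diff_Ckb l)
  ultimately show "((\<lambda>e. vnormk k (\<lambda>x. f e x - l x)) \<longlongrightarrow> 0) F"
    by (simp add: vnormk_tendsto_iff)
qed (rule l)

lemma ap_tendsto_normk:
  fixes f :: "'e \<Rightarrow> real^'n::finite \<Rightarrow> real^'n"
  assumes "ap_tendsto f l F"
  shows "((\<lambda>e. normk k (comp_fun (\<lambda>x. f e x - l x) j)) \<longlongrightarrow> 0) F"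
proof -
  have "\<forall>\<^sub>F e in F. \<forall>j. Ckb k (comp_fun (\<lambda>x. f e x - l x) j)"
    using assms unfolding ap_tendsto_def by (auto elim!: eventually_mono intro: Cinf_ap_diff_Ckb)
  from vnormk_tendsto_iff[OF this] assms show ?thesis unfolding ap_tendsto_def by blast
qed

lemma ap_tendsto_uniform_limit:
  fixes f :: "'e \<Rightarrow> real^'n::finite \<Rightarrow> real^'n"
  assumes a: "ap_tendsto f l F"
  shows "uniform_limit UNIV f l F"
proof -
  have ev: "\<forall>\<^sub>F e in F. f e \<in> Cinf_ap" and l: "l \<in> Cinf_ap" using a unfolding ap_tendsto_def by auto
  have "uniform_limit UNIV (\<lambda>e x. f e x $ j) (\<lambda>x. l x $ j) F" for j
  proof (rule uniform_limit_of_normk[where k=0])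
    show "\<forall>\<^sub>F e in F. Ckb 0 (\<lambda>x. f e x $ j)"
      using ev by eventually_elim (use Cinf_ap_Ckb in \<open>auto simp: comp_fun_def\<close>)
    show "Ckb 0 (\<lambda>x. l x $ j)" using Cinf_ap_Ckb[OF l, of 0 j] by (simp add: comp_fun_def)
    show "((\<lambda>e. normk 0 (\<lambda>x. f e x $ j - l x $ j)) \<longlongrightarrow> 0) F"
      using ap_tendsto_normk[OF a, of 0 j] by (simp add: comp_fun_def)
  qed
  from uniform_limit_componentwise[OF this] show ?thesis by simp
qed

text \<open>Stated for sequences: a convergent sequence of reals is bounded over all its terms,
  whereas along a general filter only an eventual bound would follow.\<close>

lemma ap_tendsto_bdd_Cinf:
  fixes f :: "nat \<Rightarrow> real^'n::finite \<Rightarrow> real^'n"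
  assumes a: "ap_tendsto f l sequentially" and f: "\<And>m. f m \<in> Cinf_ap"
  shows "bdd_Cinf UNIV f"
proof -
  have l: "l \<in> Cinf_ap" using a unfolding ap_tendsto_def by auto
  have "bdd_Cinf UNIV (\<lambda>m x. f m x - l x)"
  proof (rule bdd_Cinf_componentwise, rule bdd_Cinf_of_normk)
    fix j k
    show "Ckb k (comp_fun (\<lambda>x. f m x - l x) j)" for m by (rule Cinf_ap_diff_Ckb[OF f l])
    have "Bseq (\<lambda>m. normk k (comp_fun (\<lambda>x. f m x - l x) j))"
      by (rule convergent_imp_Bseq) (use ap_tendsto_normk[OF a] in \<open>auto simp: convergent_def\<close>)
    then obtain K where "\<And>m. norm (normk k (comp_fun (\<lambda>x. f m x - l x) j)) \<le> K"
      by (auto simp: Bseq_def)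
    then have "normk k (comp_fun (\<lambda>x. f m x - l x) j) \<le> K" for m by (simp add: abs_le_D1)
    then show "\<exists>M. \<forall>m\<in>UNIV. normk k (comp_fun (\<lambda>x. f m x - l x) j) \<le> M" by blast
  qed
  from bdd_Cinf_add[OF this Cinf_bdd_family[OF Cinf_ap_Cinf_bdd[OF l]]] show ?thesis by simp
qed

section \<open>The exponential map\<close>

lemma ap_tendsto_duhamel:
  fixes u v h :: "'e \<Rightarrow> real^'n::finite \<Rightarrow> real^'n"
  assumes ev: "\<forall>\<^sub>F e in F. e \<in> I"
    and bdd: "bdd_Cinf I u" "bdd_Cinf I v" "bdd_Cinf I h"
    and ap: "\<And>e. e \<in> I \<Longrightarrow> u e \<in> Cinf_ap" "\<And>e. e \<in> I \<Longrightarrow> v e \<in> Cinf_ap" "\<And>e. e \<in> I \<Longrightarrow> h e \<in> Cinf_ap"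
    and l: "u0 \<in> Cinf_ap" "v0 \<in> Cinf_ap" "h0 \<in> Cinf_ap"
    and lim: "uniform_limit UNIV u u0 F" "uniform_limit UNIV v v0 F" "uniform_limit UNIV h h0 F"
  shows "ap_tendsto (\<lambda>e. duhamel (u e) (v e) (h e)) (duhamel u0 v0 h0) F"
proof (rule ap_tendstoI[OF bdd_Cinf_duhamel[OF bdd] ev])
  show "uniform_limit UNIV (\<lambda>e. duhamel (u e) (v e) (h e)) (duhamel u0 v0 h0) F"
    by (rule uniform_limit_duhamel[OF bdd(1) Cinf_ap_Cinf_bdd[OF l(1)] lim(1) bdd(2) Cinf_ap_Cinf_bdd[OF l(2)] lim(2)
          bdd(3) Cinf_ap_Cinf_bdd[OF l(3)] lim(3) ev])
qed (intro Cinf_ap_duhamel ap l; assumption)+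

lemma ap_tendsto_cong:
  assumes "ap_tendsto g l F" "\<forall>\<^sub>F e in F. f e = g e"
  shows "ap_tendsto f l F"
  unfolding ap_tendsto_def
proof (intro conjI allI)
  show "l \<in> Cinf_ap" using assms(1) unfolding ap_tendsto_def by blast
  have "\<forall>\<^sub>F e in F. g e \<in> Cinf_ap" using assms(1) unfolding ap_tendsto_def by blast
  with assms(2) show "\<forall>\<^sub>F e in F. f e \<in> Cinf_ap" by eventually_elim simp
  fix k
  have "((\<lambda>e. vnormk k (\<lambda>x. g e x - l x)) \<longlongrightarrow> 0) F" using assms(1) unfolding ap_tendsto_def by blast
  then show "((\<lambda>e. vnormk k (\<lambda>x. f e x - l x)) \<longlongrightarrow> 0) F"
    by (rule Lim_transform_eventually) (use assms(2) in eventually_elim, simp)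
qed

lemma uniform_limit_scale:
  fixes u :: "'a::euclidean_space \<Rightarrow> 'b::euclidean_space"
  assumes c: "(c \<longlongrightarrow> c0) F" and u: "Cinf_bdd u"
  shows "uniform_limit UNIV (\<lambda>e x. c e *\<^sub>R u x) (\<lambda>x. c0 *\<^sub>R u x) F"
proof (rule bounded_bilinear.bounded_uniform_limit[OF bounded_bilinear_scaleR])
  show "uniform_limit UNIV (\<lambda>e x. c e) (\<lambda>x. c0) F"
    by (rule uniform_limitI) (use tendstoD[OF c] in auto)
  show "uniform_limit UNIV (\<lambda>e. u) u F" by (rule uniform_limit_const)
  obtain M where "M \<ge> 0" "\<And>i x. i \<in> {()} \<Longrightarrow> norm (u x) \<le> M"
    by (rule bdd_Cinf_bounded[OF u]) (rule that)
  then show "bounded (u ` UNIV)" unfolding bounded_iff by blast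
  show "bounded ((\<lambda>x. c0) ` UNIV)" by simp
qed

lemma flow_scale_1:
  assumes "Cinf_bdd u" "t \<ge> 0"
  shows "flow (\<lambda>x. t *\<^sub>R u x) 1 = flow u t"
  using flow_scale[OF Cinf_bdd_Lip_bdd[OF assms(1)] assms(2), of 1] by (simp add: fun_eq_iff)

text \<open>Exhibits u composed with its flow as a value of \<open>duhamel\<close>, so that its
  almost periodicity and its continuity in t come from the results on the operator.\<close>

lemma duhamel_scaled_self:
  assumes u: "Cinf_bdd u" and t: "t \<ge> 0"
  shows "duhamel (\<lambda>x. t *\<^sub>R u x) (\<lambda>x. t *\<^sub>R u x) u x = u (flow u t x)"
\<comment> \<open>The general case divides by t; at t = 0 both fields vanish and their flows are the
  identity.\<close>
proof (cases "t = 0")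
  case True
  then show ?thesis
    using duhamel_const[of 0 u x] flow_0[OF Cinf_bdd_Lip_bdd[OF u]] by simp
next
  case False
  have tu: "Cinf_bdd (\<lambda>x. t *\<^sub>R u x)"
    by (rule bdd_Cinf_scale_const[of _ "\<lambda>_. t" "\<bar>t\<bar>", OF _ u]) simp
  have "t *\<^sub>R duhamel (\<lambda>x. t *\<^sub>R u x) (\<lambda>x. t *\<^sub>R u x) u x = t *\<^sub>R u (flow u t x)"
    using duhamel_self[OF tu, of x] by (simp add: duhamel_scale[OF tu] flow_scale_1[OF u t])
  then show ?thesis using False by simp
qed

text \<open>The displacement is the difference between the flow and that of the zero field, hence a
  value of \<open>duhamel\<close>.\<close>

lemma flow_minus_id_Cinf_ap:
  fixes u :: "real^'n::finite \<Rightarrow> real^'n"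
  assumes u: "u \<in> Cinf_ap" and t: "t \<ge> 0"
  shows "(\<lambda>x. flow u t x - x) \<in> Cinf_ap"
proof -
  note C = Cinf_ap_Cinf_bdd[OF u] and tu = Cinf_ap_scale[OF u, of t]
  have "flow u t x - x = duhamel (\<lambda>_. 0) (\<lambda>x. t *\<^sub>R u x) (\<lambda>x. t *\<^sub>R u x) x" for x
    using flow_difference[OF Cinf_ap_Cinf_bdd[OF Cinf_ap_const[of 0]] Cinf_ap_Cinf_bdd[OF tu], of x]
    by (simp add: flow_const flow_scale_1[OF C t])
  then have "(\<lambda>x. flow u t x - x) = duhamel (\<lambda>_. 0) (\<lambda>x. t *\<^sub>R u x) (\<lambda>x. t *\<^sub>R u x)"
    by (rule ext)
  then show ?thesis using Cinf_ap_duhamel[OF Cinf_ap_const[of 0] tu tu] by (simp only:)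
qed

section \<open>The Jacobian bound and the flow as a curve of diffeomorphisms\<close>

lemma mat_plus_jac_flow:
  fixes u :: "real^'n::finite \<Rightarrow> real^'n"
  assumes u: "Cinf_bdd u"
  shows "mat 1 + jac (\<lambda>y. flow u 1 y - y) x = matrix (fd (flow u 1) x)"
proof -
  let ?f = "\<lambda>y. flow u 1 y - y"
  have "(?f has_derivative fd ?f x) (at x)"
    using bdd_Cinf_has_fd[OF bdd_Cinf_flow[OF u], of "((), 1)" x] by simp
  from bounded_linear.has_derivative[OF bounded_linear_vec_nth this]
  have "pd j (comp_fun ?f i) x = fd ?f x (axis j 1) $ i" for i j
    unfolding comp_fun_def by (rule pd_has_derivative(2))
  then show ?thesis
    by (simp add: vec_eq_iff jac_def matrix_def mat_def fd_flow_eq[OF u] axis_def)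
qed

lemma tendsto_det:
  fixes A :: "'e \<Rightarrow> real^'n::finite^'n"
  assumes "\<And>i j. ((\<lambda>e. A e $ i $ j) \<longlongrightarrow> B $ i $ j) F"
  shows "((\<lambda>e. det (A e)) \<longlongrightarrow> det B) F"
  unfolding det_def by (intro tendsto_intros assms)

text \<open>\<open>flow u 1\<close> is an iterate of \<open>flow u (1 / N)\<close>, whose derivative is uniformly close to the
  identity for large \<open>N\<close>; by the chain rule the determinants multiply.\<close>

lemma det_flow_lower_bound:
  fixes u :: "real^'n::finite \<Rightarrow> real^'n"
  assumes u: "Cinf_bdd u"
  shows "\<exists>\<delta>>0. \<forall>x. \<delta> \<le> det (matrix (fd (flow u 1) x))"
proof -
  note ul = Cinf_bdd_Lip_bdd[OF u]
  let ?h = "\<lambda>N. inverse (real (Suc N))"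
  \<comment> \<open>A failure would give a point X N for each N. At these points the derivatives
    tend to the identity, as they do uniformly in space, so continuity of the determinant forces the
    limit 1, against the bound 1/2.\<close>
  have "\<exists>N. \<forall>x. 1 / 2 \<le> det (matrix (fd (flow u (?h N)) x))"
  proof (rule ccontr)
    assume "\<not> ?thesis"
    then obtain X where X: "\<And>N. det (matrix (fd (flow u (?h N)) (X N))) < 1 / 2"
      by (metis not_le)
    have z: "Cinf_bdd (\<lambda>_ :: real^'n. 0 :: real^'n)" by (rule Cinf_ap_Cinf_bdd[OF Cinf_ap_const])
    have fz: "fd (flow (\<lambda>_. 0) 1) y b = b" for y b :: "real^'n"
    proof -
      have "flow (\<lambda>_. 0 :: real^'n) 1 = (\<lambda>x. x)" by (simp add: flow_const fun_eq_iff)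
      then show ?thesis by simp
    qed
    have "(\<lambda>N. fd (flow u (?h N)) (X N) b) \<longlonglongrightarrow> b" for b
    proof (rule tendstoI)
      fix e :: real assume e: "e > 0"
      have "uniform_limit UNIV (\<lambda>N x. ?h N *\<^sub>R u x) (\<lambda>_. 0) sequentially"
        using uniform_limit_scale[OF LIMSEQ_inverse_real_of_nat u] by simp
      moreover have "bdd_Cinf UNIV (\<lambda>N x. ?h N *\<^sub>R u x)"
        by (rule bdd_Cinf_scale_const[where M=1, OF _ Cinf_bdd_family[OF u]]) (simp add: field_simps)
      ultimately have "uniform_limit ({0..1} \<times> UNIV) (\<lambda>N p. fd (flow (\<lambda>x. ?h N *\<^sub>R u x) (fst p)) (snd p) b)
        (\<lambda>p. fd (flow (\<lambda>_. 0) (fst p)) (snd p) b) sequentially"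
        by (intro uniform_limit_fd_flow[where I=UNIV] z) auto
      from uniform_limitD[OF this e]
      show "\<forall>\<^sub>F N in sequentially. dist (fd (flow u (?h N)) (X N) b) b < e"
      proof eventually_elim
        case (elim N)
        from elim[rule_format, of "(1, X N)"] show ?case
          by (simp add: fz flow_scale_1[OF u, of "?h N", simplified])
      qed
    qed
    then have "(\<lambda>N. fd (flow u (?h N)) (X N) b $ i) \<longlonglongrightarrow> b $ i" for b i
      by (rule tendsto_vec_nth)
    then have "(\<lambda>N. det (matrix (fd (flow u (?h N)) (X N)))) \<longlonglongrightarrow> det (mat 1 :: real^'n^'n)"
    proof (intro tendsto_det)
      fix i j :: 'n
      have "mat 1 $ i $ j = axis j (1::real) $ i" by (simp add: mat_def axis_def)
      then show "(\<lambda>N. matrix (fd (flow u (?h N)) (X N)) $ i $ j) \<longlonglongrightarrow> mat 1 $ i $ j"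
        using \<open>\<And>b i. (\<lambda>N. fd (flow u (?h N)) (X N) b $ i) \<longlonglongrightarrow> b $ i\<close>[of "axis j 1" i]
        by (simp only: matrix_def vec_lambda_beta)
    qed
    then have "det (mat 1 :: real^'n^'n) \<le> 1 / 2"
      by (rule LIMSEQ_le_const2) (use X in \<open>auto intro: less_imp_le\<close>)
    then show False by simp
  qed
  then obtain N where N: "\<And>x. 1 / 2 \<le> det (matrix (fd (flow u (?h N)) x))" by blast
  have h: "?h N \<in> {0..1}" by (simp add: field_simps)
  \<comment> \<open>The k-th step composes with one more flow of duration 1 / (N + 1) and costs a
    factor 1/2; time 1 is reached at k = N + 1.\<close>
  have "(1 / 2) ^ k \<le> det (matrix (fd (flow u (real k * ?h N)) x))" if "k \<le> Suc N" for k x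
    using that
  proof (induction k)
    case 0
    have "flow u 0 = (\<lambda>x. x)" by (simp add: flow_0[OF ul] fun_eq_iff)
    then show ?case by (simp add: matrix_id[unfolded id_def])
  next
    case (Suc k)
    let ?t = "real k * ?h N"
    have t: "?t \<in> {0..1}" using Suc.prems by (simp add: field_simps)
    note d1 = flow_has_fd[OF u t, of x] and d2 = flow_has_fd[OF u h, of "flow u ?t x"]
    have "flow u (real (Suc k) * ?h N) = (\<lambda>x. flow u (?h N) (flow u ?t x))"
    proof
      fix x
      have "real (Suc k) * ?h N = ?t + ?h N" by (simp add: algebra_simps)
      then show "flow u (real (Suc k) * ?h N) x = flow u (?h N) (flow u ?t x)"
        using flow_semigroup[OF ul, of "?h N" ?t x] t h by (metis atLeastAtMost_iff)
    qed
    then have "fd (flow u (real (Suc k) * ?h N)) x = fd (flow u (?h N)) (flow u ?t x) \<circ> fd (flow u ?t) x"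
      using fd_eqI[OF has_derivative_compose[OF d1 d2]] by (simp add: comp_def)
    then have "det (matrix (fd (flow u (real (Suc k) * ?h N)) x)) =
       det (matrix (fd (flow u (?h N)) (flow u ?t x))) * det (matrix (fd (flow u ?t) x))"
      using has_derivative_linear[OF d1] has_derivative_linear[OF d2] by (simp add: matrix_compose det_mul)
    moreover have "1 / 2 * (1 / 2) ^ k \<le> det (matrix (fd (flow u (?h N)) (flow u ?t x))) * det (matrix (fd (flow u ?t) x))"
      using Suc N[of "flow u ?t x"] by (intro mult_mono) (auto intro: order_trans[of 0 "1/2"])
    ultimately show ?case by simp
  qed
  from this[of "Suc N"] have "(1 / 2) ^ Suc N \<le> det (matrix (fd (flow u 1) x))" for x by simp
  then show ?thesis by (intro exI[of _ "(1 / 2) ^ Suc N"]) simp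
qed

lemma flow_Diff_ap:
  fixes u :: "real^'n::finite \<Rightarrow> real^'n"
  assumes u: "u \<in> Cinf_ap" and t: "t \<ge> 0"
  shows "flow u t \<in> Diff_ap"
proof -
  note C = Cinf_ap_Cinf_bdd[OF u] and tu = Cinf_ap_Cinf_bdd[OF Cinf_ap_scale[OF u, of t]]
  obtain \<delta> where d: "\<delta> > 0" "\<And>x. \<delta> \<le> det (matrix (fd (flow (\<lambda>x. t *\<^sub>R u x) 1) x))"
    using det_flow_lower_bound[OF tu] by blast
  have "\<delta> \<le> (INF x. det (mat 1 + jac (\<lambda>y. flow u t y - y) x))"
    using d(2) mat_plus_jac_flow[OF tu] by (intro cINF_greatest) (simp_all add: flow_scale_1[OF C t])
  then show ?thesis
    unfolding Diff_ap_def using d(1) flow_minus_id_Cinf_ap[OF u t] by simp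
qed

text \<open>Boundedness of the interval makes the fields s u a bounded family; removing t permits
  division by s - t.\<close>

lemma eventually_at_halfline_near:
  "t \<ge> 0 \<Longrightarrow> \<forall>\<^sub>F s in at t within {0..}. s \<in> {0..t + 1} - {t::real}"
  unfolding eventually_at by (intro exI[of _ 1]) (auto simp: dist_real_def)

lemma is_flow_flow:
  fixes u :: "real^'n::finite \<Rightarrow> real^'n"
  assumes u: "u \<in> Cinf_ap"
  shows "is_flow u (flow u)"
  unfolding is_flow_def
proof (intro conjI allI impI)
  note C = Cinf_ap_Cinf_bdd[OF u]
  show "flow u 0 = id" by (simp add: flow_0[OF Cinf_bdd_Lip_bdd[OF C]] fun_eq_iff)
  fix t :: real assume t: "t \<ge> 0"
  show "flow u t \<in> Diff_ap" by (rule flow_Diff_ap[OF u t])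
  let ?I = "{0..t + 1} - {t}"
  note ev = eventually_at_halfline_near[OF t]
  have bt: "bdd_Cinf ?I (\<lambda>s x. t *\<^sub>R u x)" and bs: "bdd_Cinf ?I (\<lambda>s x. s *\<^sub>R u x)"
    and b: "bdd_Cinf ?I (\<lambda>s. u)"
    by (rule bdd_Cinf_scale_const[where M="t + 1", OF _ Cinf_bdd_family[OF C]], use t in simp)+
      (rule Cinf_bdd_family[OF C])
  have lt: "uniform_limit UNIV (\<lambda>s x. t *\<^sub>R u x) (\<lambda>x. t *\<^sub>R u x) (at t within {0..})"
    and ls: "uniform_limit UNIV (\<lambda>s x. s *\<^sub>R u x) (\<lambda>x. t *\<^sub>R u x) (at t within {0..})"
    and l: "uniform_limit UNIV (\<lambda>s. u) u (at t within {0..})"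
    by (rule uniform_limit_scale[OF _ C], rule tendsto_intros)+ (rule uniform_limit_const)
  have lim: "duhamel (\<lambda>x. t *\<^sub>R u x) (\<lambda>x. t *\<^sub>R u x) u = (\<lambda>x. u (flow u t x))"
    using duhamel_scaled_self[OF C t] by (simp add: fun_eq_iff)
  \<comment> \<open>Because s u - t u = (s - t) u, the difference quotient in time is exactly this
    value of \<open>duhamel\<close>.\<close>
  have "ap_tendsto (\<lambda>s. duhamel (\<lambda>x. t *\<^sub>R u x) (\<lambda>x. s *\<^sub>R u x) u) (\<lambda>x. u (flow u t x)) (at t within {0..})"
    unfolding lim[symmetric]
    by (rule ap_tendsto_duhamel[OF ev bt bs b _ _ _ _ _ _ lt ls l]) (intro Cinf_ap_scale u)+
  then show "ap_tendsto (\<lambda>s x. (1 / (s - t)) *\<^sub>R (flow u s x - flow u t x)) (\<lambda>x. u (flow u t x)) (at t within {0..})"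
  proof (rule ap_tendsto_cong)
    show "\<forall>\<^sub>F s in at t within {0..}. (\<lambda>x. (1 / (s - t)) *\<^sub>R (flow u s x - flow u t x)) =
        duhamel (\<lambda>x. t *\<^sub>R u x) (\<lambda>x. s *\<^sub>R u x) u"
      using ev
    proof eventually_elim
      case (elim s)
      note tu = Cinf_ap_Cinf_bdd[OF Cinf_ap_scale[OF u]]
      have "flow u s x - flow u t x = (s - t) *\<^sub>R duhamel (\<lambda>x. t *\<^sub>R u x) (\<lambda>x. s *\<^sub>R u x) u x" for x
        using flow_difference[OF tu[of t] tu[of s], of x] elim t
        by (simp add: flow_scale_1[OF C] scaleR_left_diff_distrib[symmetric] duhamel_scale[OF tu])
      then show ?case using elim by (simp add: fun_eq_iff)
    qed
  qed
  \<comment> \<open>The same continuity with s u in both slots, where \<open>duhamel\<close> is u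
    composed with the flow at time s.\<close>
  have "ap_tendsto (\<lambda>s. duhamel (\<lambda>x. s *\<^sub>R u x) (\<lambda>x. s *\<^sub>R u x) u) (\<lambda>x. u (flow u t x)) (at t within {0..})"
    unfolding lim[symmetric]
    by (rule ap_tendsto_duhamel[OF ev bs bs b _ _ _ _ _ _ ls ls l]) (intro Cinf_ap_scale u)+
  then show "ap_tendsto (\<lambda>s x. u (flow u s x)) (\<lambda>x. u (flow u t x)) (at t within {0..})"
    by (rule ap_tendsto_cong) (use ev in eventually_elim, use duhamel_scaled_self[OF C] in auto)
qed

text \<open>Convergence in the Frechet space implies pointwise convergence, so a curve of
  diffeomorphisms solving the equation has ordinary trajectories; uniqueness is thereby reduced to
  the equation at each point.\<close>

lemma is_flow_ivp:
  fixes u :: "real^'n::finite \<Rightarrow> real^'n"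
  assumes "is_flow u \<phi>"
  shows "ivp u x (\<lambda>t. \<phi> t x)"
  unfolding ivp_def
proof (intro conjI allI impI)
  show "\<phi> 0 x = x" using assms by (simp add: is_flow_def)
  fix t :: real assume t: "t \<ge> 0"
  have "ap_tendsto (\<lambda>s x. (1 / (s - t)) *\<^sub>R (\<phi> s x - \<phi> t x)) (\<lambda>x. u (\<phi> t x)) (at t within {0..})"
    using assms t unfolding is_flow_def by simp
  from tendsto_uniform_limitI[OF ap_tendsto_uniform_limit[OF this], of x]
  have "((\<lambda>s. (1 / (s - t)) *\<^sub>R (\<phi> s x - \<phi> t x)) \<longlongrightarrow> u (\<phi> t x)) (at t within {0..})" by simp
  then have lim: "((\<lambda>s. norm ((1 / (s - t)) *\<^sub>R (\<phi> s x - \<phi> t x) - u (\<phi> t x))) \<longlongrightarrow> 0) (at t within {0..})"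
    by (rule tendsto_norm_zero[OF LIM_zero])
  have "((\<lambda>s. norm ((1 / norm (s - t)) *\<^sub>R (\<phi> s x - (\<phi> t x + (s - t) *\<^sub>R u (\<phi> t x))))) \<longlongrightarrow> 0) (at t within {0..})"
  proof (rule Lim_transform_eventually[OF lim])
    show "\<forall>\<^sub>F s in at t within {0..}. norm ((1 / (s - t)) *\<^sub>R (\<phi> s x - \<phi> t x) - u (\<phi> t x)) =
       norm ((1 / norm (s - t)) *\<^sub>R (\<phi> s x - (\<phi> t x + (s - t) *\<^sub>R u (\<phi> t x))))"
      using eventually_at_halfline_near[OF t]
    proof eventually_elim
      case (elim s)
      then have "(1 / (s - t)) *\<^sub>R (\<phi> s x - \<phi> t x) - u (\<phi> t x) =
          (1 / (s - t)) *\<^sub>R (\<phi> s x - (\<phi> t x + (s - t) *\<^sub>R u (\<phi> t x)))"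
        by (simp add: scaleR_diff_right scaleR_add_right)
      then show ?case by simp
    qed
  qed
  then show "((\<lambda>t. \<phi> t x) has_vector_derivative u (\<phi> t x)) (at t within {0..})"
    unfolding has_vector_derivative_def has_derivative_within
    by (intro conjI bounded_linear_scaleR_left) (rule tendsto_norm_zero_cancel)
qed

lemma is_flow_unique:
  fixes u :: "real^'n::finite \<Rightarrow> real^'n"
  assumes "u \<in> Cinf_ap" "is_flow u \<phi>" "t \<ge> 0"
  shows "\<phi> t = flow u t"
  using flow_unique[OF Cinf_bdd_Lip_bdd[OF Cinf_ap_Cinf_bdd[OF assms(1)]] is_flow_ivp[OF assms(2)] assms(3)]
  by (simp add: fun_eq_iff)

lemma Exp_LG_eq_flow:
  fixes u :: "real^'n::finite \<Rightarrow> real^'n"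
  assumes "u \<in> Cinf_ap" shows "Exp_LG u = flow u 1"
  unfolding Exp_LG_def
  by (rule is_flow_unique[OF assms someI[of "is_flow u", OF is_flow_flow[OF assms]]]) simp

text \<open>With v = u + e h the formula for flow differences carries the factor e exactly, so the
  directional derivative is the value at e = 0 of a continuous expression.\<close>

lemma has_dd_Exp_LG:
  fixes u h :: "real^'n::finite \<Rightarrow> real^'n"
  assumes u: "u \<in> Cinf_ap" and h: "h \<in> Cinf_ap"
  shows "has_dd (\<lambda>u x. Exp_LG u x - x) u h (duhamel u u h)"
  unfolding has_dd_def
proof (rule ap_tendsto_cong)
  note Cu = Cinf_ap_Cinf_bdd[OF u] and Ch = Cinf_ap_Cinf_bdd[OF h]
  let ?I = "{-1..1} - {0::real}"
  have ev: "\<forall>\<^sub>F e in at 0. e \<in> ?I"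
    unfolding eventually_at by (intro exI[of _ 1]) (auto simp: dist_real_def)
  have ap: "(\<lambda>x. u x + e *\<^sub>R h x) \<in> Cinf_ap" for e
    using Cinf_ap_lincomb[OF u h, of 1 e] by simp
  have "uniform_limit UNIV (\<lambda>e x. e *\<^sub>R h x) (\<lambda>x. 0 *\<^sub>R h x) (at (0::real))"
    by (rule uniform_limit_scale[OF _ Ch]) (rule tendsto_intros)
  then have lim: "uniform_limit UNIV (\<lambda>e x. u x + e *\<^sub>R h x) (\<lambda>x. u x + 0 *\<^sub>R h x) (at (0::real))"
    by (intro uniform_limit_add uniform_limit_const)
  show "ap_tendsto (\<lambda>e. duhamel u (\<lambda>x. u x + e *\<^sub>R h x) h) (duhamel u u h) (at 0)"
  proof (rule ap_tendsto_duhamel[OF ev])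
    show "bdd_Cinf ?I (\<lambda>e x. u x + e *\<^sub>R h x)"
      by (intro bdd_Cinf_add Cinf_bdd_family[OF Cu] bdd_Cinf_scale_const[where M=1, OF _ Cinf_bdd_family[OF Ch]]) auto
    show "uniform_limit UNIV (\<lambda>e x. u x + e *\<^sub>R h x) u (at (0::real))" using lim by simp
  qed (intro Cinf_bdd_family[OF Cu] Cinf_bdd_family[OF Ch] u h ap uniform_limit_const)+
  show "\<forall>\<^sub>F e in at 0. (\<lambda>y. (1 / e) *\<^sub>R (Exp_LG (\<lambda>z. u z + e *\<^sub>R h z) y - y - (Exp_LG u y - y))) =
      duhamel u (\<lambda>x. u x + e *\<^sub>R h x) h"
    using ev
  proof eventually_elim
    case (elim e)
    have "flow (\<lambda>z. u z + e *\<^sub>R h z) 1 y - flow u 1 y = e *\<^sub>R duhamel u (\<lambda>x. u x + e *\<^sub>R h x) h y" for y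
      using flow_difference[OF Cu Cinf_ap_Cinf_bdd[OF ap[of e]], of y] by (simp add: duhamel_scale[OF Cu])
    then show ?case using elim by (simp add: fun_eq_iff Exp_LG_eq_flow[OF u] Exp_LG_eq_flow[OF ap])
  qed
qed

section \<open>An almost periodic field with vanishing averages\<close>

text \<open>Differentiation advances the phase by pi / 2. With the phase as index the derivative is
  a multiple of a member of the same family, which closes the induction.\<close>

lemma bdd_Ck_cos: "bdd_Ck k UNIV (\<lambda>\<phi> x. cos (w \<bullet> x + \<phi>))"
proof (induction k)
  case 0
  show ?case by (auto intro!: exI[of _ 1])
next
  case (Suc k)
  show ?case
  proof (rule bdd_Ck_SucI)
    show "norm (cos (w \<bullet> x + \<phi>)) \<le> 1" for \<phi> x by simp
    show "((\<lambda>x. cos (w \<bullet> x + \<phi>)) has_derivative (\<lambda>v. (w \<bullet> v) *\<^sub>R cos (w \<bullet> x + (\<phi> + pi / 2)))) (at x)" for \<phi> x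
      by (auto intro!: derivative_eq_intros simp: cos_add sin_add algebra_simps)
    show "bdd_Ck k UNIV (\<lambda>\<phi> x. (w \<bullet> v) *\<^sub>R cos (w \<bullet> x + (\<phi> + pi / 2)))" for v
      by (rule bdd_Ck_scale_const[OF order_refl bdd_Ck_reindex[OF Suc, of UNIV "\<lambda>\<phi>. \<phi> + pi / 2"]]) simp
  qed
qed

text \<open>By the addition theorem a translate by d depends on d only through the point (cos (w
  \<bullet> d), sin (w \<bullet> d)) of the unit circle, where bounded sequences have convergent
  subsequences.\<close>

lemma Cinf_ap_cos:
  fixes w c :: "real^'n::finite"
  shows "(\<lambda>x. cos (w \<bullet> x) *\<^sub>R c) \<in> Cinf_ap"
proof (rule Cinf_apI)
  have "bdd_Cinf UNIV (\<lambda>\<phi> x. cos (w \<bullet> x + \<phi>))"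
    unfolding bdd_Cinf_def by (rule allI) (rule bdd_Ck_cos)
  from bdd_Cinf_reindex[OF this, of "{()}" "\<lambda>_. 0"] show "Cinf_bdd (\<lambda>x. cos (w \<bullet> x) *\<^sub>R c)"
    using bdd_Cinf_bounded_linear[OF bounded_linear_scaleR_left, of "{()}" "\<lambda>_ x. cos (w \<bullet> x)" c] by simp
  fix d :: "nat \<Rightarrow> real^'n"
  have "bounded (range (\<lambda>m. (cos (w \<bullet> d m), sin (w \<bullet> d m))))"
  proof -
    have "norm (cos (w \<bullet> d m), sin (w \<bullet> d m)) \<le> 1" for m by (simp add: norm_Pair)
    then show ?thesis unfolding bounded_iff by blast
  qed
  from bounded_imp_convergent_subsequence[OF this]
  obtain l r where r: "strict_mono r" and l: "((\<lambda>m. (cos (w \<bullet> d m), sin (w \<bullet> d m))) \<circ> r) \<longlonglongrightarrow> l" by blast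
  have C: "(\<lambda>m. cos (w \<bullet> d (r m))) \<longlonglongrightarrow> fst l" and S: "(\<lambda>m. sin (w \<bullet> d (r m))) \<longlonglongrightarrow> snd l"
    using tendsto_fst[OF l] tendsto_snd[OF l] by (simp_all add: comp_def)
  have uc: "uniform_limit UNIV (\<lambda>m x. a m) (\<lambda>x. b) sequentially" if "a \<longlonglongrightarrow> b" for a :: "nat \<Rightarrow> real" and b
    by (rule uniform_limitI) (use tendstoD[OF that] in auto)
  have b: "bounded (range (\<lambda>x. cos (w \<bullet> x)))" "bounded (range (\<lambda>x. sin (w \<bullet> x)))"
    unfolding bounded_iff by (auto intro!: exI[of _ 1])
  have "uniform_limit UNIV (\<lambda>m x. (cos (w \<bullet> x) * cos (w \<bullet> d (r m)) - sin (w \<bullet> x) * sin (w \<bullet> d (r m))) *\<^sub>R c)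
     (\<lambda>x. (cos (w \<bullet> x) * fst l - sin (w \<bullet> x) * snd l) *\<^sub>R c) sequentially"
    by (intro bounded_linear.uniform_limit[OF bounded_linear_scaleR_left] uniform_limit_minus
          uniform_lim_mult uniform_limit_const uc C S b) simp_all
  then have "uniform_limit UNIV (\<lambda>m x. cos (w \<bullet> (x + d (r m))) *\<^sub>R c)
     (\<lambda>x. (cos (w \<bullet> x) * fst l - sin (w \<bullet> x) * snd l) *\<^sub>R c) sequentially"
    by (simp add: inner_add_right cos_add)
  then show "\<exists>r l. strict_mono r \<and> uniform_limit UNIV (\<lambda>m x. cos (w \<bullet> (x + d (r m))) *\<^sub>R c) l sequentially"
    using r by blast
qed

lemma integral_cos_period: "integral {0..1} (\<lambda>s. cos (a + 2 * pi * s) *\<^sub>R (c::'a::banach)) = 0"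
proof (rule integral_unique)
  have "((\<lambda>s. cos (a + 2 * pi * s) *\<^sub>R c) has_integral
     ((sin (a + 2 * pi * 1) / (2 * pi)) *\<^sub>R c - (sin (a + 2 * pi * 0) / (2 * pi)) *\<^sub>R c)) {0..1}"
  proof (rule fundamental_theorem_of_calculus)
    show "((\<lambda>s. (sin (a + 2 * pi * s) / (2 * pi)) *\<^sub>R c) has_vector_derivative cos (a + 2 * pi * s) *\<^sub>R c) (at s within {0..1})" for s
    proof (rule has_vector_derivative_scaleR[where g'=0, simplified])
      show "((\<lambda>s. sin (a + 2 * pi * s) / (2 * pi)) has_real_derivative cos (a + 2 * pi * s)) (at s within {0..1})"
        by (auto intro!: derivative_eq_intros)
    qed (auto intro!: derivative_eq_intros)
  qed simp
  moreover have "sin (a + 2 * pi * 1) = sin a" by (simp add: sin_add)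
  ultimately show "((\<lambda>s. cos (a + 2 * pi * s) *\<^sub>R c) has_integral 0) {0..1}" by simp
qed

theorem theorem3p4:
  shows "(\<forall>u \<in> (Cinf_ap :: (real^'n::finite \<Rightarrow> real^'n) set).
            (\<exists>\<phi>. is_flow u \<phi>) \<and>
            (\<forall>\<phi> \<psi>. is_flow u \<phi> \<longrightarrow> is_flow u \<psi> \<longrightarrow> (\<forall>t\<ge>0. \<phi> t = \<psi> t)) \<and>
            Exp_LG u \<in> Diff_ap)
       \<and> C1F_ap (\<lambda>u x. Exp_LG u x - x :: real^'n)
       \<and> (\<forall>h \<in> (Cinf_ap :: (real^'n \<Rightarrow> real^'n) set).
            has_dd (\<lambda>u x. Exp_LG u x - x) (\<lambda>_. 0) h h)
       \<and> (\<forall>c :: real^'n. c \<noteq> 0 \<longrightarrow>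
            (\<exists>du \<in> Cinf_ap. du \<noteq> (\<lambda>_. 0) \<and>
               has_dd (\<lambda>u x. Exp_LG u x - x) (\<lambda>_. c) du (\<lambda>_. 0)))"
proof (intro conjI ballI allI impI)
  fix u :: "real^'n \<Rightarrow> real^'n" assume u: "u \<in> Cinf_ap"
  show "\<exists>\<phi>. is_flow u \<phi>" using is_flow_flow[OF u] by blast
  show "\<phi> t = \<psi> t" if "is_flow u \<phi>" "is_flow u \<psi>" "t \<ge> 0" for \<phi> \<psi> t
    using is_flow_unique[OF u that(1,3)] is_flow_unique[OF u that(2,3)] by simp
  show "Exp_LG u \<in> Diff_ap"
    unfolding Exp_LG_eq_flow[OF u] by (rule flow_Diff_ap[OF u]) simp
next
  show "C1F_ap (\<lambda>u x. Exp_LG u x - x :: real^'n)"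
    unfolding C1F_ap_def
  proof (intro conjI ballI exI[of _ "\<lambda>u h. duhamel u u h"] allI impI)
    show "(\<lambda>x. Exp_LG u x - x) \<in> Cinf_ap" if "u \<in> Cinf_ap" for u :: "real^'n \<Rightarrow> real^'n"
      unfolding Exp_LG_eq_flow[OF that] by (rule flow_minus_id_Cinf_ap[OF that]) simp
    show "has_dd (\<lambda>u x. Exp_LG u x - x) u h (duhamel u u h)"
      if "u \<in> Cinf_ap" "h \<in> Cinf_ap" for u h :: "real^'n \<Rightarrow> real^'n"
      by (rule has_dd_Exp_LG[OF that])
    fix us hs :: "nat \<Rightarrow> real^'n \<Rightarrow> real^'n" and u h
    assume ap: "\<forall>m. us m \<in> Cinf_ap \<and> hs m \<in> Cinf_ap" and l: "u \<in> Cinf_ap" "h \<in> Cinf_ap"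
      and us: "ap_tendsto us u sequentially" and hs: "ap_tendsto hs h sequentially"
    have b: "bdd_Cinf UNIV us" "bdd_Cinf UNIV hs"
      using ap_tendsto_bdd_Cinf[OF us] ap_tendsto_bdd_Cinf[OF hs] ap by blast+
    note lim = ap_tendsto_uniform_limit[OF us] ap_tendsto_uniform_limit[OF hs]
    show "ap_tendsto (\<lambda>m. duhamel (us m) (us m) (hs m)) (duhamel u u h) sequentially"
      by (rule ap_tendsto_duhamel[OF _ b(1) b(1) b(2) _ _ _ l(1) l(1) l(2) lim(1) lim(1) lim(2)])
         (use ap in simp_all)
  qed
next
  fix h :: "real^'n \<Rightarrow> real^'n" assume h: "h \<in> Cinf_ap"
  \<comment> \<open>For the zero field the segment of averaging shrinks to the point x.\<close>
  have "duhamel (\<lambda>_. 0) (\<lambda>_. 0) h = h" by (simp add: fun_eq_iff duhamel_const)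
  then show "has_dd (\<lambda>u x. Exp_LG u x - x) (\<lambda>_. 0) h h"
    using has_dd_Exp_LG[OF Cinf_ap_const[of 0] h] by simp
next
  fix c :: "real^'n" assume c: "c \<noteq> 0"
  \<comment> \<open>Normalised so that ?w \<bullet> c = 2 pi: along the segment from x to x + c the
    cosine runs through exactly one period.\<close>
  let ?w = "(2 * pi / (c \<bullet> c)) *\<^sub>R c"
  let ?du = "\<lambda>x. cos (?w \<bullet> x) *\<^sub>R c"
  show "\<exists>du \<in> Cinf_ap. du \<noteq> (\<lambda>_. 0) \<and> has_dd (\<lambda>u x. Exp_LG u x - x) (\<lambda>_. c) du (\<lambda>_. 0)"
  proof (intro bexI[of _ ?du] conjI)
    show "?du \<in> Cinf_ap" by (rule Cinf_ap_cos)
    \<comment> \<open>At the origin the cosine is 1 and the field takes the value c.\<close>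
    have "?du 0 \<noteq> 0" using c by simp
    then show "?du \<noteq> (\<lambda>_. 0)" by (rule contrapos_nn) (rule fun_cong)
    have eq: "?du (x + s *\<^sub>R c) = cos (?w \<bullet> x + 2 * pi * s) *\<^sub>R c" for x s
    proof -
      have "?w \<bullet> (x + s *\<^sub>R c) = ?w \<bullet> x + 2 * pi * s"
        using c by (simp add: inner_add_right)
      then show ?thesis by (simp only:)
    qed
    have "duhamel (\<lambda>_. c) (\<lambda>_. c) ?du x = 0" for x
      unfolding duhamel_const eq by (rule integral_cos_period)
    then have "duhamel (\<lambda>_. c) (\<lambda>_. c) ?du = (\<lambda>_. 0)" by (rule ext)
    with has_dd_Exp_LG[OF Cinf_ap_const[of c] Cinf_ap_cos[of ?w c]]
    show "has_dd (\<lambda>u x. Exp_LG u x - x) (\<lambda>_. c) ?du (\<lambda>_. 0)"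
      by (simp only:)
  qed
qed

end
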